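(* Let $M \models \mathrm{PA}$ and suppose that $M$ has an expansion $(M,T) \models \mathrm{PT}^- + \mathrm{INT}\upharpoonright_{\mathrm{tot}}$. Then $M$ is short recursively saturated.
   Context: Conventions. $\mathcal{L}_{\mathrm{PA}}$ is the language of Peano Arithmetic $\mathrm{PA}$ and $\mathcal{L}_T=\mathcal{L}_{\mathrm{PA}}\cup\{T\}$ with $T$ a new unary predicate. Syntax is arithmetized inside $\mathrm{PA}$, and symbols for syntactic operations on codes are suppressed (e.g. $T(\phi\vee\psi)$ means $T$ of the code of the disjunction). Inside arithmetic, $\phi,\psi$ range over codes of $\mathcal{L}_{\mathrm{PA}}$-sentences; $\phi(v)$ over codes of $\mathcal{L}_{\mathrm{PA}}$-formulae with at most one free variable; $s,t$ over codes of closed arithmetical terms; $v$ over codes of variables. $\underline{x}$ is (the code of) the standard numeral for $x$; $s^\circ$ is the value of the closed term coded by $s$. In the arithmetized language $\neg,\vee,\exists$ are primitive, and $\wedge,\forall$ are abbreviations. $\mathrm{PT}^-$ is the $\mathcal{L}_T$-theory consisting of $\mathrm{PA}$ (induction only for $\mathcal{L}_{\mathrm{PA}}$-formulae) and the axioms: (1a) $\forall s,t\,(T(s=t)\equiv s^\circ=t^\circ)$; (1b) $\forall s,t\,(T(\neg s=t)\equiv s^\circ\neq t^\circ)$; (2a) $\forall\phi,\psi\,(T(\phi\vee\psi)\equiv T(\phi)\vee T(\psi))$; (2b) $\forall\phi,\psi\,(T(\neg(\phi\vee\psi))\equiv T(\neg\phi)\wedge T(\neg\psi))$; (3a) $\forall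 v\forall\phi(v)\,(T(\exists v\phi)\equiv\exists x\,T(\phi(\underline{x})))$; (3b) $\forall v\forall\phi(v)\,(T(\neg\exists v\phi)\equiv\forall x\,T(\neg\phi(\underline{x})))$; (4) $\forall\phi\,(T(\neg\neg\phi)\equiv T(\phi))$; (5) $\forall\phi(v)\,\forall s,t\,(s^\circ=t^\circ\rightarrow(T(\phi(s))\equiv T(\phi(t))))$. $\mathrm{tot}(\phi(v))$ is the formula "$\phi(v)$ is an $\mathcal{L}_{\mathrm{PA}}$-formula with at most one free variable, and $\forall x\,(T(\phi(\underline{x}))\vee T(\neg\phi(\underline{x})))$". $\mathrm{INT}\upharpoonright_{\mathrm{tot}}$ is the $\mathcal{L}_T$-sentence $$\forall\phi(v)\Bigl[\mathrm{tot}(\phi(v))\rightarrow\Bigl(\forall x\,\bigl(T(\phi(\underline{x}))\rightarrow T(\phi(\underline{x+1}))\bigr)\rightarrow\bigl(T(\phi(0))\rightarrow\forall x\,T(\phi(\underline{x}))\bigr)\Bigr)\Bigr].$$ An expansion of $M$ is the same model together with an interpretation of the additional symbol. A model $M\models\mathrm{PA}$ is short recursively saturated if every recursive (finitely satisfiable in $M$) type with finitely many parameters from $M$ of the form $p(x)=\{x<a\wedge\phi_i(x) \mid i\in\mathbb{N}\}$, where $a\in M$ is some fixed parameter, is realised in $M$. *)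

theory Defs
  imports Main "HOL-Library.Nat_Bijection"
begin

section \<open>The languages of arithmetic\<close>

datatype trm = Var nat | Zero | Succ trm | Add trm trm | Mul trm trm

datatype fm = Equ trm trm | Neg fm | Or fm fm | Exi nat fm

datatype fmT = EquT trm trm | TrT trm | NegT fmT | OrT fmT fmT | ExiT nat fmT

primrec emb :: "fm \<Rightarrow> fmT" where
  "emb (Equ s t) = EquT s t"
| "emb (Neg p) = NegT (emb p)"
| "emb (Or p q) = OrT (emb p) (emb q)"
| "emb (Exi i p) = ExiT i (emb p)"

abbreviation And :: "fm \<Rightarrow> fm \<Rightarrow> fm" where "And p q \<equiv> Neg (Or (Neg p) (Neg q))"
abbreviation Imp :: "fm \<Rightarrow> fm \<Rightarrow> fm" where "Imp p q \<equiv> Or (Neg p) q"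
abbreviation All :: "nat \<Rightarrow> fm \<Rightarrow> fm" where "All i p \<equiv> Neg (Exi i (Neg p))"

primrec fvt :: "trm \<Rightarrow> nat set" where
  "fvt (Var i) = {i}"
| "fvt Zero = {}"
| "fvt (Succ t) = fvt t"
| "fvt (Add s t) = fvt s \<union> fvt t"
| "fvt (Mul s t) = fvt s \<union> fvt t"

primrec fv :: "fm \<Rightarrow> nat set" where
  "fv (Equ s t) = fvt s \<union> fvt t"
| "fv (Neg p) = fv p"
| "fv (Or p q) = fv p \<union> fv q"
| "fv (Exi i p) = fv p - {i}"

primrec substt :: "nat \<Rightarrow> trm \<Rightarrow> trm \<Rightarrow> trm" where
  "substt i u (Var j) = (if j = i then u else Var j)"
| "substt i u Zero = Zero"
| "substt i u (Succ t) = Succ (substt i u t)"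
| "substt i u (Add s t) = Add (substt i u s) (substt i u t)"
| "substt i u (Mul s t) = Mul (substt i u s) (substt i u t)"

text \<open>This substitution does not rename bound variables. It is only used for terms \<open>u\<close> whose
  variables are among \<open>{i}\<close>, and for these no capture is possible.\<close>

primrec subst :: "nat \<Rightarrow> trm \<Rightarrow> fm \<Rightarrow> fm" where
  "subst i u (Equ s t) = Equ (substt i u s) (substt i u t)"
| "subst i u (Neg p) = Neg (subst i u p)"
| "subst i u (Or p q) = Or (subst i u p) (subst i u q)"
| "subst i u (Exi j p) = Exi j (if j = i then p else subst i u p)"


section \<open>Structures and satisfaction\<close>

text \<open>The domain of a structure is the whole (arbitrary, nonempty) type \<open>'a\<close>.
  An expansion of \<open>M\<close> to the language with \<open>T\<close> is the pair of \<open>M\<close> and a set \<open>T\<close> of elements.\<close>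

record 'a arith_struct =
  zeroI :: "'a"
  succI :: "'a \<Rightarrow> 'a"
  addI :: "'a \<Rightarrow> 'a \<Rightarrow> 'a"
  mulI :: "'a \<Rightarrow> 'a \<Rightarrow> 'a"

primrec teval :: "'a arith_struct \<Rightarrow> (nat \<Rightarrow> 'a) \<Rightarrow> trm \<Rightarrow> 'a" where
  "teval M e (Var i) = e i"
| "teval M e Zero = zeroI M"
| "teval M e (Succ t) = succI M (teval M e t)"
| "teval M e (Add s t) = addI M (teval M e s) (teval M e t)"
| "teval M e (Mul s t) = mulI M (teval M e s) (teval M e t)"

primrec sat :: "'a arith_struct \<Rightarrow> (nat \<Rightarrow> 'a) \<Rightarrow> fm \<Rightarrow> bool" where
  "sat M e (Equ s t) \<longleftrightarrow> teval M e s = teval M e t"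
| "sat M e (Neg p) \<longleftrightarrow> \<not> sat M e p"
| "sat M e (Or p q) \<longleftrightarrow> sat M e p \<or> sat M e q"
| "sat M e (Exi i p) \<longleftrightarrow> (\<exists>b. sat M (e(i := b)) p)"

primrec satT :: "'a arith_struct \<Rightarrow> 'a set \<Rightarrow> (nat \<Rightarrow> 'a) \<Rightarrow> fmT \<Rightarrow> bool" where
  "satT M T e (EquT s t) \<longleftrightarrow> teval M e s = teval M e t"
| "satT M T e (TrT t) \<longleftrightarrow> teval M e t \<in> T"
| "satT M T e (NegT p) \<longleftrightarrow> \<not> satT M T e p"
| "satT M T e (OrT p q) \<longleftrightarrow> satT M T e p \<or> satT M T e q"
| "satT M T e (ExiT i p) \<longleftrightarrow> (\<exists>b. satT M T (e(i := b)) p)"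

text \<open>Free variables of axioms are read as universally quantified.\<close>

definition models :: "'a arith_struct \<Rightarrow> fm set \<Rightarrow> bool" where
  "models M \<Gamma> \<longleftrightarrow> (\<forall>p\<in>\<Gamma>. \<forall>e. sat M e p)"

definition modelsT :: "'a arith_struct \<Rightarrow> 'a set \<Rightarrow> fmT set \<Rightarrow> bool" where
  "modelsT M T \<Gamma> \<longleftrightarrow> (\<forall>p\<in>\<Gamma>. \<forall>e. satT M T e p)"


section \<open>Peano Arithmetic\<close>

definition PA_basic :: "fm set" where
  "PA_basic =
    {Neg (Equ (Succ (Var 0)) Zero),
     Imp (Equ (Succ (Var 0)) (Succ (Var 1))) (Equ (Var 0) (Var 1)),
     Equ (Add (Var 0) Zero) (Var 0),
     Equ (Add (Var 0) (Succ (Var 1))) (Succ (Add (Var 0) (Var 1))),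
     Equ (Mul (Var 0) Zero) Zero,
     Equ (Mul (Var 0) (Succ (Var 1))) (Add (Mul (Var 0) (Var 1)) (Var 0))}"

definition induction_axiom :: "nat \<Rightarrow> fm \<Rightarrow> fm" where
  "induction_axiom i p =
    Imp (And (subst i Zero p) (All i (Imp p (subst i (Succ (Var i)) p)))) (All i p)"

definition PA :: "fm set" where
  "PA = PA_basic \<union> {induction_axiom i p | i p. True}"


section \<open>Formula schemes\<close>

text \<open>To write down concrete formulae of the object language readably, binders are written in
  higher-order style. An element of \<open>nat \<Rightarrow> fm\<close> awaits the least variable index \<open>n\<close> not yet in
  use; a quantifier takes \<open>Var n\<close> as its bound variable and passes \<open>Suc n\<close> to its body. Applied
  to \<open>0\<close>, a scheme without parameters yields a sentence, and no capture ever occurs.\<close>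

type_synonym scheme = "nat \<Rightarrow> fm"

definition sEq :: "trm \<Rightarrow> trm \<Rightarrow> scheme" (infix "\<^bold>=" 50) where
  "(s \<^bold>= t) = (\<lambda>n. Equ s t)"
definition sNot :: "scheme \<Rightarrow> scheme" ("\<^bold>\<not> _" [40] 40) where
  "(\<^bold>\<not> A) = (\<lambda>n. Neg (A n))"
definition sOr :: "scheme \<Rightarrow> scheme \<Rightarrow> scheme" (infixr "\<^bold>\<or>" 30) where
  "(A \<^bold>\<or> B) = (\<lambda>n. Or (A n) (B n))"
definition sEx :: "(trm \<Rightarrow> scheme) \<Rightarrow> scheme" (binder "\<^bold>\<exists>" 10) where
  "sEx F = (\<lambda>n. Exi n (F (Var n) (Suc n)))"

abbreviation sAnd :: "scheme \<Rightarrow> scheme \<Rightarrow> scheme" (infixr "\<^bold>\<and>" 35) where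
  "(A \<^bold>\<and> B) \<equiv> \<^bold>\<not> (\<^bold>\<not> A \<^bold>\<or> \<^bold>\<not> B)"
abbreviation sImp :: "scheme \<Rightarrow> scheme \<Rightarrow> scheme" (infixr "\<^bold>\<longrightarrow>" 25) where
  "(A \<^bold>\<longrightarrow> B) \<equiv> \<^bold>\<not> A \<^bold>\<or> B"
abbreviation sAll :: "(trm \<Rightarrow> scheme) \<Rightarrow> scheme" (binder "\<^bold>\<forall>" 10) where
  "sAll F \<equiv> \<^bold>\<not> (\<^bold>\<exists>x. \<^bold>\<not> F x)"
abbreviation sNeq :: "trm \<Rightarrow> trm \<Rightarrow> scheme" (infix "\<^bold>\<noteq>" 50) where
  "(s \<^bold>\<noteq> t) \<equiv> \<^bold>\<not> (s \<^bold>= t)"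

type_synonym schemeT = "nat \<Rightarrow> fmT"

definition arith :: "scheme \<Rightarrow> schemeT" ("\<langle>_\<rangle>") where
  "\<langle>A\<rangle> = (\<lambda>n. emb (A n))"
definition tTr :: "trm \<Rightarrow> schemeT" where
  "tTr t = (\<lambda>n. TrT t)"
definition tNot :: "schemeT \<Rightarrow> schemeT" ("\<^bold>\<not>\<^sub>T _" [40] 40) where
  "(\<^bold>\<not>\<^sub>T A) = (\<lambda>n. NegT (A n))"
definition tOr :: "schemeT \<Rightarrow> schemeT \<Rightarrow> schemeT" (infixr "\<^bold>\<or>\<^sub>T" 30) where
  "(A \<^bold>\<or>\<^sub>T B) = (\<lambda>n. OrT (A n) (B n))"
definition tEx :: "(trm \<Rightarrow> schemeT) \<Rightarrow> schemeT" (binder "\<^bold>\<exists>\<^sub>T" 10) where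
  "tEx F = (\<lambda>n. ExiT n (F (Var n) (Suc n)))"

abbreviation tAnd :: "schemeT \<Rightarrow> schemeT \<Rightarrow> schemeT" (infixr "\<^bold>\<and>\<^sub>T" 35) where
  "(A \<^bold>\<and>\<^sub>T B) \<equiv> \<^bold>\<not>\<^sub>T (\<^bold>\<not>\<^sub>T A \<^bold>\<or>\<^sub>T \<^bold>\<not>\<^sub>T B)"
abbreviation tImp :: "schemeT \<Rightarrow> schemeT \<Rightarrow> schemeT" (infixr "\<^bold>\<longrightarrow>\<^sub>T" 25) where
  "(A \<^bold>\<longrightarrow>\<^sub>T B) \<equiv> \<^bold>\<not>\<^sub>T A \<^bold>\<or>\<^sub>T B"
abbreviation tIff :: "schemeT \<Rightarrow> schemeT \<Rightarrow> schemeT" (infix "\<^bold>\<longleftrightarrow>\<^sub>T" 25) where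
  "(A \<^bold>\<longleftrightarrow>\<^sub>T B) \<equiv> (A \<^bold>\<longrightarrow>\<^sub>T B) \<^bold>\<and>\<^sub>T (B \<^bold>\<longrightarrow>\<^sub>T A)"
abbreviation tAll :: "(trm \<Rightarrow> schemeT) \<Rightarrow> schemeT" (binder "\<^bold>\<forall>\<^sub>T" 10) where
  "tAll F \<equiv> \<^bold>\<not>\<^sub>T (\<^bold>\<exists>\<^sub>Tx. \<^bold>\<not>\<^sub>T F x)"


section \<open>Goedel numbering\<close>

primrec tcode :: "trm \<Rightarrow> nat" where
  "tcode (Var i) = prod_encode (0, i)"
| "tcode Zero = prod_encode (1, 0)"
| "tcode (Succ t) = prod_encode (2, tcode t)"
| "tcode (Add s t) = prod_encode (3, prod_encode (tcode s, tcode t))"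
| "tcode (Mul s t) = prod_encode (4, prod_encode (tcode s, tcode t))"

primrec fcode :: "fm \<Rightarrow> nat" where
  "fcode (Equ s t) = prod_encode (5, prod_encode (tcode s, tcode t))"
| "fcode (Neg p) = prod_encode (6, fcode p)"
| "fcode (Or p q) = prod_encode (7, prod_encode (fcode p, fcode q))"
| "fcode (Exi i p) = prod_encode (8, prod_encode (tcode (Var i), fcode p))"


section \<open>Arithmetized syntax\<close>

definition less :: "trm \<Rightarrow> trm \<Rightarrow> scheme" where
  "less x y = (\<^bold>\<exists>z. Add x (Succ z) \<^bold>= y)"

primrec num :: "nat \<Rightarrow> trm" where
  "num 0 = Zero"
| "num (Suc k) = Succ (num k)"

text \<open>\<open>z = prod_encode (x, y)\<close>, that is, \<open>2 z = (x + y) (x + y + 1) + 2 x\<close>.\<close>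

definition pair :: "trm \<Rightarrow> trm \<Rightarrow> trm \<Rightarrow> scheme" where
  "pair x y z = (Add z z \<^bold>= Add (Mul (Add x y) (Succ (Add x y))) (Add x x))"

definition tag1 :: "nat \<Rightarrow> trm \<Rightarrow> trm \<Rightarrow> scheme" where
  "tag1 k x z = pair (num k) x z"

definition tag2 :: "nat \<Rightarrow> trm \<Rightarrow> trm \<Rightarrow> trm \<Rightarrow> scheme" where
  "tag2 k x y z = (\<^bold>\<exists>p. pair x y p \<^bold>\<and> tag1 k p z)"

text \<open>In each of the following graphs the last argument is the code of the compound expression.\<close>

definition cVar :: "trm \<Rightarrow> scheme" where "cVar z = (\<^bold>\<exists>i. tag1 0 i z)"
definition cZero :: "trm \<Rightarrow> scheme" where "cZero = tag1 1 Zero"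
definition cSucc :: "trm \<Rightarrow> trm \<Rightarrow> scheme" where "cSucc = tag1 2"
definition cAdd :: "trm \<Rightarrow> trm \<Rightarrow> trm \<Rightarrow> scheme" where "cAdd = tag2 3"
definition cMul :: "trm \<Rightarrow> trm \<Rightarrow> trm \<Rightarrow> scheme" where "cMul = tag2 4"
definition cEq :: "trm \<Rightarrow> trm \<Rightarrow> trm \<Rightarrow> scheme" where "cEq = tag2 5"
definition cNeg :: "trm \<Rightarrow> trm \<Rightarrow> scheme" where "cNeg = tag1 6"
definition cOr :: "trm \<Rightarrow> trm \<Rightarrow> trm \<Rightarrow> scheme" where "cOr = tag2 7"
definition cEx :: "trm \<Rightarrow> trm \<Rightarrow> trm \<Rightarrow> scheme" where "cEx = tag2 8"

text \<open>The triple \<open>a, b, c\<close> codes the finite set of those \<open>y < c\<close> for which Goedel's modulus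
  \<open>1 + (y + 1) b\<close> divides \<open>a\<close>. Every bounded definable set has such a code, provably in PA.\<close>

definition elem :: "trm \<Rightarrow> trm \<Rightarrow> trm \<Rightarrow> trm \<Rightarrow> scheme" where
  "elem a b c y = (less y c \<^bold>\<and> (\<^bold>\<exists>q. a \<^bold>= Mul q (Succ (Mul (Succ y) b))))"

text \<open>Arithmetized inductive definitions: \<open>x\<close> belongs to a coded finite set each of whose elements
  is obtained by \<open>step\<close> from elements of that set. In all uses below, \<open>step\<close> goes from immediate
  subexpressions (in \<open>Numeral\<close>: from the predecessor) to the compound one; as these have smaller
  codes, there are no circular justifications and the coded set is a derivation.\<close>

definition inductively :: "((trm \<Rightarrow> scheme) \<Rightarrow> trm \<Rightarrow> scheme) \<Rightarrow> trm \<Rightarrow> scheme" where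
  "inductively step x =
    (\<^bold>\<exists>a. \<^bold>\<exists>b. \<^bold>\<exists>c. elem a b c x \<^bold>\<and> (\<^bold>\<forall>y. elem a b c y \<^bold>\<longrightarrow> step (elem a b c) y))"

definition holds2 :: "(trm \<Rightarrow> scheme) \<Rightarrow> trm \<Rightarrow> trm \<Rightarrow> scheme" where
  "holds2 P x y = (\<^bold>\<exists>p. pair x y p \<^bold>\<and> P p)"

definition inductively2 ::
  "((trm \<Rightarrow> trm \<Rightarrow> scheme) \<Rightarrow> trm \<Rightarrow> trm \<Rightarrow> scheme) \<Rightarrow> trm \<Rightarrow> trm \<Rightarrow> scheme" where
  "inductively2 step =
    holds2 (inductively (\<lambda>P p. \<^bold>\<exists>x. \<^bold>\<exists>y. pair x y p \<^bold>\<and> step (holds2 P) x y))"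

definition Term :: "trm \<Rightarrow> scheme" where
  "Term = inductively (\<lambda>P x.
     cVar x \<^bold>\<or> cZero x
     \<^bold>\<or> (\<^bold>\<exists>s. P s \<^bold>\<and> cSucc s x)
     \<^bold>\<or> (\<^bold>\<exists>s. \<^bold>\<exists>t. P s \<^bold>\<and> P t \<^bold>\<and> (cAdd s t x \<^bold>\<or> cMul s t x)))"

definition Form :: "trm \<Rightarrow> scheme" where
  "Form = inductively (\<lambda>P x.
     (\<^bold>\<exists>s. \<^bold>\<exists>t. Term s \<^bold>\<and> Term t \<^bold>\<and> cEq s t x)
     \<^bold>\<or> (\<^bold>\<exists>p. P p \<^bold>\<and> cNeg p x)
     \<^bold>\<or> (\<^bold>\<exists>p. \<^bold>\<exists>q. P p \<^bold>\<and> P q \<^bold>\<and> cOr p q x)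
     \<^bold>\<or> (\<^bold>\<exists>v. \<^bold>\<exists>p. cVar v \<^bold>\<and> P p \<^bold>\<and> cEx v p x))"

text \<open>The variable (coded by) \<open>v\<close> occurs free in the term or formula \<open>x\<close>.\<close>

definition FreeIn :: "trm \<Rightarrow> trm \<Rightarrow> scheme" where
  "FreeIn v = inductively (\<lambda>P x.
     (cVar x \<^bold>\<and> x \<^bold>= v)
     \<^bold>\<or> (\<^bold>\<exists>p. P p \<^bold>\<and> (cSucc p x \<^bold>\<or> cNeg p x))
     \<^bold>\<or> (\<^bold>\<exists>p. \<^bold>\<exists>q. (P p \<^bold>\<or> P q) \<^bold>\<and> (cAdd p q x \<^bold>\<or> cMul p q x \<^bold>\<or> cEq p q x \<^bold>\<or> cOr p q x))
     \<^bold>\<or> (\<^bold>\<exists>u. \<^bold>\<exists>p. P p \<^bold>\<and> u \<^bold>\<noteq> v \<^bold>\<and> cEx u p x))"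

definition ClTerm :: "trm \<Rightarrow> scheme" where
  "ClTerm x = (Term x \<^bold>\<and> \<^bold>\<not> (\<^bold>\<exists>v. FreeIn v x))"

definition Sent :: "trm \<Rightarrow> scheme" where
  "Sent x = (Form x \<^bold>\<and> \<^bold>\<not> (\<^bold>\<exists>v. FreeIn v x))"

text \<open>\<open>v\<close> is a variable and \<open>x\<close> is a formula with no free variable other than \<open>v\<close>. Quantifying
  over \<open>v\<close> and \<open>x\<close> with \<open>Form1 v x\<close> renders the quantifier over formulae with at most one free
  variable.\<close>

definition Form1 :: "trm \<Rightarrow> trm \<Rightarrow> scheme" where
  "Form1 v x = (cVar v \<^bold>\<and> Form x \<^bold>\<and> (\<^bold>\<forall>u. FreeIn u x \<^bold>\<longrightarrow> u \<^bold>= v))"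

text \<open>\<open>y\<close> results from the term or formula \<open>x\<close> by replacing the free occurrences of \<open>v\<close> by \<open>t\<close>;
  used for closed \<open>t\<close> only.\<close>

definition Subst :: "trm \<Rightarrow> trm \<Rightarrow> trm \<Rightarrow> trm \<Rightarrow> scheme" where
  "Subst v t = inductively2 (\<lambda>P x y.
     (cVar x \<^bold>\<and> x \<^bold>= v \<^bold>\<and> y \<^bold>= t)
     \<^bold>\<or> (cVar x \<^bold>\<and> x \<^bold>\<noteq> v \<^bold>\<and> y \<^bold>= x)
     \<^bold>\<or> (cZero x \<^bold>\<and> y \<^bold>= x)
     \<^bold>\<or> (\<^bold>\<exists>p. \<^bold>\<exists>p'. P p p' \<^bold>\<and> ((cSucc p x \<^bold>\<and> cSucc p' y) \<^bold>\<or> (cNeg p x \<^bold>\<and> cNeg p' y)))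
     \<^bold>\<or> (\<^bold>\<exists>p. \<^bold>\<exists>q. \<^bold>\<exists>p'. \<^bold>\<exists>q'. P p p' \<^bold>\<and> P q q' \<^bold>\<and>
           ((cAdd p q x \<^bold>\<and> cAdd p' q' y) \<^bold>\<or> (cMul p q x \<^bold>\<and> cMul p' q' y)
            \<^bold>\<or> (cEq p q x \<^bold>\<and> cEq p' q' y) \<^bold>\<or> (cOr p q x \<^bold>\<and> cOr p' q' y)))
     \<^bold>\<or> (\<^bold>\<exists>u. \<^bold>\<exists>p. \<^bold>\<exists>p'. u \<^bold>\<noteq> v \<^bold>\<and> P p p' \<^bold>\<and> cEx u p x \<^bold>\<and> cEx u p' y)
     \<^bold>\<or> (\<^bold>\<exists>p. cEx v p x \<^bold>\<and> y \<^bold>= x))"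

text \<open>\<open>y\<close> is the code of the numeral for \<open>x\<close>.\<close>

definition Numeral :: "trm \<Rightarrow> trm \<Rightarrow> scheme" where
  "Numeral = inductively2 (\<lambda>P x y.
     (x \<^bold>= Zero \<^bold>\<and> cZero y) \<^bold>\<or> (\<^bold>\<exists>w. \<^bold>\<exists>t. P w t \<^bold>\<and> x \<^bold>= Succ w \<^bold>\<and> cSucc t y))"

text \<open>\<open>x\<close> is the value of the closed term coded by \<open>s\<close>.\<close>

definition Val :: "trm \<Rightarrow> trm \<Rightarrow> scheme" where
  "Val = inductively2 (\<lambda>P s x.
     (cZero s \<^bold>\<and> x \<^bold>= Zero)
     \<^bold>\<or> (\<^bold>\<exists>t. \<^bold>\<exists>y. P t y \<^bold>\<and> cSucc t s \<^bold>\<and> x \<^bold>= Succ y)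
     \<^bold>\<or> (\<^bold>\<exists>t. \<^bold>\<exists>u. \<^bold>\<exists>y. \<^bold>\<exists>z. P t y \<^bold>\<and> P u z \<^bold>\<and>
           ((cAdd t u s \<^bold>\<and> x \<^bold>= Add y z) \<^bold>\<or> (cMul t u s \<^bold>\<and> x \<^bold>= Mul y z))))"

definition SameVal :: "trm \<Rightarrow> trm \<Rightarrow> scheme" where
  "SameVal s t = (\<^bold>\<exists>x. Val s x \<^bold>\<and> Val t x)"

text \<open>\<open>z\<close> is the sentence obtained from \<open>p\<close> by substituting the numeral for \<open>x\<close> for \<open>v\<close>.\<close>

definition Inst :: "trm \<Rightarrow> trm \<Rightarrow> trm \<Rightarrow> trm \<Rightarrow> scheme" where
  "Inst p v x z = (\<^bold>\<exists>n. Numeral x n \<^bold>\<and> Subst v n p z)"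


section \<open>The theory \<open>PT\<^sup>-\<close> and internal induction for total formulae\<close>

text \<open>\<open>T\<close> applied to (the value of) a syntactic operation that is given by its graph.\<close>

definition tTrOf :: "(trm \<Rightarrow> scheme) \<Rightarrow> schemeT" where
  "tTrOf G = (\<^bold>\<exists>\<^sub>Tz. \<langle>G z\<rangle> \<^bold>\<and>\<^sub>T tTr z)"

definition NegOf :: "(trm \<Rightarrow> scheme) \<Rightarrow> trm \<Rightarrow> scheme" where
  "NegOf G z = (\<^bold>\<exists>y. G y \<^bold>\<and> cNeg y z)"

definition PT1a :: fmT where
  "PT1a = (\<^bold>\<forall>\<^sub>Ts. \<^bold>\<forall>\<^sub>Tt. \<langle>ClTerm s \<^bold>\<and> ClTerm t\<rangle> \<^bold>\<longrightarrow>\<^sub>T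
     (tTrOf (cEq s t) \<^bold>\<longleftrightarrow>\<^sub>T \<langle>SameVal s t\<rangle>)) 0"

definition PT1b :: fmT where
  "PT1b = (\<^bold>\<forall>\<^sub>Ts. \<^bold>\<forall>\<^sub>Tt. \<langle>ClTerm s \<^bold>\<and> ClTerm t\<rangle> \<^bold>\<longrightarrow>\<^sub>T
     (tTrOf (NegOf (cEq s t)) \<^bold>\<longleftrightarrow>\<^sub>T \<langle>\<^bold>\<not> SameVal s t\<rangle>)) 0"

definition PT2a :: fmT where
  "PT2a = (\<^bold>\<forall>\<^sub>Tp. \<^bold>\<forall>\<^sub>Tq. \<langle>Sent p \<^bold>\<and> Sent q\<rangle> \<^bold>\<longrightarrow>\<^sub>T
     (tTrOf (cOr p q) \<^bold>\<longleftrightarrow>\<^sub>T (tTr p \<^bold>\<or>\<^sub>T tTr q))) 0"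

definition PT2b :: fmT where
  "PT2b = (\<^bold>\<forall>\<^sub>Tp. \<^bold>\<forall>\<^sub>Tq. \<langle>Sent p \<^bold>\<and> Sent q\<rangle> \<^bold>\<longrightarrow>\<^sub>T
     (tTrOf (NegOf (cOr p q)) \<^bold>\<longleftrightarrow>\<^sub>T (tTrOf (cNeg p) \<^bold>\<and>\<^sub>T tTrOf (cNeg q)))) 0"

definition PT3a :: fmT where
  "PT3a = (\<^bold>\<forall>\<^sub>Tv. \<^bold>\<forall>\<^sub>Tp. \<langle>Form1 v p\<rangle> \<^bold>\<longrightarrow>\<^sub>T
     (tTrOf (cEx v p) \<^bold>\<longleftrightarrow>\<^sub>T (\<^bold>\<exists>\<^sub>Tx. tTrOf (Inst p v x)))) 0"

definition PT3b :: fmT where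
  "PT3b = (\<^bold>\<forall>\<^sub>Tv. \<^bold>\<forall>\<^sub>Tp. \<langle>Form1 v p\<rangle> \<^bold>\<longrightarrow>\<^sub>T
     (tTrOf (NegOf (cEx v p)) \<^bold>\<longleftrightarrow>\<^sub>T (\<^bold>\<forall>\<^sub>Tx. tTrOf (NegOf (Inst p v x))))) 0"

definition PT4 :: fmT where
  "PT4 = (\<^bold>\<forall>\<^sub>Tp. \<langle>Sent p\<rangle> \<^bold>\<longrightarrow>\<^sub>T (tTrOf (NegOf (cNeg p)) \<^bold>\<longleftrightarrow>\<^sub>T tTr p)) 0"

definition PT5 :: fmT where
  "PT5 = (\<^bold>\<forall>\<^sub>Tv. \<^bold>\<forall>\<^sub>Tp. \<langle>Form1 v p\<rangle> \<^bold>\<longrightarrow>\<^sub>T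
     (\<^bold>\<forall>\<^sub>Ts. \<^bold>\<forall>\<^sub>Tt. \<langle>ClTerm s \<^bold>\<and> ClTerm t\<rangle> \<^bold>\<longrightarrow>\<^sub>T \<langle>SameVal s t\<rangle> \<^bold>\<longrightarrow>\<^sub>T
        (tTrOf (Subst v s p) \<^bold>\<longleftrightarrow>\<^sub>T tTrOf (Subst v t p)))) 0"

definition PT_minus :: "fmT set" where
  "PT_minus = emb ` PA \<union> {PT1a, PT1b, PT2a, PT2b, PT3a, PT3b, PT4, PT5}"

definition tot :: "trm \<Rightarrow> trm \<Rightarrow> schemeT" where
  "tot v p = (\<langle>Form1 v p\<rangle> \<^bold>\<and>\<^sub>T
     (\<^bold>\<forall>\<^sub>Tx. tTrOf (Inst p v x) \<^bold>\<or>\<^sub>T tTrOf (NegOf (Inst p v x))))"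

definition INT_tot :: fmT where
  "INT_tot = (\<^bold>\<forall>\<^sub>Tv. \<^bold>\<forall>\<^sub>Tp. tot v p \<^bold>\<longrightarrow>\<^sub>T
     (\<^bold>\<forall>\<^sub>Tx. tTrOf (Inst p v x) \<^bold>\<longrightarrow>\<^sub>T tTrOf (Inst p v (Succ x))) \<^bold>\<longrightarrow>\<^sub>T
     tTrOf (Inst p v Zero) \<^bold>\<longrightarrow>\<^sub>T
     (\<^bold>\<forall>\<^sub>Tx. tTrOf (Inst p v x))) 0"


section \<open>Recursive sets\<close>

text \<open>Total recursive functions of a given arity, as functions on argument lists; values at lists
  of a different length are irrelevant.\<close>

inductive recfun :: "nat \<Rightarrow> (nat list \<Rightarrow> nat) \<Rightarrow> bool" where
  zero: "recfun n (\<lambda>xs. 0)"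
| succ: "recfun 1 (\<lambda>xs. Suc (xs ! 0))"
| proj: "i < n \<Longrightarrow> recfun n (\<lambda>xs. xs ! i)"
| comp: "recfun (length gs) f \<Longrightarrow> (\<forall>g\<in>set gs. recfun n g) \<Longrightarrow>
    recfun n (\<lambda>xs. f (map (\<lambda>g. g xs) gs))"
| prim_rec: "recfun n f \<Longrightarrow> recfun (Suc (Suc n)) g \<Longrightarrow>
    recfun (Suc n) (\<lambda>xs. rec_nat (f (tl xs)) (\<lambda>y r. g (y # r # tl xs)) (hd xs))"
| minimization: "recfun (Suc n) f \<Longrightarrow> (\<And>xs. length xs = n \<Longrightarrow> \<exists>y. f (y # xs) = 0) \<Longrightarrow>
    recfun n (\<lambda>xs. LEAST y. f (y # xs) = 0)"

definition recursive_set :: "nat set \<Rightarrow> bool" where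
  "recursive_set A \<longleftrightarrow> (\<exists>f. recfun 1 f \<and> (\<forall>n. f [n] = (if n \<in> A then 1 else 0)))"


section \<open>Short recursive saturation\<close>

text \<open>A set of formulae \<open>p\<close> is read as a set of conditions on the variable \<open>x\<close>; all other
  variables stand for parameters from \<open>M\<close>, with values given by \<open>e\<close>.\<close>

definition realised :: "'a arith_struct \<Rightarrow> (nat \<Rightarrow> 'a) \<Rightarrow> nat \<Rightarrow> fm set \<Rightarrow> bool" where
  "realised M e x p \<longleftrightarrow> (\<exists>b. \<forall>\<phi>\<in>p. sat M (e(x := b)) \<phi>)"

definition recursive_type :: "'a arith_struct \<Rightarrow> (nat \<Rightarrow> 'a) \<Rightarrow> nat \<Rightarrow> fm set \<Rightarrow> bool" where
  "recursive_type M e x p \<longleftrightarrow>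
     finite (\<Union>\<phi>\<in>p. fv \<phi>) \<and> recursive_set (fcode ` p) \<and>
     (\<forall>q. finite q \<and> q \<subseteq> p \<longrightarrow> realised M e x q)"

text \<open>\<open>x < w\<close> for distinct variables \<open>x\<close> and \<open>w\<close>, with a fresh bound variable.\<close>

definition less_var :: "nat \<Rightarrow> nat \<Rightarrow> fm" where
  "less_var x w = less (Var x) (Var w) (Suc (max x w))"

definition short_recursively_saturated :: "'a arith_struct \<Rightarrow> bool" where
  "short_recursively_saturated M \<longleftrightarrow>
     (\<forall>e x w (\<phi> :: nat \<Rightarrow> fm) p.
        x \<noteq> w \<and> p = {And (less_var x w) (\<phi> i) | i. True} \<and> recursive_type M e x p
        \<longrightarrow> realised M e x p)"

end

theory Submission
  imports Defs
begin

text \<open>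
  The set \<open>p\<close> of conditions is coded into one formula of nonstandard length that only
  ever gets evaluated down to a standard depth. Suppose that \<open>M\<close> is nonstandard and that the
  recursive type \<open>p\<close> is omitted. Let \<open>\<psi>\<^sub>n\<close> be the condition in \<open>p\<close> with code \<open>n\<close>, or \<open>0 = 0\<close> if there is
  none. For a nonstandard \<open>c\<close>, form inside \<open>M\<close> the nested conjunction
  \<open>\<psi>\<^sub>0 \<and> (y = 0 \<or> (\<psi>\<^sub>1 \<and> (y = 1 \<or> (\<psi>\<^sub>2 \<and> \<dots>))))\<close>
  of depth \<open>c\<close>, let \<open>\<Theta>(y)\<close> be its existential closure in \<open>x\<close>, and let the parameters
  be replaced by numerals. The compositional axioms unravel one layer at a time.
  If \<open>y\<close> is the standard number \<open>m\<close>, an \<open>x\<close> satisfying \<open>\<psi>\<^sub>0, \<dots>, \<psi>\<^sub>m\<close> exists by finite satisfiability,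
  and after \<open>m + 1\<close> layers the disjunct \<open>y = m\<close> makes the rest irrelevant: \<open>\<Theta>(m)\<close> is in \<open>T\<close>.
  If \<open>y\<close> is nonstandard, every \<open>x\<close> falsifies some \<open>\<psi>\<^sub>n\<close> with standard \<open>n\<close>, so that the negation
  of the conjunction gets into \<open>T\<close> after \<open>n + 1\<close> layers: the negation of \<open>\<Theta>(y)\<close> is in \<open>T\<close>.
  Hence \<open>\<Theta>\<close> is total, and \<open>T\<close> contains \<open>\<Theta>(y)\<close> only for standard \<open>y\<close>, because a truth of \<open>\<Theta>(d)\<close> with
  nonstandard \<open>d\<close> would unravel to an \<open>x\<close> realising \<open>p\<close>. So \<open>\<Theta>\<close> is inductive, internal induction
  puts \<open>\<Theta>(c)\<close> into \<open>T\<close>, and \<open>p\<close> is realised after all. This is \<open>nonstandard_realises\<close>; the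
  unravelling of one layer is \<open>truth_of_link\<close>, and the formula to be unravelled comes from
  \<open>chain_exists\<close>. In the standard model (\<open>standard_realises\<close>) the bound \<open>x < a\<close> leaves finitely many
  candidates, and finite satisfiability suffices.

  The rest supplies the arithmetic of syntax inside an arbitrary model of PA. Definability in \<open>M\<close> is
  handled semantically, by a calculus of definable relations (\<open>dfn\<close>, \<open>dfun\<close>), and induction in
  \<open>M\<close> is available for exactly these (\<open>definable_induct\<close>). Goedel's coding of bounded definable sets
  (\<open>code_bounded_set\<close>) turns the arithmetized inductive definitions into fixed points
  (\<open>ind_fixpoint\<close>); from then on the internal syntax is used through its recursion equations only.
  The same fixed points give definable recursion along \<open>M\<close> (\<open>iter\<close>). It serves twice: to build the
  formula of nonstandard length, and to interpret every recursive function by a definable one that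
  agrees with it on standard arguments (\<open>recfun_represented\<close>). In this way \<open>M\<close> can tell which standard
  codes belong to \<open>p\<close> while it builds the formula.
\<close>

section \<open>Satisfaction and substitution\<close>

lemma teval_cong: "(\<And>i. i \<in> fvt t \<Longrightarrow> e i = e' i) \<Longrightarrow> teval M e t = teval M e' t"
  by (induction t) auto

lemma sat_cong: "(\<And>i. i \<in> fv p \<Longrightarrow> e i = e' i) \<Longrightarrow> sat M e p \<longleftrightarrow> sat M e' p"
proof (induction p arbitrary: e e')
  case (Equ s t)
  then show ?case
    using teval_cong[of s e e' M] teval_cong[of t e e' M] by simp
next
  case (Exi i p)
  have "sat M (e(i := b)) p \<longleftrightarrow> sat M (e'(i := b)) p" for b
    by (rule Exi.IH) (use Exi.prems in auto)
  then show ?case by simp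
next
  case (Neg p)
  show ?case using Neg.IH[of e e'] Neg.prems by simp
next
  case (Or p q)
  show ?case using Or.IH(1)[of e e'] Or.IH(2)[of e e'] Or.prems by simp
qed

lemma teval_substt: "teval M e (substt i u t) = teval M (e(i := teval M e u)) t"
  by (induction t) auto

text \<open>No capture can occur: under a quantifier binding \<open>j \<noteq> i\<close> the value of \<open>u\<close> is unaffected.\<close>

lemma sat_subst:
  "fvt u \<subseteq> {i} \<Longrightarrow> sat M e (subst i u p) \<longleftrightarrow> sat M (e(i := teval M e u)) p"
proof (induction p arbitrary: e)
  case (Exi j p)
  show ?case
  proof (cases "j = i")
    case False
    then have "teval M (e(j := b)) u = teval M e u" for b
      by (intro teval_cong) (use Exi.prems in auto)
    then have "sat M (e(j := b)) (subst i u p) \<longleftrightarrow> sat M ((e(i := teval M e u))(j := b)) p" for b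
      using Exi.IH[OF Exi.prems, of "e(j := b)"] fun_upd_twist[OF False, of e b "teval M e u"]
      by (simp del: fun_upd_apply)
    with False show ?thesis by (simp del: fun_upd_apply)
  qed (simp del: fun_upd_apply)
qed (simp_all add: teval_substt)


section \<open>Definability in a model of arithmetic\<close>

locale pa_model =
  fixes M :: "'a arith_struct"
  assumes models_PA: "models M PA"
begin

abbreviation zero_M ("\<zero>") where "\<zero> \<equiv> zeroI M"
abbreviation S where "S \<equiv> succI M"
abbreviation add_M (infixl "\<oplus>" 65) where "x \<oplus> y \<equiv> addI M x y"
abbreviation mul_M (infixl "\<otimes>" 70) where "x \<otimes> y \<equiv> mulI M x y"

text \<open>The relations on environments that are definable in \<open>M\<close> with parameters. Environments are stacks
  in the style of de Bruijn: under a quantifier the new element has index 0 and all others are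
  shifted. Thus definability of a HOL predicate is proved by resolution along its structure, and
  formulae of the object language with their variable names never have to be written down.\<close>

inductive dfn :: "((nat \<Rightarrow> 'a) \<Rightarrow> bool) \<Rightarrow> bool" where
  const: "dfn (\<lambda>e. e i = c)"
| eq: "dfn (\<lambda>e. e i = e j)"
| succ: "dfn (\<lambda>e. e i = S (e j))"
| add: "dfn (\<lambda>e. e i = e j \<oplus> e k)"
| mul: "dfn (\<lambda>e. e i = e j \<otimes> e k)"
| neg: "dfn R \<Longrightarrow> dfn (\<lambda>e. \<not> R e)"
| disj: "dfn Q \<Longrightarrow> dfn R \<Longrightarrow> dfn (\<lambda>e. Q e \<or> R e)"
| ex: "dfn (\<lambda>e. R (\<lambda>i. e (Suc i)) (e 0)) \<Longrightarrow> dfn (\<lambda>e. \<exists>b. R e b)"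

text \<open>The formula \<open>\<phi>\<close> reads entry \<open>i\<close> of the environment from variable \<open>\<sigma> i\<close> and parameter \<open>s\<close> from
  variable \<open>\<pi> s\<close>. Both placements are arbitrary, so that two formulae can be combined without
  renaming their variables. For finite \<open>A\<close> there remain fresh variables to quantify over.\<close>

definition expressible :: "'a set \<Rightarrow> nat \<Rightarrow> ((nat \<Rightarrow> 'a) \<Rightarrow> bool) \<Rightarrow> bool" where
  "expressible A N R \<longleftrightarrow> (\<forall>\<pi> \<sigma>. \<exists>\<phi>. \<forall>E e.
    (\<forall>s\<in>A. E (\<pi> s) = s) \<longrightarrow> (\<forall>i<N. e i = E (\<sigma> i)) \<longrightarrow> (sat M E \<phi> \<longleftrightarrow> R e))"

lemma expressibleI:
  assumes "\<And>\<pi> \<sigma> E e. \<forall>s\<in>A. E (\<pi> s) = s \<Longrightarrow> \<forall>i<N. e i = E (\<sigma> i) \<Longrightarrow> sat M E (\<phi> \<pi> \<sigma>) \<longleftrightarrow> R e"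
  shows "expressible A N R"
  unfolding expressible_def using assms by metis

lemma expressibleE:
  assumes "expressible A N R"
  obtains \<phi> where "\<And>E e. \<forall>s\<in>A. E (\<pi> s) = s \<Longrightarrow> \<forall>i<N. e i = E (\<sigma> i) \<Longrightarrow> sat M E \<phi> \<longleftrightarrow> R e"
  using assms unfolding expressible_def by metis

lemma dfn_expressible:
  assumes "dfn R"
  shows "\<exists>A N. finite A \<and> expressible A N R"
  using assms
proof induction
  case (const i c)
  have "expressible {c} (Suc i) (\<lambda>e. e i = c)"
    by (rule expressibleI[of _ _ "\<lambda>\<pi> \<sigma>. Equ (Var (\<sigma> i)) (Var (\<pi> c))"]) simp
  then show ?case by blast
next
  case (eq i j)
  have "expressible {} (Suc (i + j)) (\<lambda>e. e i = e j)"
    by (rule expressibleI[of _ _ "\<lambda>\<pi> \<sigma>. Equ (Var (\<sigma> i)) (Var (\<sigma> j))"]) simp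
  then show ?case by blast
next
  case (succ i j)
  have "expressible {} (Suc (i + j)) (\<lambda>e. e i = S (e j))"
    by (rule expressibleI[of _ _ "\<lambda>\<pi> \<sigma>. Equ (Var (\<sigma> i)) (Succ (Var (\<sigma> j)))"]) simp
  then show ?case by blast
next
  case (add i j k)
  have "expressible {} (Suc (i + j + k)) (\<lambda>e. e i = e j \<oplus> e k)"
    by (rule expressibleI[of _ _ "\<lambda>\<pi> \<sigma>. Equ (Var (\<sigma> i)) (Add (Var (\<sigma> j)) (Var (\<sigma> k)))"]) simp
  then show ?case by blast
next
  case (mul i j k)
  have "expressible {} (Suc (i + j + k)) (\<lambda>e. e i = e j \<otimes> e k)"
    by (rule expressibleI[of _ _ "\<lambda>\<pi> \<sigma>. Equ (Var (\<sigma> i)) (Mul (Var (\<sigma> j)) (Var (\<sigma> k)))"]) simp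
  then show ?case by blast
next
  case (neg R)
  then obtain A N where A: "finite A" and R: "expressible A N R" by blast
  have "expressible A N (\<lambda>e. \<not> R e)"
    unfolding expressible_def
  proof (intro allI)
    fix \<pi> \<sigma>
    obtain \<phi> where \<phi>: "\<And>E e. \<forall>s\<in>A. E (\<pi> s) = s \<Longrightarrow> \<forall>i<N. e i = E (\<sigma> i) \<Longrightarrow> sat M E \<phi> \<longleftrightarrow> R e"
      using expressibleE[OF R] by metis
    show "\<exists>\<phi>. \<forall>E e. (\<forall>s\<in>A. E (\<pi> s) = s) \<longrightarrow> (\<forall>i<N. e i = E (\<sigma> i)) \<longrightarrow> sat M E \<phi> = (\<not> R e)"
      by (rule exI[of _ "Neg \<phi>"]) (simp add: \<phi>)
  qed
  with A show ?case by blast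
next
  case (disj Q R)
  then obtain A N A' N' where A: "finite A" "finite A'"
    and Q: "expressible A N Q" and R: "expressible A' N' R" by blast
  have "expressible (A \<union> A') (max N N') (\<lambda>e. Q e \<or> R e)"
    unfolding expressible_def
  proof (intro allI)
    fix \<pi> \<sigma>
    obtain \<phi> where \<phi>: "\<And>E e. \<forall>s\<in>A. E (\<pi> s) = s \<Longrightarrow> \<forall>i<N. e i = E (\<sigma> i) \<Longrightarrow> sat M E \<phi> \<longleftrightarrow> Q e"
      using expressibleE[OF Q] by metis
    obtain \<psi> where \<psi>: "\<And>E e. \<forall>s\<in>A'. E (\<pi> s) = s \<Longrightarrow> \<forall>i<N'. e i = E (\<sigma> i) \<Longrightarrow> sat M E \<psi> \<longleftrightarrow> R e"
      using expressibleE[OF R] by metis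
    show "\<exists>\<phi>. \<forall>E e. (\<forall>s\<in>A \<union> A'. E (\<pi> s) = s) \<longrightarrow> (\<forall>i<max N N'. e i = E (\<sigma> i)) \<longrightarrow>
        sat M E \<phi> = (Q e \<or> R e)"
    proof (rule exI[of _ "Or \<phi> \<psi>"], intro allI impI)
      fix E e assume "\<forall>s\<in>A \<union> A'. E (\<pi> s) = s" "\<forall>i<max N N'. e i = E (\<sigma> i)"
      then show "sat M E (Or \<phi> \<psi>) = (Q e \<or> R e)" using \<phi>[of E e] \<psi>[of E e] by simp
    qed
  qed
  with A show ?case by blast
next
  case (ex R)
  then obtain A N where A: "finite A" and R: "expressible A N (\<lambda>e. R (\<lambda>i. e (Suc i)) (e 0))"
    by blast
  have "expressible A N (\<lambda>e. \<exists>b. R e b)"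
    unfolding expressible_def
  proof (intro allI)
    fix \<pi> \<sigma> :: "_ \<Rightarrow> nat"
    have "finite (\<pi> ` A \<union> \<sigma> ` {..<N})" using A by simp
    then obtain v where v: "v \<notin> \<pi> ` A" "v \<notin> \<sigma> ` {..<N}"
      using ex_new_if_finite[OF infinite_UNIV_nat] by blast
    obtain \<phi> where \<phi>: "\<And>E e. \<forall>s\<in>A. E (\<pi> s) = s \<Longrightarrow> \<forall>i<N. e i = E (case_nat v \<sigma> i)
        \<Longrightarrow> sat M E \<phi> \<longleftrightarrow> R (\<lambda>i. e (Suc i)) (e 0)"
      by (rule expressibleE[OF R, of \<pi> "case_nat v \<sigma>"]) (rule that, assumption)
    have *: "sat M (E(v := b)) \<phi> \<longleftrightarrow> R e b"
      if "\<forall>s\<in>A. E (\<pi> s) = s" "\<forall>i<N. e i = E (\<sigma> i)" for E e b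
    proof -
      have "\<forall>s\<in>A. (E(v := b)) (\<pi> s) = s" using v that by auto
      moreover have "\<forall>i<N. case_nat b e i = (E(v := b)) (case_nat v \<sigma> i)"
        using v that by (auto split: nat.split)
      ultimately show ?thesis using \<phi>[of "E(v := b)" "case_nat b e"] by simp
    qed
    show "\<exists>\<phi>. \<forall>E e. (\<forall>s\<in>A. E (\<pi> s) = s) \<longrightarrow> (\<forall>i<N. e i = E (\<sigma> i)) \<longrightarrow> sat M E \<phi> = (\<exists>b. R e b)"
    proof (rule exI[of _ "Exi v \<phi>"], intro allI impI)
      fix E e assume "\<forall>s\<in>A. E (\<pi> s) = s" "\<forall>i<N. e i = E (\<sigma> i)"
      then show "sat M E (Exi v \<phi>) = (\<exists>b. R e b)" unfolding sat.simps by (simp only: *)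
    qed
  qed
  with A show ?case by blast
qed

text \<open>The bridge to the induction scheme of PA: variable 0 carries the induction and the finitely many
  parameters are placed at the variables above it.\<close>

lemma definable_induct:
  assumes P: "dfn (\<lambda>e. P (e 0))" and 0: "P \<zero>" and S: "\<And>x. P x \<Longrightarrow> P (S x)"
  shows "P x"
proof -
  obtain A N where "finite A" and A: "expressible A N (\<lambda>e. P (e 0))"
    using dfn_expressible[OF P] by blast
  obtain n :: nat and f where f: "A = f ` {i. i < n}"
    using \<open>finite A\<close> unfolding finite_conv_nat_seg_image by metis
  define \<pi> where "\<pi> s = Suc (inv_into {i. i < n} f s)" for s
  obtain p where p: "\<And>E e. \<forall>s\<in>A. E (\<pi> s) = s \<Longrightarrow> \<forall>i<N. e i = E 0 \<Longrightarrow> sat M E p \<longleftrightarrow> P (e 0)"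
    by (rule expressibleE[OF A, of \<pi> "\<lambda>_. 0"]) (rule that, assumption)
  have f_inv: "\<forall>s\<in>A. f (inv_into {i. i < n} f s) = s"
    unfolding f by (blast intro: f_inv_into_f)
  have *: "sat M ((case_nat \<zero> f)(0 := b)) p \<longleftrightarrow> P b" for b
    using p[of "(case_nat \<zero> f)(0 := b)" "\<lambda>_. b"] f_inv by (simp add: \<pi>_def)
  have "induction_axiom 0 p \<in> PA" unfolding PA_def by blast
  then have "sat M (case_nat \<zero> f) (induction_axiom 0 p)"
    using models_PA unfolding models_def by blast
  moreover have "sat M (case_nat \<zero> f) (subst 0 Zero p) \<longleftrightarrow> P \<zero>"
    by (subst sat_subst) (simp_all only: fvt.simps teval.simps empty_subsetI *)
  moreover have "sat M ((case_nat \<zero> f)(0 := b)) (subst 0 (Succ (Var 0)) p) \<longleftrightarrow> P (S b)" for b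
    by (subst sat_subst) (simp_all only: fvt.simps teval.simps fun_upd_same fun_upd_upd subset_refl *)
  ultimately show ?thesis
    unfolding induction_axiom_def sat.simps * using 0 S by blast
qed

lemma dfn_rename: "dfn R \<Longrightarrow> dfn (\<lambda>e. R (\<lambda>i. e (\<rho> i)))"
proof (induction arbitrary: \<rho> rule: dfn.induct)
  case (ex R)
  have "dfn (\<lambda>e. R (\<lambda>i. e (Suc (\<rho> i))) (e 0))"
    using ex.IH[of "case_nat 0 (\<lambda>i. Suc (\<rho> i))"] by simp
  then show ?case by (rule dfn.ex)
next
  case (neg R) show ?case by (rule dfn.neg[OF neg.IH])
next
  case (disj Q R) show ?case by (rule dfn.disj[OF disj.IH])
qed (rule dfn.intros)+

text \<open>A function of environments is definable if its graph is; entry 0 holds the value.\<close>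

definition dfun :: "((nat \<Rightarrow> 'a) \<Rightarrow> 'a) \<Rightarrow> bool" where
  "dfun f \<longleftrightarrow> dfn (\<lambda>e. e 0 = f (\<lambda>i. e (Suc i)))"

lemma dfun_rename:
  assumes "dfun f" shows "dfun (\<lambda>e. f (\<lambda>i. e (\<rho> i)))"
  using dfn_rename[OF assms[unfolded dfun_def], of "case_nat 0 (\<lambda>i. Suc (\<rho> i))"]
  unfolding dfun_def by simp

lemma dfn_conj: assumes "dfn Q" "dfn R" shows "dfn (\<lambda>e. Q e \<and> R e)"
proof -
  have "dfn (\<lambda>e. \<not> (\<not> Q e \<or> \<not> R e))" by (intro dfn.neg dfn.disj assms)
  then show ?thesis by simp
qed

lemma dfn_imp: assumes "dfn Q" "dfn R" shows "dfn (\<lambda>e. Q e \<longrightarrow> R e)"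
proof -
  have "dfn (\<lambda>e. \<not> Q e \<or> R e)" by (intro dfn.neg dfn.disj assms)
  then show ?thesis by (simp only: imp_conv_disj)
qed

lemma dfn_iff: assumes "dfn Q" "dfn R" shows "dfn (\<lambda>e. Q e \<longleftrightarrow> R e)"
  unfolding iff_conv_conj_imp by (intro dfn_conj dfn_imp assms)

lemma dfn_all:
  assumes "dfn (\<lambda>e. R (\<lambda>i. e (Suc i)) (e 0))" shows "dfn (\<lambda>e. \<forall>b. R e b)"
proof -
  have "dfn (\<lambda>e. \<not> (\<exists>b. \<not> R e b))" by (intro dfn.neg dfn.ex assms)
  then show ?thesis by simp
qed

lemma dfn_let:
  assumes "dfun f" "dfn (\<lambda>e. R (\<lambda>i. e (Suc i)) (e 0))"
  shows "dfn (\<lambda>e. R e (f e))"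
proof -
  have "dfn (\<lambda>e. \<exists>y. y = f e \<and> R e y)"
    using assms(1) unfolding dfun_def by (intro dfn.ex dfn_conj assms(2))
  then show ?thesis by simp
qed

lemma dfun_var: "dfun (\<lambda>e. e i)" unfolding dfun_def by (rule dfn.eq)
lemma dfun_const: "dfun (\<lambda>e. c)" unfolding dfun_def by (rule dfn.const)

lemma dfn_eq: "dfun f \<Longrightarrow> dfun g \<Longrightarrow> dfn (\<lambda>e. f e = g e)"
  by (rule dfn_let[of f], assumption, rule dfn_let[of "\<lambda>e. g (\<lambda>i. e (Suc i))"])
    (erule dfun_rename, rule dfn.eq)

lemma dfun_S: "dfun f \<Longrightarrow> dfun (\<lambda>e. S (f e))"
  unfolding dfun_def[of "\<lambda>e. S (f e)"]
  by (rule dfn_let[of "\<lambda>e. f (\<lambda>i. e (Suc i))"]) (erule dfun_rename, rule dfn.succ)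

lemma dfun_add: "dfun f \<Longrightarrow> dfun g \<Longrightarrow> dfun (\<lambda>e. f e \<oplus> g e)"
  unfolding dfun_def[of "\<lambda>e. f e \<oplus> g e"]
  by (rule dfn_let[of "\<lambda>e. f (\<lambda>i. e (Suc i))"], erule dfun_rename,
      rule dfn_let[of "\<lambda>e. g (\<lambda>i. e (Suc (Suc i)))"], erule dfun_rename, rule dfn.add)

lemma dfun_mul: "dfun f \<Longrightarrow> dfun g \<Longrightarrow> dfun (\<lambda>e. f e \<otimes> g e)"
  unfolding dfun_def[of "\<lambda>e. f e \<otimes> g e"]
  by (rule dfn_let[of "\<lambda>e. f (\<lambda>i. e (Suc i))"], erule dfun_rename,
      rule dfn_let[of "\<lambda>e. g (\<lambda>i. e (Suc (Suc i)))"], erule dfun_rename, rule dfn.mul)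

lemmas dfn_basic = dfn_eq dfn.neg dfn.disj dfn.ex dfn_conj dfn_imp dfn_iff dfn_all
  dfun_S dfun_add dfun_mul dfun_var dfun_const

text \<open>Definable relations may be evaluated at definable functions, so it suffices to establish the
  definability of a new notion on variables.\<close>

lemma dfn_comp:
  assumes "dfn R" "\<And>i. dfun (f i)"
  shows "dfn (\<lambda>e. R (\<lambda>i. f i e))"
  using assms
proof (induction arbitrary: f rule: dfn.induct)
  case (ex R)
  have "dfun (case i of 0 \<Rightarrow> (\<lambda>e. e 0) | Suc i \<Rightarrow> (\<lambda>e. f i (\<lambda>j. e (Suc j))))" for i
    by (cases i) (auto intro: dfun_var dfun_rename ex.prems)
  from ex.IH[of "\<lambda>i. case i of 0 \<Rightarrow> (\<lambda>e. e 0) | Suc i \<Rightarrow> (\<lambda>e. f i (\<lambda>j. e (Suc j)))", OF this] have "dfn (\<lambda>e. R (\<lambda>i. f i (\<lambda>j. e (Suc j))) (e 0))" by simp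
  then show ?case by (rule dfn.ex)
next
  case (neg R) show ?case by (rule dfn.neg[OF neg.IH[OF neg.prems]])
next
  case (disj Q R) show ?case
    by (rule dfn.disj[OF disj.IH(1)[OF disj.prems] disj.IH(2)[OF disj.prems]])
qed (intro dfn_eq dfun_S dfun_add dfun_mul dfun_const; assumption)+

lemma dfun_comp:
  assumes "dfun F" "\<And>i. dfun (f i)"
  shows "dfun (\<lambda>e. F (\<lambda>i. f i e))"
proof -
  have "dfun (case i of 0 \<Rightarrow> (\<lambda>e. e 0) | Suc i \<Rightarrow> (\<lambda>e. f i (\<lambda>j. e (Suc j))))" for i
    by (cases i) (auto intro: dfun_var dfun_rename assms)
  from dfn_comp[OF assms(1)[unfolded dfun_def],
      of "\<lambda>i. case i of 0 \<Rightarrow> (\<lambda>e. e 0) | Suc i \<Rightarrow> (\<lambda>e. f i (\<lambda>j. e (Suc j)))", OF this] show ?thesis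
    unfolding dfun_def by simp
qed

lemma dfn_app1: "dfn (\<lambda>e. P (e 0)) \<Longrightarrow> dfun f \<Longrightarrow> dfn (\<lambda>e. P (f e))"
  using dfn_comp[of "\<lambda>e. P (e 0)" "\<lambda>_. f"] by simp

lemma dfn_app2:
  "dfn (\<lambda>e. P (e 0) (e 1)) \<Longrightarrow> dfun f \<Longrightarrow> dfun g \<Longrightarrow> dfn (\<lambda>e. P (f e) (g e))"
  using dfn_comp[of "\<lambda>e. P (e 0) (e 1)" "\<lambda>i. if i = 0 then f else g"] by simp

lemma dfn_app4:
  "dfn (\<lambda>e. P (e 0) (e 1) (e 2) (e 3)) \<Longrightarrow> dfun f \<Longrightarrow> dfun g \<Longrightarrow> dfun h \<Longrightarrow> dfun k \<Longrightarrow>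
    dfn (\<lambda>e. P (f e) (g e) (h e) (k e))"
  using dfn_comp[of "\<lambda>e. P (e 0) (e 1) (e 2) (e 3)"
      "\<lambda>i. if i = 0 then f else if i = 1 then g else if i = 2 then h else k"] by simp

lemma dfun_app1: "dfun (\<lambda>e. F (e 0)) \<Longrightarrow> dfun f \<Longrightarrow> dfun (\<lambda>e. F (f e))"
  using dfun_comp[of "\<lambda>e. F (e 0)" "\<lambda>_. f"] by simp

lemma dfun_app2:
  "dfun (\<lambda>e. F (e 0) (e 1)) \<Longrightarrow> dfun f \<Longrightarrow> dfun g \<Longrightarrow> dfun (\<lambda>e. F (f e) (g e))"
  using dfun_comp[of "\<lambda>e. F (e 0) (e 1)" "\<lambda>i. if i = 0 then f else g"] by simp

section \<open>Arithmetic in a model\<close>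


lemma PA_basic_sat: "p \<in> PA_basic \<Longrightarrow> sat M (\<lambda>i. if i = 0 then x else y) p"
  using models_PA unfolding models_def PA_def by blast

lemma S_not_zero [simp]: "S x \<noteq> \<zero>" "\<zero> \<noteq> S x"
  using PA_basic_sat[of "Neg (Equ (Succ (Var 0)) Zero)" x] by (auto simp: PA_basic_def)

lemma S_inject [simp]: "S x = S y \<longleftrightarrow> x = y"
  using PA_basic_sat[of "Imp (Equ (Succ (Var 0)) (Succ (Var 1))) (Equ (Var 0) (Var 1))" x y]
  by (auto simp: PA_basic_def)

lemma add_zero [simp]: "x \<oplus> \<zero> = x"
  using PA_basic_sat[of "Equ (Add (Var 0) Zero) (Var 0)" x] by (auto simp: PA_basic_def)

lemma add_S [simp]: "x \<oplus> S y = S (x \<oplus> y)"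
  using PA_basic_sat[of "Equ (Add (Var 0) (Succ (Var 1))) (Succ (Add (Var 0) (Var 1)))" x y]
  by (auto simp: PA_basic_def)

lemma mul_zero [simp]: "x \<otimes> \<zero> = \<zero>"
  using PA_basic_sat[of "Equ (Mul (Var 0) Zero) Zero" x] by (auto simp: PA_basic_def)

lemma mul_S [simp]: "x \<otimes> S y = x \<otimes> y \<oplus> x"
  using PA_basic_sat[of "Equ (Mul (Var 0) (Succ (Var 1))) (Add (Mul (Var 0) (Var 1)) (Var 0))" x y]
  by (auto simp: PA_basic_def)

lemma zero_add [simp]: "\<zero> \<oplus> x = x"
  by (rule definable_induct[of "\<lambda>x. \<zero> \<oplus> x = x"]) (intro dfn_basic, simp_all)

lemma S_add [simp]: "S x \<oplus> y = S (x \<oplus> y)"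
  by (rule definable_induct[of "\<lambda>y. S x \<oplus> y = S (x \<oplus> y)"]) (intro dfn_basic, simp_all)

lemma add_comm: "x \<oplus> y = y \<oplus> x"
  by (rule definable_induct[of "\<lambda>y. x \<oplus> y = y \<oplus> x"]) (intro dfn_basic, simp_all)

lemma add_assoc: "(x \<oplus> y) \<oplus> z = x \<oplus> (y \<oplus> z)"
  by (rule definable_induct[of "\<lambda>z. (x \<oplus> y) \<oplus> z = x \<oplus> (y \<oplus> z)"]) (intro dfn_basic, simp_all)

lemma add_left_comm: "x \<oplus> (y \<oplus> z) = y \<oplus> (x \<oplus> z)"
  by (metis add_assoc add_comm)

lemmas add_ac = add_assoc add_comm add_left_comm

lemma zero_mul [simp]: "\<zero> \<otimes> x = \<zero>"
  by (rule definable_induct[of "\<lambda>x. \<zero> \<otimes> x = \<zero>"]) (intro dfn_basic, simp_all)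

lemma S_mul [simp]: "S x \<otimes> y = x \<otimes> y \<oplus> y"
  by (rule definable_induct[of "\<lambda>y. S x \<otimes> y = x \<otimes> y \<oplus> y"])
    (intro dfn_basic, simp_all add: add_ac)

lemma mul_comm: "x \<otimes> y = y \<otimes> x"
  by (rule definable_induct[of "\<lambda>y. x \<otimes> y = y \<otimes> x"]) (intro dfn_basic, simp_all)

lemma add_mul: "(x \<oplus> y) \<otimes> z = x \<otimes> z \<oplus> y \<otimes> z"
  by (rule definable_induct[of "\<lambda>z. (x \<oplus> y) \<otimes> z = x \<otimes> z \<oplus> y \<otimes> z"])
    (intro dfn_basic, simp_all add: add_ac)

lemma mul_add: "z \<otimes> (x \<oplus> y) = z \<otimes> x \<oplus> z \<otimes> y"
  by (metis add_mul mul_comm)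

lemma mul_assoc: "(x \<otimes> y) \<otimes> z = x \<otimes> (y \<otimes> z)"
  by (rule definable_induct[of "\<lambda>z. (x \<otimes> y) \<otimes> z = x \<otimes> (y \<otimes> z)"])
    (intro dfn_basic, simp_all add: mul_add)

lemma mul_left_comm: "x \<otimes> (y \<otimes> z) = y \<otimes> (x \<otimes> z)"
  by (metis mul_assoc mul_comm)

lemmas mul_ac = mul_assoc mul_comm mul_left_comm

lemma add_left_cancel [simp]: "x \<oplus> y = x \<oplus> z \<longleftrightarrow> y = z"
proof -
  have "x \<oplus> y = x \<oplus> z \<longrightarrow> y = z"
    by (rule definable_induct[of "\<lambda>x. x \<oplus> y = x \<oplus> z \<longrightarrow> y = z"]) (intro dfn_basic, simp_all)
  then show ?thesis by auto
qed

lemma add_right_cancel [simp]: "y \<oplus> x = z \<oplus> x \<longleftrightarrow> y = z"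
  by (metis add_comm add_left_cancel)

lemma zero_or_S: "x = \<zero> \<or> (\<exists>y. x = S y)"
  by (rule definable_induct[of "\<lambda>x. x = \<zero> \<or> (\<exists>y. x = S y)"]) (intro dfn_basic, simp_all)

lemma add_eq_zero [simp]: "x \<oplus> y = \<zero> \<longleftrightarrow> x = \<zero> \<and> y = \<zero>"
  by (metis zero_or_S add_S S_not_zero(1) add_zero)

text \<open>The order is the one expressed by the formula \<open>less\<close>.\<close>

definition le :: "'a \<Rightarrow> 'a \<Rightarrow> bool" (infix "\<preceq>" 50) where "x \<preceq> y \<longleftrightarrow> (\<exists>z. x \<oplus> z = y)"
definition lt :: "'a \<Rightarrow> 'a \<Rightarrow> bool" (infix "\<prec>" 50) where "x \<prec> y \<longleftrightarrow> (\<exists>z. x \<oplus> S z = y)"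

lemma dfn_le: "dfun f \<Longrightarrow> dfun g \<Longrightarrow> dfn (\<lambda>e. f e \<preceq> g e)"
  by (rule dfn_app2) (unfold le_def, intro dfn_basic)
lemma dfn_lt: "dfun f \<Longrightarrow> dfun g \<Longrightarrow> dfn (\<lambda>e. f e \<prec> g e)"
  by (rule dfn_app2) (unfold lt_def, intro dfn_basic)

lemma le_or_lt: "x \<preceq> y \<or> y \<prec> x"
proof (rule definable_induct[of "\<lambda>x. x \<preceq> y \<or> y \<prec> x"])
  show "dfn (\<lambda>e. e 0 \<preceq> y \<or> y \<prec> e 0)" by (intro dfn_basic dfn_le dfn_lt)
  show "\<zero> \<preceq> y \<or> y \<prec> \<zero>" by (simp add: le_def)
next
  fix x assume "x \<preceq> y \<or> y \<prec> x"
  then show "S x \<preceq> y \<or> y \<prec> S x"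
  proof
    assume "x \<preceq> y"
    then obtain z where "x \<oplus> z = y" unfolding le_def by blast
    then show ?thesis using zero_or_S[of z] unfolding le_def lt_def by (metis S_add add_S add_zero)
  next
    assume "y \<prec> x"
    then obtain z where "y \<oplus> S z = x" unfolding lt_def by blast
    then have "y \<oplus> S (S z) = S x" by simp
    then show ?thesis unfolding lt_def by blast
  qed
qed

lemma le_antisym: "x \<preceq> y \<Longrightarrow> y \<preceq> x \<Longrightarrow> x = y"
  unfolding le_def by (metis add_assoc add_eq_zero add_left_cancel add_zero)

lemma lt_iff: "x \<prec> y \<longleftrightarrow> x \<preceq> y \<and> x \<noteq> y"
  unfolding le_def lt_def by (metis S_not_zero(1) add_left_cancel add_zero zero_or_S)

sublocale linorder "(\<preceq>)" "(\<prec>)"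
proof
  fix x y z
  show "x \<prec> y \<longleftrightarrow> x \<preceq> y \<and> \<not> y \<preceq> x" using lt_iff le_antisym by (metis le_def add_zero)
  show "x \<preceq> x" unfolding le_def using add_zero by blast
  show "x \<preceq> y \<Longrightarrow> y \<preceq> z \<Longrightarrow> x \<preceq> z" unfolding le_def by (metis add_assoc)
  show "x \<preceq> y \<Longrightarrow> y \<preceq> x \<Longrightarrow> x = y" by (rule le_antisym)
  show "x \<preceq> y \<or> y \<preceq> x" using le_or_lt lt_iff by blast
qed

lemma zero_le [simp]: "\<zero> \<preceq> x" by (simp add: le_def)
lemma not_lt_zero [simp]: "\<not> x \<prec> \<zero>" by (simp add: lt_def)
lemma S_le_S [simp]: "S x \<preceq> S y \<longleftrightarrow> x \<preceq> y" by (simp add: le_def)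
lemma lt_S [simp]: "x \<prec> S y \<longleftrightarrow> x \<preceq> y" by (simp add: lt_def le_def)
lemma S_le: "S x \<preceq> y \<longleftrightarrow> x \<prec> y" by (simp add: lt_def le_def)
lemma le_add [simp]: "x \<preceq> x \<oplus> y" "x \<preceq> y \<oplus> x" by (auto simp: le_def intro: add_comm)
lemma add_le_cancel [simp]: "x \<oplus> y \<preceq> x \<oplus> z \<longleftrightarrow> y \<preceq> z" by (simp add: le_def add_assoc)

lemma add_mono: "x \<preceq> x' \<Longrightarrow> y \<preceq> y' \<Longrightarrow> x \<oplus> y \<preceq> x' \<oplus> y'"
  by (metis add_comm add_le_cancel order.trans)

lemma add_less_le_mono: "x \<prec> x' \<Longrightarrow> y \<preceq> y' \<Longrightarrow> x \<oplus> y \<prec> x' \<oplus> y'"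
  using add_mono[of "S x" x' y y'] by (simp add: S_le)

lemma mul_mono: "x \<preceq> x' \<Longrightarrow> y \<preceq> y' \<Longrightarrow> x \<otimes> y \<preceq> x' \<otimes> y'"
proof -
  have "x \<otimes> y \<preceq> x' \<otimes> y" if "x \<preceq> x'" for x x' y
    using that unfolding le_def by (metis add_mul)
  then show "x \<preceq> x' \<Longrightarrow> y \<preceq> y' \<Longrightarrow> x \<otimes> y \<preceq> x' \<otimes> y'"
    by (metis mul_comm order.trans)
qed

lemma definable_less_induct:
  assumes P: "dfn (\<lambda>e. P (e 0))" and step: "\<And>x. (\<And>y. y \<prec> x \<Longrightarrow> P y) \<Longrightarrow> P x"
  shows "P x"
proof -
  have "\<forall>y. y \<prec> x \<longrightarrow> P y"
  proof (rule definable_induct[of "\<lambda>x. \<forall>y. y \<prec> x \<longrightarrow> P y"])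
    show "dfn (\<lambda>e. \<forall>y. y \<prec> e 0 \<longrightarrow> P y)"
      by (intro dfn_basic dfn_lt dfn_app1[OF P])
  next
    fix x assume "\<forall>y. y \<prec> x \<longrightarrow> P y"
    then show "\<forall>y. y \<prec> S x \<longrightarrow> P y" using step[of x] by (metis lt_S le_less)
  qed simp
  then show ?thesis using step by blast
qed

lemma definable_least:
  assumes P: "dfn (\<lambda>e. P (e 0))" and "P x"
  shows "\<exists>y. P y \<and> (\<forall>z. z \<prec> y \<longrightarrow> \<not> P z)"
  using definable_less_induct[of "\<lambda>x. \<not> P x"] assms dfn.neg[OF P] by metis


section \<open>Pairing\<close>

lemma double_inject: "x \<oplus> x = y \<oplus> y \<longleftrightarrow> x = y"
  using add_less_le_mono[of x y x y] add_less_le_mono[of y x y x] by (metis less_irrefl linorder_cases less_imp_le)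

text \<open>The number \<open>s (s + 1)\<close> is even, and half of it is at least \<open>s\<close>. The second part yields the bounds for
  the components of a pair.\<close>

lemma pair_bound_ex: "\<exists>r. (s \<oplus> r) \<oplus> (s \<oplus> r) = s \<otimes> S s"
proof (rule definable_induct[of "\<lambda>s. \<exists>r. (s \<oplus> r) \<oplus> (s \<oplus> r) = s \<otimes> S s"])
  show "dfn (\<lambda>e. \<exists>r. (e 0 \<oplus> r) \<oplus> (e 0 \<oplus> r) = e 0 \<otimes> S (e 0))" by (intro dfn_basic)
next
  fix s assume "\<exists>r. (s \<oplus> r) \<oplus> (s \<oplus> r) = s \<otimes> S s"
  then obtain r where r: "(s \<oplus> r) \<oplus> (s \<oplus> r) = s \<otimes> S s" by blast
  have "(S s \<oplus> (s \<oplus> r)) \<oplus> (S s \<oplus> (s \<oplus> r)) = (S s \<oplus> S s) \<oplus> ((s \<oplus> r) \<oplus> (s \<oplus> r))"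
    by (simp add: add_ac)
  also have "\<dots> = S s \<otimes> S (S s)" unfolding r by (simp add: add_ac)
  finally show "\<exists>r. (S s \<oplus> r) \<oplus> (S s \<oplus> r) = S s \<otimes> S (S s)" by blast
qed simp

definition pr :: "'a \<Rightarrow> 'a \<Rightarrow> 'a" where
  "pr x y = (THE z. z \<oplus> z = (x \<oplus> y) \<otimes> S (x \<oplus> y) \<oplus> (x \<oplus> x))"

lemma pr_eqI: "z \<oplus> z = (x \<oplus> y) \<otimes> S (x \<oplus> y) \<oplus> (x \<oplus> x) \<Longrightarrow> pr x y = z"
  unfolding pr_def by (rule the_equality, assumption) (metis double_inject)

lemma pr_ex: "\<exists>r. pr x y = (x \<oplus> y) \<oplus> (x \<oplus> r) \<and>
  pr x y \<oplus> pr x y = (x \<oplus> y) \<otimes> S (x \<oplus> y) \<oplus> (x \<oplus> x)"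
proof -
  obtain r where r: "((x \<oplus> y) \<oplus> r) \<oplus> ((x \<oplus> y) \<oplus> r) = (x \<oplus> y) \<otimes> S (x \<oplus> y)"
    using pair_bound_ex by blast
  have "((x \<oplus> y) \<oplus> (x \<oplus> r)) \<oplus> ((x \<oplus> y) \<oplus> (x \<oplus> r)) =
      (((x \<oplus> y) \<oplus> r) \<oplus> ((x \<oplus> y) \<oplus> r)) \<oplus> (x \<oplus> x)"
    by (simp only: add_ac)
  then have z: "((x \<oplus> y) \<oplus> (x \<oplus> r)) \<oplus> ((x \<oplus> y) \<oplus> (x \<oplus> r)) =
      (x \<oplus> y) \<otimes> S (x \<oplus> y) \<oplus> (x \<oplus> x)"
    unfolding r .
  show ?thesis
    by (rule exI[of _ r], rule conjI[OF pr_eqI[OF z]]) (unfold pr_eqI[OF z], rule z)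
qed

lemma pr_iff: "z = pr x y \<longleftrightarrow> z \<oplus> z = (x \<oplus> y) \<otimes> S (x \<oplus> y) \<oplus> (x \<oplus> x)"
  using pr_ex[of x y] double_inject by metis

lemma le_pr: "x \<preceq> pr x y" "y \<preceq> pr x y" and lt_pr: "x \<noteq> \<zero> \<Longrightarrow> y \<prec> pr x y"
proof -
  obtain r where r: "pr x y = (x \<oplus> y) \<oplus> (x \<oplus> r)" using pr_ex by blast
  show "x \<preceq> pr x y" unfolding r add_assoc by simp
  show "y \<preceq> pr x y" unfolding r add_assoc add_left_comm[of x y] by simp
  have "pr x y = y \<oplus> (x \<oplus> (x \<oplus> r))" using r by (simp add: add_ac)
  then show "x \<noteq> \<zero> \<Longrightarrow> y \<prec> pr x y" by (metis add_eq_zero add_left_cancel add_zero le_add(1) lt_iff)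
qed

lemma pr_inject [simp]: "pr x y = pr x' y' \<longleftrightarrow> x = x' \<and> y = y'"
proof
  assume eq: "pr x y = pr x' y'"
  have lt: "pr x y \<prec> pr x' y'" if "x \<oplus> y \<prec> x' \<oplus> y'" for x y x' y'
  proof -
    let ?s = "x \<oplus> y" and ?s' = "x' \<oplus> y'"
    have "pr x y \<oplus> pr x y = ?s \<otimes> S ?s \<oplus> (x \<oplus> x)" using pr_ex by blast
    also have "\<dots> \<preceq> ?s \<otimes> S ?s \<oplus> (?s \<oplus> ?s)" by (intro add_mono) auto
    also have "\<dots> \<prec> S ?s \<otimes> S (S ?s)"
    proof -
      have "S ?s \<otimes> S (S ?s) = S (S (?s \<otimes> S ?s \<oplus> (?s \<oplus> ?s)))" by (simp add: add_ac)
      then show ?thesis by (simp add: le_less)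
    qed
    also have "\<dots> \<preceq> ?s' \<otimes> S ?s'" using that by (intro mul_mono) (simp_all add: S_le)
    also have "\<dots> \<preceq> ?s' \<otimes> S ?s' \<oplus> (x' \<oplus> x')" by simp
    also have "\<dots> = pr x' y' \<oplus> pr x' y'" using pr_ex by metis
    finally show ?thesis using add_mono[of "pr x' y'" "pr x y"] by (meson not_le)
  qed
  then have s: "x \<oplus> y = x' \<oplus> y'"
    using eq lt[of x y x' y'] lt[of x' y' x y] by (metis less_irrefl linorder_cases)
  moreover have "pr x y \<oplus> pr x y = pr x' y' \<oplus> pr x' y'" using eq by simp
  ultimately have "x \<oplus> x = x' \<oplus> x'" using pr_ex[of x y] pr_ex[of x' y'] by (metis add_left_cancel)
  then show "x = x' \<and> y = y'" using s double_inject by force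
qed simp

lemma dfun_pr: "dfun f \<Longrightarrow> dfun g \<Longrightarrow> dfun (\<lambda>e. pr (f e) (g e))"
  by (rule dfun_app2) (unfold dfun_def pr_iff, intro dfn_basic)

lemmas dfn_intros = dfn_basic dfn_le dfn_lt dfun_pr


section \<open>Coding of bounded definable sets\<close>

definition divides :: "'a \<Rightarrow> 'a \<Rightarrow> bool" where "divides m a \<longleftrightarrow> (\<exists>q. a = q \<otimes> m)"
text \<open>Being coprime is expressed through divisibility alone (Gauss' lemma serves as the definition).
  This avoids subtraction and Bezout coefficients inside \<open>M\<close>.\<close>

definition coprime_to :: "'a \<Rightarrow> 'a \<Rightarrow> bool" where "coprime_to m a \<longleftrightarrow> (\<forall>k. divides m (a \<otimes> k) \<longrightarrow> divides m k)"

lemma dfn_divides: "dfun f \<Longrightarrow> dfun g \<Longrightarrow> dfn (\<lambda>e. divides (f e) (g e))"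
  by (rule dfn_app2) (unfold divides_def, intro dfn_basic)

lemma dfn_coprime_to: "dfun f \<Longrightarrow> dfun g \<Longrightarrow> dfn (\<lambda>e. coprime_to (f e) (g e))"
  by (rule dfn_app2) (unfold coprime_to_def, intro dfn_basic dfn_divides)

lemma divides_mul: "divides m a \<Longrightarrow> divides m (a \<otimes> k)" "divides m a \<Longrightarrow> divides m (k \<otimes> a)"
  unfolding divides_def by (metis mul_assoc mul_comm)+

lemma divides_mul_self [simp]: "divides m (m \<otimes> k)" "divides m (k \<otimes> m)"
  unfolding divides_def by (metis mul_comm)+

lemma divides_cancel:
  assumes "divides m u" "divides m (k \<oplus> u)" shows "divides m k"
proof -
  obtain q r where q: "u = q \<otimes> m" and r: "k \<oplus> q \<otimes> m = r \<otimes> m"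
    using assms unfolding divides_def by metis
  show ?thesis
  proof (cases "q \<preceq> r")
    case True
    then obtain d where "r = q \<oplus> d" unfolding le_def by blast
    with r have "k \<oplus> q \<otimes> m = d \<otimes> m \<oplus> q \<otimes> m" by (simp add: add_mul add_comm)
    then show ?thesis unfolding divides_def by auto
  next
    case False
    then obtain d where "q = r \<oplus> d" by (metis le_def linear)
    with r have "(k \<oplus> d \<otimes> m) \<oplus> r \<otimes> m = \<zero> \<oplus> r \<otimes> m" by (simp add: add_mul add_ac)
    then have "k = \<zero>" unfolding add_right_cancel by simp
    then show ?thesis unfolding divides_def by (metis zero_mul)
  qed
qed

lemma coprime_to_mul: "coprime_to m a \<Longrightarrow> coprime_to m b \<Longrightarrow> coprime_to m (a \<otimes> b)"
  unfolding coprime_to_def mul_assoc by blast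

text \<open>A substitute for the factorial of \<open>c\<close>.\<close>

lemma common_multiple: "\<exists>b. b \<noteq> \<zero> \<and> (\<forall>d. d \<noteq> \<zero> \<and> d \<preceq> c \<longrightarrow> divides d b)"
proof (rule definable_induct[of "\<lambda>c. \<exists>b. b \<noteq> \<zero> \<and> (\<forall>d. d \<noteq> \<zero> \<and> d \<preceq> c \<longrightarrow> divides d b)"])
  show "dfn (\<lambda>e. \<exists>b. b \<noteq> \<zero> \<and> (\<forall>d. d \<noteq> \<zero> \<and> d \<preceq> e 0 \<longrightarrow> divides d b))"
    by (intro dfn_intros dfn_divides)
  show "\<exists>b. b \<noteq> \<zero> \<and> (\<forall>d. d \<noteq> \<zero> \<and> d \<preceq> \<zero> \<longrightarrow> divides d b)"
    by (rule exI[of _ "S \<zero>"]) (auto dest: le_antisym)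
next
  fix c assume "\<exists>b. b \<noteq> \<zero> \<and> (\<forall>d. d \<noteq> \<zero> \<and> d \<preceq> c \<longrightarrow> divides d b)"
  then obtain b where b: "b \<noteq> \<zero>" "\<And>d. d \<noteq> \<zero> \<Longrightarrow> d \<preceq> c \<Longrightarrow> divides d b" by blast
  have "divides d (b \<otimes> S c)" if "d \<noteq> \<zero>" "d \<preceq> S c" for d
  proof (cases "d = S c")
    case True
    then show ?thesis by (simp only: divides_mul_self)
  next
    case False
    with that have "d \<preceq> c" by (metis lt_S lt_iff)
    with b(2)[OF that(1)] show ?thesis by (intro divides_mul(1))
  qed
  moreover have "b \<otimes> S c \<noteq> \<zero>" using b(1) by simp
  ultimately show "\<exists>b. b \<noteq> \<zero> \<and> (\<forall>d. d \<noteq> \<zero> \<and> d \<preceq> S c \<longrightarrow> divides d b)" by blast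
qed

definition modulus :: "'a \<Rightarrow> 'a \<Rightarrow> 'a" where "modulus b y = S (S y \<otimes> b)"

lemma coprime_to_modulus_base: "coprime_to (modulus b y) b"
  unfolding coprime_to_def
proof (intro allI impI)
  fix k assume k: "divides (modulus b y) (b \<otimes> k)"
  have "divides (modulus b y) (S y \<otimes> (b \<otimes> k))" using k by (rule divides_mul)
  moreover have "divides (modulus b y) (k \<oplus> S y \<otimes> (b \<otimes> k))"
  proof -
    have "k \<oplus> S y \<otimes> (b \<otimes> k) = modulus b y \<otimes> k"
      unfolding modulus_def by (simp add: add_mul mul_add add_ac mul_ac)
    then show ?thesis by (simp only: divides_mul_self)
  qed
  ultimately show "divides (modulus b y) k" by (rule divides_cancel)
qed

text \<open>Goedel's moduli are pairwise coprime. If the modulus \<open>m\<close> at \<open>y\<close> divides \<open>k\<close> times the modulus at \<open>z\<close>, it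
  divides \<open>v b k\<close>, where \<open>v\<close> is the distance of \<open>y\<close> and \<open>z\<close>; since \<open>v\<close> divides \<open>b\<close>, it divides
  \<open>b b k\<close> and hence \<open>k\<close>.\<close>

lemma coprime_to_modulus:
  assumes d: "\<And>d. d \<noteq> \<zero> \<Longrightarrow> d \<preceq> c \<Longrightarrow> divides d b" and y: "y \<preceq> c" "z \<preceq> c" "y \<noteq> z"
  shows "coprime_to (modulus b y) (modulus b z)"
  unfolding coprime_to_def
proof (intro allI impI)
  fix k let ?m = "modulus b y"
  assume k: "divides ?m (modulus b z \<otimes> k)"
  have shift: "modulus b (u \<oplus> v) \<otimes> k = (v \<otimes> b) \<otimes> k \<oplus> modulus b u \<otimes> k" for u v
    unfolding modulus_def by (simp add: add_mul add_ac)
  have "\<exists>v. v \<noteq> \<zero> \<and> v \<preceq> c \<and> divides ?m ((v \<otimes> b) \<otimes> k)"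
  proof (cases "y \<prec> z")
    case True
    then obtain v where v: "z = y \<oplus> S v" unfolding lt_def by metis
    then have "divides ?m ((S v \<otimes> b) \<otimes> k)"
      using k divides_cancel[of ?m "?m \<otimes> k"] by (simp only: shift divides_mul_self)
    moreover have "S v \<preceq> c" using v y(2) by (metis le_add(2) order.trans)
    ultimately show ?thesis using S_not_zero(1) by blast
  next
    case False
    then obtain v where v: "y = z \<oplus> S v" using y(3) unfolding lt_def by (metis linorder_cases lt_def)
    have "divides ?m ((S v \<otimes> b) \<otimes> k \<oplus> modulus b z \<otimes> k)"
      using shift[of z "S v", folded v] by (metis divides_mul_self(1))
    then have "divides ?m ((S v \<otimes> b) \<otimes> k)" using k divides_cancel by blast
    moreover have "S v \<preceq> c" using v y(1) by (metis le_add(2) order.trans)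
    ultimately show ?thesis using S_not_zero(1) by blast
  qed
  then obtain v where v: "v \<noteq> \<zero>" "v \<preceq> c" "divides ?m ((v \<otimes> b) \<otimes> k)" by blast
  then obtain q where "b = q \<otimes> v" using d unfolding divides_def by blast
  then have "q \<otimes> ((v \<otimes> b) \<otimes> k) = b \<otimes> (b \<otimes> k)" by (simp add: mul_ac)
  then have "divides ?m (b \<otimes> (b \<otimes> k))" using v(3) by (metis divides_mul(2))
  then show "divides ?m k" using coprime_to_modulus_base unfolding coprime_to_def by blast
qed

definition elemM :: "'a \<Rightarrow> 'a \<Rightarrow> 'a \<Rightarrow> 'a \<Rightarrow> bool" where
  "elemM a b c y \<longleftrightarrow> y \<prec> c \<and> divides (modulus b y) a"

lemma dfn_elemM:
  "dfun f \<Longrightarrow> dfun g \<Longrightarrow> dfun h \<Longrightarrow> dfun k \<Longrightarrow> dfn (\<lambda>e. elemM (f e) (g e) (h e) (k e))"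
  by (rule dfn_app4) (unfold elemM_def modulus_def, intro dfn_intros dfn_divides)

text \<open>The code \<open>a\<close> is the product of the moduli of the elements. Building it up to \<open>z\<close>, the induction has to
  remember that the moduli still to come are coprime to \<open>a\<close>: then multiplying by a new modulus
  decides membership of \<open>z\<close> and changes nothing below \<open>z\<close>.\<close>

lemma code_bounded_set:
  assumes D: "dfn (\<lambda>e. D (e 0))"
  shows "\<exists>a b. \<forall>y. elemM a b c y \<longleftrightarrow> y \<prec> c \<and> D y"
proof -
  obtain b where b: "b \<noteq> \<zero>" "\<And>d. d \<noteq> \<zero> \<Longrightarrow> d \<preceq> c \<Longrightarrow> divides d b" using common_multiple by blast
  \<comment> \<open>The code of the part below \<open>z\<close>, together with coprimality to the moduli not
    yet decided.\<close>
  let ?P = "\<lambda>z. \<exists>a. (\<forall>y. y \<prec> c \<and> y \<prec> z \<longrightarrow> (divides (modulus b y) a \<longleftrightarrow> D y)) \<and>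
    (\<forall>w. w \<prec> c \<and> z \<preceq> w \<longrightarrow> coprime_to (modulus b w) a)"
  have "?P c"
  proof (rule definable_induct[of ?P])
    show "dfn (\<lambda>e. ?P (e 0))"
      unfolding modulus_def by (intro dfn_intros dfn_divides dfn_coprime_to dfn_app1[OF D])
    show "?P \<zero>" by (rule exI[of _ "S \<zero>"]) (simp add: coprime_to_def)
  next
    fix z assume "?P z"
    then obtain a where a: "\<And>y. y \<prec> c \<Longrightarrow> y \<prec> z \<Longrightarrow> divides (modulus b y) a \<longleftrightarrow> D y"
        "\<And>w. w \<prec> c \<Longrightarrow> z \<preceq> w \<Longrightarrow> coprime_to (modulus b w) a" by blast
    have coprime_to: "coprime_to (modulus b y) (modulus b z)" if "y \<prec> c" "z \<prec> c" "y \<noteq> z" for y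
      using coprime_to_modulus[of c b y z] b(2) that by (simp add: less_imp_le)
    consider "\<not> z \<prec> c" | "z \<prec> c" "D z" | "z \<prec> c" "\<not> D z" by blast
    then show "?P (S z)"
    proof cases
      case 1
      then have "y \<prec> c \<Longrightarrow> y \<prec> z" for y by order
      moreover have "w \<prec> c \<Longrightarrow> z \<preceq> w \<Longrightarrow> False" for w using 1 by order
      ultimately show ?thesis using a by (intro exI[of _ a]) (metis S_le less_imp_le)
    next
      case 2
      have "divides (modulus b y) (a \<otimes> modulus b z) \<longleftrightarrow> D y" if "y \<prec> c" "y \<preceq> z" for y
      proof (cases "y = z")
        case False
        then have "divides (modulus b y) (modulus b z \<otimes> a) \<longleftrightarrow> divides (modulus b y) a"
          using coprime_to[of y] that 2 unfolding coprime_to_def by (metis divides_mul(2))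
        with a(1)[of y] that False show ?thesis by (simp add: lt_iff mul_comm)
      qed (use 2 in simp)
      moreover have "coprime_to (modulus b w) (a \<otimes> modulus b z)" if "w \<prec> c" "S z \<preceq> w" for w
        using that a(2)[of w] coprime_to[of w] 2 by (intro coprime_to_mul) (auto simp: S_le lt_iff)
      ultimately show ?thesis by (intro exI[of _ "a \<otimes> modulus b z"]) simp
    next
      case 3
      have "\<not> divides (modulus b z) a"
      proof
        assume "divides (modulus b z) a"
        then have "divides (modulus b z) (a \<otimes> S \<zero>)" by simp
        then have "divides (modulus b z) (S \<zero>)" using a(2)[of z] 3 unfolding coprime_to_def by blast
        then obtain q where q: "S \<zero> = q \<otimes> modulus b z" unfolding divides_def by blast
        then have "S \<zero> \<otimes> modulus b z \<preceq> S \<zero>"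
          by (metis mul_mono order.refl S_le_S zero_le zero_mul zero_or_S S_not_zero(1))
        then show False using b(1) by (auto simp: modulus_def dest: le_antisym)
      qed
      then have "divides (modulus b y) a \<longleftrightarrow> D y" if "y \<prec> c" "y \<preceq> z" for y
        using a(1)[of y] that 3 by (cases "y = z") (auto simp: lt_iff)
      moreover have "coprime_to (modulus b w) a" if "w \<prec> c" "S z \<preceq> w" for w
        using that a(2)[of w] by (simp add: S_le less_imp_le)
      ultimately show ?thesis by (intro exI[of _ a]) simp
    qed
  qed
  then show ?thesis unfolding elemM_def by blast
qed

section \<open>Inductive definitions inside the model\<close>


text \<open>Monotone operators that use finitely many elements of their argument only. This is what makes a
  union of finitely many derivations a derivation.\<close>

definition finitary :: "(('a \<Rightarrow> bool) \<Rightarrow> bool) \<Rightarrow> bool" where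
  "finitary A \<longleftrightarrow> (\<forall>P. A P \<longrightarrow> (\<exists>F. finite F \<and> (\<forall>x\<in>F. P x) \<and> (\<forall>Q. (\<forall>x\<in>F. Q x) \<longrightarrow> A Q)))"

lemma finitary_const: "finitary (\<lambda>P. C)"
  unfolding finitary_def by (metis finite.emptyI empty_iff)

lemma finitary_mem: "finitary (\<lambda>P. P t)"
  unfolding finitary_def by (intro allI impI exI[of _ "{t}"]) simp

lemma finitaryE:
  assumes "finitary A" "A P"
  obtains F where "finite F" "\<forall>x\<in>F. P x" "\<And>Q. \<forall>x\<in>F. Q x \<Longrightarrow> A Q"
  using assms unfolding finitary_def by metis

lemma finitary_conj: assumes "finitary A" "finitary B" shows "finitary (\<lambda>P. A P \<and> B P)"
  unfolding finitary_def
proof (intro allI impI)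
  fix P assume "A P \<and> B P"
  then have A: "A P" and B: "B P" by simp_all
  obtain F where F: "finite F" "\<forall>x\<in>F. P x" and FA: "\<And>Q. \<forall>x\<in>F. Q x \<Longrightarrow> A Q"
    using finitaryE[OF assms(1) A] by metis
  obtain G where G: "finite G" "\<forall>x\<in>G. P x" and GB: "\<And>Q. \<forall>x\<in>G. Q x \<Longrightarrow> B Q"
    using finitaryE[OF assms(2) B] by metis
  show "\<exists>F. finite F \<and> (\<forall>x\<in>F. P x) \<and> (\<forall>Q. (\<forall>x\<in>F. Q x) \<longrightarrow> A Q \<and> B Q)"
    by (rule exI[of _ "F \<union> G"]) (use F G in \<open>auto intro!: FA GB\<close>)
qed

lemma finitary_disj: assumes "finitary A" "finitary B" shows "finitary (\<lambda>P. A P \<or> B P)"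
  using assms unfolding finitary_def by metis

lemma finitary_ex: assumes "\<And>b. finitary (A b)" shows "finitary (\<lambda>P. \<exists>b. A b P)"
  using assms unfolding finitary_def by metis

lemmas finitary_intros = finitary_const finitary_mem finitary_conj finitary_disj finitary_ex

lemma finitary_mono:
  assumes "finitary A" "A P" "\<And>x. P x \<Longrightarrow> Q x"
  shows "A Q"
proof -
  obtain F where "\<forall>x\<in>F. P x" and "\<And>Q. \<forall>x\<in>F. Q x \<Longrightarrow> A Q"
    using finitaryE[OF assms(1,2)] by metis
  with assms(3) show ?thesis by metis
qed

text \<open>The meaning of \<open>inductively\<close>.\<close>

definition ind :: "(('a \<Rightarrow> bool) \<Rightarrow> 'a \<Rightarrow> bool) \<Rightarrow> 'a \<Rightarrow> bool" where
  "ind step x \<longleftrightarrow> (\<exists>a b c. elemM a b c x \<and> (\<forall>y. elemM a b c y \<longrightarrow> step (elemM a b c) y))"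

text \<open>From left to right, each element of a derivation has the same derivation. From right to left, the
  finitely many elements used by \<open>step\<close> have derivations, whose union together with \<open>x\<close> is again
  definable and bounded, hence coded.\<close>

lemma ind_fixpoint:
  assumes finitary: "\<And>y. finitary (\<lambda>P. step P y)"
  shows "ind step x \<longleftrightarrow> step (ind step) x"
proof
  assume "ind step x"
  then obtain a b c where abc: "elemM a b c x" "\<And>y. elemM a b c y \<Longrightarrow> step (elemM a b c) y"
    unfolding ind_def by blast
  then have "ind step y" if "elemM a b c y" for y using that unfolding ind_def by blast
  then show "step (ind step) x" by (rule finitary_mono[OF finitary abc(2)[OF abc(1)]])
next
  assume "step (ind step) x"
  then obtain F where F: "finite F" "\<forall>y\<in>F. ind step y" and step: "\<And>Q. (\<forall>y\<in>F. Q y) \<Longrightarrow> step Q x"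
    using finitaryE[OF finitary] by metis
  \<comment> \<open>One derivation containing all elements of \<open>F\<close>.\<close>
  have "\<exists>a b c. (\<forall>y\<in>F. elemM a b c y) \<and> (\<forall>y. elemM a b c y \<longrightarrow> step (elemM a b c) y)"
    using F
  proof (induction F rule: finite_induct)
    case empty
    obtain a b where "\<forall>y. elemM a b \<zero> y \<longleftrightarrow> y \<prec> \<zero> \<and> False"
      using code_bounded_set[OF dfn_eq[OF dfun_var[of 0] dfun_S[OF dfun_var[of 0]]]] by (metis not_lt_zero)
    then show ?case by blast
  next
    case (insert y F)
    then obtain a b c where abc: "\<forall>y\<in>F. elemM a b c y" "\<And>y. elemM a b c y \<Longrightarrow> step (elemM a b c) y"
      by auto
    from insert.prems obtain a' b' c' where
      abc': "elemM a' b' c' y" "\<And>y. elemM a' b' c' y \<Longrightarrow> step (elemM a' b' c') y"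
      unfolding ind_def by auto
    have "dfn (\<lambda>e. elemM a b c (e 0) \<or> elemM a' b' c' (e 0))" by (intro dfn_intros dfn_elemM)
    from code_bounded_set[OF this] obtain a'' b'' where
      code: "\<And>y. elemM a'' b'' (max c c') y \<longleftrightarrow> y \<prec> max c c' \<and> (elemM a b c y \<or> elemM a' b' c' y)"
      by blast
    have "y \<prec> max c c'" if "elemM a b c y \<or> elemM a' b' c' y" for y
      using that unfolding elemM_def by (auto simp: less_max_iff_disj)
    with code have code: "elemM a'' b'' (max c c') y \<longleftrightarrow> elemM a b c y \<or> elemM a' b' c' y" for y
      by blast
    have "step (elemM a'' b'' (max c c')) y" if y: "elemM a b c y \<or> elemM a' b' c' y" for y
      using y
    proof
      assume "elemM a b c y"
      show ?thesis by (rule finitary_mono[OF finitary abc(2)]) (fact, simp add: code)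
    next
      assume "elemM a' b' c' y"
      show ?thesis by (rule finitary_mono[OF finitary abc'(2)]) (fact, simp add: code)
    qed
    then show ?case using abc(1) abc'(1) code by blast
  qed
  then obtain a b c where abc: "\<And>y. y \<in> F \<Longrightarrow> elemM a b c y"
      "\<And>y. elemM a b c y \<Longrightarrow> step (elemM a b c) y" by blast
  let ?c = "max c (S x)"
  have "dfn (\<lambda>e. elemM a b c (e 0) \<or> e 0 = x)" by (intro dfn_intros dfn_elemM)
  from code_bounded_set[OF this] obtain a' b' where
    code: "\<And>y. elemM a' b' ?c y \<longleftrightarrow> y \<prec> ?c \<and> (elemM a b c y \<or> y = x)" by blast
  have "y \<prec> ?c" if "elemM a b c y \<or> y = x" for y
    using that unfolding elemM_def by (auto simp: less_max_iff_disj)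
  with code have code: "elemM a' b' ?c y \<longleftrightarrow> elemM a b c y \<or> y = x" for y by blast
  have "step (elemM a' b' ?c) y" if "elemM a b c y \<or> y = x" for y
    using that
  proof
    assume "elemM a b c y"
    show ?thesis by (rule finitary_mono[OF finitary abc(2)]) (fact, simp add: code)
  next
    assume "y = x"
    then show ?thesis using step[of "elemM a' b' ?c"] abc(1) code by simp
  qed
  then show "ind step x" unfolding ind_def using code by blast
qed

definition ind2 :: "(('a \<Rightarrow> 'a \<Rightarrow> bool) \<Rightarrow> 'a \<Rightarrow> 'a \<Rightarrow> bool) \<Rightarrow> 'a \<Rightarrow> 'a \<Rightarrow> bool" where
  "ind2 step x y = ind (\<lambda>P p. \<exists>x y. p = pr x y \<and> step (\<lambda>x y. P (pr x y)) x y) (pr x y)"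

lemma ind2_fixpoint:
  assumes finitary: "\<And>x y. finitary (\<lambda>P. step (\<lambda>x y. P (pr x y)) x y)"
  shows "ind2 step x y \<longleftrightarrow> step (ind2 step) x y"
proof -
  have "finitary (\<lambda>P. \<exists>x y. p = pr x y \<and> step (\<lambda>x y. P (pr x y)) x y)" for p
    by (intro finitary_intros finitary)
  from ind_fixpoint[of "\<lambda>P p. \<exists>x y. p = pr x y \<and> step (\<lambda>x y. P (pr x y)) x y", OF this, of "pr x y"]
  show ?thesis unfolding ind2_def[abs_def] by simp
qed


section \<open>Definable recursion\<close>

text \<open>The graph of \<open>k \<mapsto> G (k - 1) (\<dots> (G 0 b))\<close>, where \<open>k\<close> ranges over all of \<open>M\<close>.\<close>

definition iter_graph :: "'a \<Rightarrow> ('a \<Rightarrow> 'a \<Rightarrow> 'a) \<Rightarrow> 'a \<Rightarrow> 'a \<Rightarrow> bool" where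
  "iter_graph b G = ind2 (\<lambda>P k z. (k = \<zero> \<and> z = b) \<or> (\<exists>w r. P w r \<and> k = S w \<and> z = G w r))"

lemma iter_graph_iff:
  "iter_graph b G k z \<longleftrightarrow>
    (k = \<zero> \<and> z = b) \<or> (\<exists>w r. iter_graph b G w r \<and> k = S w \<and> z = G w r)"
  unfolding iter_graph_def by (rule ind2_fixpoint) (intro finitary_intros)

definition iter :: "'a \<Rightarrow> ('a \<Rightarrow> 'a \<Rightarrow> 'a) \<Rightarrow> 'a \<Rightarrow> 'a" where
  "iter b G k = (THE z. iter_graph b G k z)"

text \<open>Base, step and argument may depend on the environment. This uniformity is needed for primitive
  recursion with parameters.\<close>

lemma dfn_iter_graph:
  assumes G: "dfun (\<lambda>e. G (\<lambda>i. e (Suc (Suc i))) (e 0) (e 1))"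
    and "dfun b" "dfun k" "dfun z"
  shows "dfn (\<lambda>e. iter_graph (b e) (G e) (k e) (z e))"
proof -
  have G': "dfun (\<lambda>e. G (\<lambda>i. f i e) (g e) (h e))" if "\<And>i. dfun (f i)" "dfun g" "dfun h" for f g h
    using dfun_comp[OF G, of "\<lambda>i. case i of 0 \<Rightarrow> g | Suc 0 \<Rightarrow> h | Suc (Suc i) \<Rightarrow> f i"] that
    by (auto split: nat.split)
  have "dfn (\<lambda>e. iter_graph (e 0) (G (\<lambda>i. e (Suc (Suc (Suc i))))) (e 1) (e 2))"
    unfolding iter_graph_def ind2_def ind_def by (intro dfn_intros dfn_elemM G')
  moreover have "dfun (case i of 0 \<Rightarrow> b | Suc 0 \<Rightarrow> k | Suc (Suc 0) \<Rightarrow> z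
      | Suc (Suc (Suc i)) \<Rightarrow> (\<lambda>e. e i))" for i
    using assms(2-) dfun_var by (simp split: nat.split)
  ultimately have "dfn (\<lambda>e. (\<lambda>e. iter_graph (e 0) (G (\<lambda>i. e (Suc (Suc (Suc i))))) (e 1) (e 2))
      (\<lambda>i. (case i of 0 \<Rightarrow> b | Suc 0 \<Rightarrow> k | Suc (Suc 0) \<Rightarrow> z | Suc (Suc (Suc i)) \<Rightarrow> (\<lambda>e. e i)) e))"
    by (rule dfn_comp)
  then show ?thesis by (simp add: numeral_2_eq_2)
qed

lemma iter_graph_unique:
  assumes G: "dfun (\<lambda>e. G (e 0) (e 1))"
  shows "\<exists>z. iter_graph b G k z \<and> (\<forall>z'. iter_graph b G k z' \<longrightarrow> z' = z)"
proof (rule definable_induct[of "\<lambda>k. \<exists>z. iter_graph b G k z \<and> (\<forall>z'. iter_graph b G k z' \<longrightarrow> z' = z)"])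
  show "dfn (\<lambda>e. \<exists>z. iter_graph b G (e 0) z \<and> (\<forall>z'. iter_graph b G (e 0) z' \<longrightarrow> z' = z))"
    by (intro dfn_intros dfn_iter_graph G)
  show "\<exists>z. iter_graph b G \<zero> z \<and> (\<forall>z'. iter_graph b G \<zero> z' \<longrightarrow> z' = z)"
    by (simp add: iter_graph_iff[of _ _ "\<zero>"])
next
  fix k assume "\<exists>z. iter_graph b G k z \<and> (\<forall>z'. iter_graph b G k z' \<longrightarrow> z' = z)"
  then show "\<exists>z. iter_graph b G (S k) z \<and> (\<forall>z'. iter_graph b G (S k) z' \<longrightarrow> z' = z)"
    by (auto simp: iter_graph_iff[of _ _ "S k"])
qed

lemma iter_eq_iff:
  assumes G: "dfun (\<lambda>e. G (e 0) (e 1))"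
  shows "z = iter b G k \<longleftrightarrow> iter_graph b G k z"
proof -
  obtain y where y: "iter_graph b G k y" "\<And>z. iter_graph b G k z \<Longrightarrow> z = y"
    using iter_graph_unique[OF G] by blast
  have "iter b G k = y" unfolding iter_def using y by (rule the_equality)
  then show ?thesis using y by blast
qed

lemma iter_simps:
  assumes G: "dfun (\<lambda>e. G (e 0) (e 1))"
  shows "iter b G \<zero> = b" "iter b G (S k) = G k (iter b G k)"
proof -
  show "iter b G \<zero> = b"
    by (rule sym, subst iter_eq_iff[OF G], subst iter_graph_iff) simp
  have "iter_graph b G k (iter b G k)" by (simp flip: iter_eq_iff[OF G])
  then show "iter b G (S k) = G k (iter b G k)"
    by (intro sym[of "G k (iter b G k)"], subst iter_eq_iff[OF G], subst iter_graph_iff) auto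
qed

lemma dfun_iter:
  assumes G: "dfun (\<lambda>e. G (\<lambda>i. e (Suc (Suc i))) (e 0) (e 1))" and b: "dfun b" and k: "dfun k"
  shows "dfun (\<lambda>e. iter (b e) (G e) (k e))"
proof -
  have G': "dfun (\<lambda>e. G (\<lambda>i. f i e) (e 0) (e 1))" if f: "\<And>i. dfun (f i)" for f
  proof -
    have "dfun (case i of 0 \<Rightarrow> (\<lambda>e. e 0) | Suc 0 \<Rightarrow> (\<lambda>e. e 1) | Suc (Suc i) \<Rightarrow> f i)" for i
      using f dfun_var by (simp split: nat.split)
    from dfun_comp[OF G,
        of "\<lambda>i. case i of 0 \<Rightarrow> (\<lambda>e. e 0) | Suc 0 \<Rightarrow> (\<lambda>e. e 1) | Suc (Suc i) \<Rightarrow> f i", OF this]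
    show ?thesis by simp
  qed
  have G1: "dfun (\<lambda>e. G e' (e 0) (e 1))" for e' by (rule G') (rule dfun_const)
  have G2: "dfun (\<lambda>e. G (\<lambda>i. e (Suc (Suc (Suc i)))) (e 0) (e 1))" by (rule G') (rule dfun_var)
  show ?thesis
    unfolding dfun_def iter_eq_iff[OF G1]
    by (intro dfn_iter_graph[of "\<lambda>e. G (\<lambda>i. e (Suc i))"] G2 dfun_rename[OF b, of Suc]
        dfun_rename[OF k, of Suc] dfun_var)
qed

section \<open>Standard elements\<close>


primrec std :: "nat \<Rightarrow> 'a" where
  "std 0 = \<zero>"
| "std (Suc n) = S (std n)"

lemma std_inject [simp]: "std m = std n \<longleftrightarrow> m = n"
proof (induction m arbitrary: n)
  case 0
  show ?case by (cases n) simp_all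
next
  case (Suc m)
  then show ?case by (cases n) simp_all
qed

lemma std_eq_zero [simp]: "std n = \<zero> \<longleftrightarrow> n = 0" "\<zero> = std n \<longleftrightarrow> n = 0"
  using std_inject[of n 0] by (auto simp del: std_inject)

lemma std_add: "std m \<oplus> std n = std (m + n)"
  by (induction n) simp_all

lemma std_mul: "std m \<otimes> std n = std (m * n)"
  by (induction n) (simp_all add: std_add add.commute)

lemma pr_std: "pr (std m) (std n) = std (prod_encode (m, n))"
proof -
  have "2 * triangle (m + n) = (m + n) * Suc (m + n)" by (induction "m + n") (simp_all add: triangle_def)
  then have "prod_encode (m, n) + prod_encode (m, n) = (m + n) * Suc (m + n) + (m + m)"
    by (simp add: prod_encode_def)
  then show ?thesis
    by (subst eq_commute, subst pr_iff) (simp only: std_add std_mul flip: std.simps(2))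
qed

lemma lt_std: "x \<prec> std n \<Longrightarrow> \<exists>m < n. x = std m"
  by (induction n) (auto simp: le_less less_Suc_eq)

lemma teval_num [simp]: "teval M e (num k) = std k"
  by (induction k) simp_all


section \<open>Semantics of the arithmetized syntax\<close>

abbreviation mVar where "mVar i \<equiv> pr \<zero> i"
abbreviation mZero where "mZero \<equiv> pr (S \<zero>) \<zero>"
abbreviation mSucc where "mSucc s \<equiv> pr (std 2) s"
abbreviation mAdd where "mAdd s t \<equiv> pr (std 3) (pr s t)"
abbreviation mMul where "mMul s t \<equiv> pr (std 4) (pr s t)"
abbreviation mEq where "mEq s t \<equiv> pr (std 5) (pr s t)"
abbreviation mNeg where "mNeg p \<equiv> pr (std 6) p"
abbreviation mOr where "mOr p q \<equiv> pr (std 7) (pr p q)"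
abbreviation mEx where "mEx v p \<equiv> pr (std 8) (pr v p)"

definition termM :: "'a \<Rightarrow> bool" where
  "termM = ind (\<lambda>P x. (\<exists>i. x = mVar i) \<or> x = mZero \<or> (\<exists>s. P s \<and> x = mSucc s) \<or>
    (\<exists>s t. P s \<and> P t \<and> (x = mAdd s t \<or> x = mMul s t)))"

definition formM :: "'a \<Rightarrow> bool" where
  "formM = ind (\<lambda>P x. (\<exists>s t. termM s \<and> termM t \<and> x = mEq s t) \<or> (\<exists>p. P p \<and> x = mNeg p) \<or>
    (\<exists>p q. P p \<and> P q \<and> x = mOr p q) \<or> (\<exists>v p. (\<exists>i. v = mVar i) \<and> P p \<and> x = mEx v p))"

definition freeM :: "'a \<Rightarrow> 'a \<Rightarrow> bool" where
  "freeM v = ind (\<lambda>P x. ((\<exists>i. x = mVar i) \<and> x = v) \<or> (\<exists>p. P p \<and> (x = mSucc p \<or> x = mNeg p)) \<or>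
    (\<exists>p q. (P p \<or> P q) \<and> (x = mAdd p q \<or> x = mMul p q \<or> x = mEq p q \<or> x = mOr p q)) \<or>
    (\<exists>u p. P p \<and> u \<noteq> v \<and> x = mEx u p))"

definition substM :: "'a \<Rightarrow> 'a \<Rightarrow> 'a \<Rightarrow> 'a \<Rightarrow> bool" where
  "substM v t = ind2 (\<lambda>P x y. ((\<exists>i. v = mVar i) \<and> x = v \<and> y = t) \<or>
    ((\<exists>i. x = mVar i) \<and> x \<noteq> v \<and> y = x) \<or> (x = mZero \<and> y = x) \<or>
    (\<exists>p p'. P p p' \<and> ((x = mSucc p \<and> y = mSucc p') \<or> (x = mNeg p \<and> y = mNeg p'))) \<or>
    (\<exists>p q p' q'. P p p' \<and> P q q' \<and>
      ((x = mAdd p q \<and> y = mAdd p' q') \<or> (x = mMul p q \<and> y = mMul p' q') \<or>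
       (x = mEq p q \<and> y = mEq p' q') \<or> (x = mOr p q \<and> y = mOr p' q'))) \<or>
    (\<exists>u p. u \<noteq> v \<and> x = mEx u p \<and> (\<exists>p'. P p p' \<and> y = mEx u p')) \<or>
    (\<exists>p. x = mEx v p \<and> y = x))"

definition numM :: "'a \<Rightarrow> 'a \<Rightarrow> bool" where
  "numM = ind2 (\<lambda>P x y. (x = \<zero> \<and> y = mZero) \<or> (\<exists>w t. P w t \<and> x = S w \<and> y = mSucc t))"

definition valM :: "'a \<Rightarrow> 'a \<Rightarrow> bool" where
  "valM = ind2 (\<lambda>P s x. (s = mZero \<and> x = \<zero>) \<or> (\<exists>t y. P t y \<and> s = mSucc t \<and> x = S y) \<or>
    (\<exists>t u y z. P t y \<and> P u z \<and> ((s = mAdd t u \<and> x = y \<oplus> z) \<or> (s = mMul t u \<and> x = y \<otimes> z))))"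

definition sentM where "sentM x \<longleftrightarrow> formM x \<and> (\<nexists>v. freeM v x)"
definition closedM where "closedM x \<longleftrightarrow> termM x \<and> (\<nexists>v. freeM v x)"
definition form1M where
  "form1M v x \<longleftrightarrow> (\<exists>i. v = mVar i) \<and> formM x \<and> (\<forall>u. freeM u x \<longrightarrow> u = v)"

definition instM where
  "instM p v x z \<longleftrightarrow> (\<exists>m. numM x m \<and> substM v m p z)"

text \<open>The steps of the arithmetized inductive definitions are positive existential, hence finitary, and
  so these notions satisfy the expected recursion equations.\<close>

lemma termM_iff: "termM x \<longleftrightarrow> (\<exists>i. x = mVar i) \<or> x = mZero \<or> (\<exists>s. termM s \<and> x = mSucc s) \<or>
    (\<exists>s t. termM s \<and> termM t \<and> (x = mAdd s t \<or> x = mMul s t))"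
  unfolding termM_def by (rule ind_fixpoint) (intro finitary_intros)

lemma formM_iff: "formM x \<longleftrightarrow>
    (\<exists>s t. termM s \<and> termM t \<and> x = mEq s t) \<or> (\<exists>p. formM p \<and> x = mNeg p) \<or>
    (\<exists>p q. formM p \<and> formM q \<and> x = mOr p q) \<or> (\<exists>v p. (\<exists>i. v = mVar i) \<and> formM p \<and> x = mEx v p)"
  unfolding formM_def by (rule ind_fixpoint) (intro finitary_intros)

lemma freeM_iff: "freeM v x \<longleftrightarrow>
    ((\<exists>i. x = mVar i) \<and> x = v) \<or> (\<exists>p. freeM v p \<and> (x = mSucc p \<or> x = mNeg p)) \<or>
    (\<exists>p q. (freeM v p \<or> freeM v q) \<and> (x = mAdd p q \<or> x = mMul p q \<or> x = mEq p q \<or> x = mOr p q)) \<or>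
    (\<exists>u p. freeM v p \<and> u \<noteq> v \<and> x = mEx u p)"
  unfolding freeM_def by (rule ind_fixpoint) (intro finitary_intros)

lemma substM_iff: "substM v t x y \<longleftrightarrow> ((\<exists>i. v = mVar i) \<and> x = v \<and> y = t) \<or>
    ((\<exists>i. x = mVar i) \<and> x \<noteq> v \<and> y = x) \<or> (x = mZero \<and> y = x) \<or>
    (\<exists>p p'. substM v t p p' \<and> ((x = mSucc p \<and> y = mSucc p') \<or> (x = mNeg p \<and> y = mNeg p'))) \<or>
    (\<exists>p q p' q'. substM v t p p' \<and> substM v t q q' \<and>
      ((x = mAdd p q \<and> y = mAdd p' q') \<or> (x = mMul p q \<and> y = mMul p' q') \<or>
       (x = mEq p q \<and> y = mEq p' q') \<or> (x = mOr p q \<and> y = mOr p' q'))) \<or>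
    (\<exists>u p. u \<noteq> v \<and> x = mEx u p \<and> (\<exists>p'. substM v t p p' \<and> y = mEx u p')) \<or>
    (\<exists>p. x = mEx v p \<and> y = x)"
  unfolding substM_def by (rule ind2_fixpoint) (intro finitary_intros)

lemma numM_iff:
  "numM x y \<longleftrightarrow> (x = \<zero> \<and> y = mZero) \<or> (\<exists>w t. numM w t \<and> x = S w \<and> y = mSucc t)"
  unfolding numM_def by (rule ind2_fixpoint) (intro finitary_intros)

lemma valM_iff:
  "valM s x \<longleftrightarrow> (s = mZero \<and> x = \<zero>) \<or> (\<exists>t y. valM t y \<and> s = mSucc t \<and> x = S y) \<or>
    (\<exists>t u y z. valM t y \<and> valM u z \<and> ((s = mAdd t u \<and> x = y \<oplus> z) \<or> (s = mMul t u \<and> x = y \<otimes> z)))"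
  unfolding valM_def by (rule ind2_fixpoint) (intro finitary_intros)

lemmas dfn_ind = dfn_intros dfn_elemM

lemma dfn_termM: "dfun f \<Longrightarrow> dfn (\<lambda>e. termM (f e))"
  by (rule dfn_app1) (unfold termM_def ind_def, intro dfn_ind)

lemma dfn_formM: "dfun f \<Longrightarrow> dfn (\<lambda>e. formM (f e))"
  by (rule dfn_app1) (unfold formM_def ind_def, intro dfn_ind dfn_termM)

lemma dfn_freeM: "dfun f \<Longrightarrow> dfun g \<Longrightarrow> dfn (\<lambda>e. freeM (f e) (g e))"
  by (rule dfn_app2) (unfold freeM_def ind_def, intro dfn_ind)

lemma dfn_substM:
  "dfun f \<Longrightarrow> dfun g \<Longrightarrow> dfun h \<Longrightarrow> dfun k \<Longrightarrow> dfn (\<lambda>e. substM (f e) (g e) (h e) (k e))"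
  by (rule dfn_app4) (unfold substM_def ind2_def ind_def, intro dfn_ind)

lemma dfn_numM: "dfun f \<Longrightarrow> dfun g \<Longrightarrow> dfn (\<lambda>e. numM (f e) (g e))"
  by (rule dfn_app2) (unfold numM_def ind2_def ind_def, intro dfn_ind)

lemma dfn_valM: "dfun f \<Longrightarrow> dfun g \<Longrightarrow> dfn (\<lambda>e. valM (f e) (g e))"
  by (rule dfn_app2) (unfold valM_def ind2_def ind_def, intro dfn_ind)


section \<open>Evaluation of formula schemes\<close>

text \<open>A scheme applied to \<open>n\<close> binds the variables from \<open>n\<close> on. Its free terms must therefore use
  smaller indices, and then they keep their values under the binders.\<close>

definition vars_below :: "nat \<Rightarrow> trm \<Rightarrow> bool" where "vars_below n t \<longleftrightarrow> fvt t \<subseteq> {..<n}"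

lemma vars_below_simps [simp]:
  "vars_below n (Var i) \<longleftrightarrow> i < n" "vars_below n Zero" "vars_below n (Succ t) \<longleftrightarrow> vars_below n t"
  "vars_below n (Add s t) \<longleftrightarrow> vars_below n s \<and> vars_below n t" "vars_below n (Mul s t) \<longleftrightarrow> vars_below n s \<and> vars_below n t"
  "vars_below n t \<Longrightarrow> vars_below (Suc n) t"
  unfolding vars_below_def by auto

lemma teval_upd [simp]: "vars_below n t \<Longrightarrow> teval M (e(n := b)) t = teval M e t"
  by (rule teval_cong) (auto simp: vars_below_def)

lemma scheme_simps [simp]:
  "(s \<^bold>= t) n = Equ s t" "(\<^bold>\<not> A) n = Neg (A n)" "(A \<^bold>\<or> B) n = Or (A n) (B n)"
  "sEx F n = Exi n (F (Var n) (Suc n))"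
  by (simp_all add: sEq_def sNot_def sOr_def sEx_def)

lemma sat_less [simp]:
  "vars_below n x \<Longrightarrow> vars_below n y \<Longrightarrow> sat M e (less x y n) \<longleftrightarrow> teval M e x \<prec> teval M e y"
  by (simp add: less_def lt_def)

lemma sat_pair [simp]: "sat M e (pair x y z n) \<longleftrightarrow> teval M e z = pr (teval M e x) (teval M e y)"
  by (simp add: pair_def pr_iff)

lemma sat_tag1 [simp]: "sat M e (tag1 k x z n) \<longleftrightarrow> teval M e z = pr (std k) (teval M e x)"
  by (simp add: tag1_def)

lemma sat_tag2 [simp]: "vars_below n x \<Longrightarrow> vars_below n y \<Longrightarrow> vars_below n z \<Longrightarrow>
    sat M e (tag2 k x y z n) \<longleftrightarrow> teval M e z = pr (std k) (pr (teval M e x) (teval M e y))"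
  by (simp add: tag2_def)

lemmas code_defs = cVar_def cZero_def cSucc_def cAdd_def cMul_def cEq_def cNeg_def cOr_def cEx_def

lemma sat_elem [simp]: "vars_below n a \<Longrightarrow> vars_below n b \<Longrightarrow> vars_below n c \<Longrightarrow> vars_below n y \<Longrightarrow>
    sat M e (elem a b c y n) \<longleftrightarrow> elemM (teval M e a) (teval M e b) (teval M e c) (teval M e y)"
  by (simp add: elem_def elemM_def divides_def modulus_def del: S_mul mul_S)

lemma sat_Term [simp]: "vars_below n t \<Longrightarrow> sat M e (Term t n) \<longleftrightarrow> termM (teval M e t)"
  by (simp add: Term_def inductively_def termM_def ind_def code_defs)

lemma sat_Form [simp]: "vars_below n t \<Longrightarrow> sat M e (Form t n) \<longleftrightarrow> formM (teval M e t)"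
  by (simp add: Form_def inductively_def formM_def ind_def code_defs conj_ac disj_ac)

lemma sat_FreeIn [simp]:
  "vars_below n v \<Longrightarrow> vars_below n t \<Longrightarrow> sat M e (FreeIn v t n) \<longleftrightarrow> freeM (teval M e v) (teval M e t)"
  by (simp add: FreeIn_def inductively_def freeM_def ind_def code_defs)

lemma sat_ClTerm [simp]: "vars_below n t \<Longrightarrow> sat M e (ClTerm t n) \<longleftrightarrow> closedM (teval M e t)"
  by (simp add: ClTerm_def closedM_def)

lemma sat_Sent [simp]: "vars_below n t \<Longrightarrow> sat M e (Sent t n) \<longleftrightarrow> sentM (teval M e t)"
  by (simp add: Sent_def sentM_def)

lemma sat_Form1 [simp]:
  "vars_below n v \<Longrightarrow> vars_below n t \<Longrightarrow> sat M e (Form1 v t n) \<longleftrightarrow> form1M (teval M e v) (teval M e t)"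
  by (auto simp: Form1_def form1M_def code_defs)

lemma sat_Subst [simp]:
  "vars_below n v \<Longrightarrow> vars_below n t \<Longrightarrow> vars_below n x \<Longrightarrow> vars_below n y \<Longrightarrow>
    sat M e (Subst v t x y n) \<longleftrightarrow> substM (teval M e v) (teval M e t) (teval M e x) (teval M e y)"
  by (simp add: Subst_def inductively2_def holds2_def inductively_def substM_def ind2_def ind_def
      code_defs conj_ac disj_ac)

lemma sat_Numeral [simp]:
  "vars_below n x \<Longrightarrow> vars_below n y \<Longrightarrow> sat M e (Numeral x y n) \<longleftrightarrow> numM (teval M e x) (teval M e y)"
  by (simp add: Numeral_def inductively2_def holds2_def inductively_def numM_def ind2_def ind_def
      code_defs conj_ac disj_ac)

lemma sat_Val [simp]:
  "vars_below n x \<Longrightarrow> vars_below n y \<Longrightarrow> sat M e (Val x y n) \<longleftrightarrow> valM (teval M e x) (teval M e y)"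
  by (simp add: Val_def inductively2_def holds2_def inductively_def valM_def ind2_def ind_def
      code_defs conj_ac disj_ac)

lemma sat_SameVal [simp]: "vars_below n s \<Longrightarrow> vars_below n t \<Longrightarrow>
    sat M e (SameVal s t n) \<longleftrightarrow> (\<exists>x. valM (teval M e s) x \<and> valM (teval M e t) x)"
  by (simp add: SameVal_def)

lemma sat_Inst [simp]: "vars_below n p \<Longrightarrow> vars_below n v \<Longrightarrow> vars_below n x \<Longrightarrow> vars_below n z \<Longrightarrow>
    sat M e (Inst p v x z n) \<longleftrightarrow> instM (teval M e p) (teval M e v) (teval M e x) (teval M e z)"
  by (simp add: Inst_def instM_def)


section \<open>Terms and formulae in the sense of the model\<close>

lemma std_eq_one [simp]: "S \<zero> = std n \<longleftrightarrow> n = 1" "std n = S \<zero> \<longleftrightarrow> n = 1"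
  using std_inject[of "Suc 0" n] by (auto simp del: std_inject)

lemma tag_lt: "k \<noteq> 0 \<Longrightarrow> x \<preceq> y \<Longrightarrow> x \<prec> pr (std k) y"
  by (rule le_less_trans[OF _ lt_pr]) simp_all

lemma termM_simps [simp]:
  "termM (mVar i)" "termM mZero" "termM (mSucc s) \<longleftrightarrow> termM s"
  "termM (mAdd s t) \<longleftrightarrow> termM s \<and> termM t" "termM (mMul s t) \<longleftrightarrow> termM s \<and> termM t"
  by (subst termM_iff, simp)+

lemma formM_simps [simp]:
  "formM (mEq s t) \<longleftrightarrow> termM s \<and> termM t" "formM (mNeg p) \<longleftrightarrow> formM p"
  "formM (mOr p q) \<longleftrightarrow> formM p \<and> formM q" "formM (mEx (mVar i) p) \<longleftrightarrow> formM p"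
  by (subst formM_iff, simp)+

lemma freeM_simps [simp]:
  "freeM v (mVar i) \<longleftrightarrow> v = mVar i" "\<not> freeM v mZero" "freeM v (mSucc s) \<longleftrightarrow> freeM v s"
  "freeM v (mAdd s t) \<longleftrightarrow> freeM v s \<or> freeM v t" "freeM v (mMul s t) \<longleftrightarrow> freeM v s \<or> freeM v t"
  "freeM v (mEq s t) \<longleftrightarrow> freeM v s \<or> freeM v t" "freeM v (mNeg p) \<longleftrightarrow> freeM v p"
  "freeM v (mOr p q) \<longleftrightarrow> freeM v p \<or> freeM v q" "freeM v (mEx u p) \<longleftrightarrow> freeM v p \<and> u \<noteq> v"
  by (subst freeM_iff, force)+

lemma substM_simps [simp]:
  "substM v t (mVar i) y \<longleftrightarrow> y = (if mVar i = v then t else mVar i)"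
  "substM v t mZero y \<longleftrightarrow> y = mZero"
  "substM v t (mSucc s) y \<longleftrightarrow> (\<exists>s'. substM v t s s' \<and> y = mSucc s')"
  "substM v t (mAdd s r) y \<longleftrightarrow> (\<exists>s' r'. substM v t s s' \<and> substM v t r r' \<and> y = mAdd s' r')"
  "substM v t (mMul s r) y \<longleftrightarrow> (\<exists>s' r'. substM v t s s' \<and> substM v t r r' \<and> y = mMul s' r')"
  "substM v t (mEq s r) y \<longleftrightarrow> (\<exists>s' r'. substM v t s s' \<and> substM v t r r' \<and> y = mEq s' r')"
  "substM v t (mNeg p) y \<longleftrightarrow> (\<exists>p'. substM v t p p' \<and> y = mNeg p')"
  "substM v t (mOr p q) y \<longleftrightarrow> (\<exists>p' q'. substM v t p p' \<and> substM v t q q' \<and> y = mOr p' q')"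
  "substM v t (mEx u p) y \<longleftrightarrow>
    (if u = v then y = mEx u p else \<exists>p'. substM v t p p' \<and> y = mEx u p')"
  by (subst substM_iff, force)+

text \<open>Structural induction over all terms in the sense of \<open>M\<close>, including those of nonstandard size, for
  definable properties. It is course-of-values induction along the codes.\<close>

lemma termM_induct [consumes 1]:
  assumes "termM x" and P: "dfn (\<lambda>e. P (e 0))"
    and "\<And>i. P (mVar i)" "P mZero" "\<And>s. termM s \<Longrightarrow> P s \<Longrightarrow> P (mSucc s)"
    and "\<And>s t. termM s \<Longrightarrow> termM t \<Longrightarrow> P s \<Longrightarrow> P t \<Longrightarrow> P (mAdd s t)"
    and "\<And>s t. termM s \<Longrightarrow> termM t \<Longrightarrow> P s \<Longrightarrow> P t \<Longrightarrow> P (mMul s t)"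
  shows "P x"
proof -
  have "termM x \<longrightarrow> P x"
  proof (rule definable_less_induct[of "\<lambda>x. termM x \<longrightarrow> P x"])
    show "dfn (\<lambda>e. termM (e 0) \<longrightarrow> P (e 0))" by (intro dfn_intros dfn_termM P)
  next
    fix x assume IH: "\<And>y. y \<prec> x \<Longrightarrow> termM y \<longrightarrow> P y"
    show "termM x \<longrightarrow> P x"
    proof
      assume "termM x"
      then consider i where "x = mVar i" | "x = mZero" | s where "termM s" "x = mSucc s"
        | s t where "termM s" "termM t" "x = mAdd s t" | s t where "termM s" "termM t" "x = mMul s t"
        by (subst (asm) termM_iff) (elim disjE exE conjE; metis)
      then show "P x"
      proof cases
        case (3 s)
        then have "P s" using IH[of s] tag_lt[of 2 s s] by simp
        with 3 assms(5) show ?thesis by simp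
      next
        case (4 s t)
        then have "P s" "P t"
          using IH[of s] IH[of t] tag_lt[of 3 _ "pr s t"] by (simp_all add: le_pr)
        with 4 assms(6) show ?thesis by simp
      next
        case (5 s t)
        then have "P s" "P t"
          using IH[of s] IH[of t] tag_lt[of 4 _ "pr s t"] by (simp_all add: le_pr)
        with 5 assms(7) show ?thesis by simp
      qed (use assms(3,4) in simp_all)
    qed
  qed
  with assms(1) show ?thesis by blast
qed

lemma formM_induct [consumes 1]:
  assumes "formM x" and P: "dfn (\<lambda>e. P (e 0))"
    and "\<And>s t. termM s \<Longrightarrow> termM t \<Longrightarrow> P (mEq s t)" "\<And>p. formM p \<Longrightarrow> P p \<Longrightarrow> P (mNeg p)"
    and "\<And>p q. formM p \<Longrightarrow> formM q \<Longrightarrow> P p \<Longrightarrow> P q \<Longrightarrow> P (mOr p q)"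
    and "\<And>i p. formM p \<Longrightarrow> P p \<Longrightarrow> P (mEx (mVar i) p)"
  shows "P x"
proof -
  have "formM x \<longrightarrow> P x"
  proof (rule definable_less_induct[of "\<lambda>x. formM x \<longrightarrow> P x"])
    show "dfn (\<lambda>e. formM (e 0) \<longrightarrow> P (e 0))" by (intro dfn_intros dfn_formM P)
  next
    fix x assume IH: "\<And>y. y \<prec> x \<Longrightarrow> formM y \<longrightarrow> P y"
    show "formM x \<longrightarrow> P x"
    proof
      assume "formM x"
      then consider s t where "termM s" "termM t" "x = mEq s t" | p where "formM p" "x = mNeg p"
        | p q where "formM p" "formM q" "x = mOr p q" | i p where "formM p" "x = mEx (mVar i) p"
        by (subst (asm) formM_iff) (elim disjE exE conjE; metis)
      then show "P x"
      proof cases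
        case (1 s t)
        with assms(3) show ?thesis by simp
      next
        case (2 p)
        then have "P p" using IH[of p] tag_lt[of 6 p p] by simp
        with 2 assms(4) show ?thesis by simp
      next
        case (3 p q)
        then have "P p" "P q"
          using IH[of p] IH[of q] tag_lt[of 7 _ "pr p q"] by (simp_all add: le_pr)
        with 3 assms(5) show ?thesis by simp
      next
        case (4 i p)
        then have "P p"
          using IH[of p] tag_lt[of 8 _ "pr (mVar i) p"] by (simp add: le_pr)
        with 4 assms(6) show ?thesis by simp
      qed
    qed
  qed
  with assms(1) show ?thesis by blast
qed


section \<open>Numerals of the model\<close>

lemma numM_simps [simp]:
  "numM \<zero> y \<longleftrightarrow> y = mZero" "numM (S x) y \<longleftrightarrow> (\<exists>t. numM x t \<and> y = mSucc t)"
  by (subst numM_iff, simp)+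

definition mnum :: "'a \<Rightarrow> 'a" where "mnum x = (THE y. numM x y)"

lemma numM_eq: "numM x y \<longleftrightarrow> y = mnum x"
proof -
  have "\<exists>y. numM x y \<and> (\<forall>z. numM x z \<longrightarrow> z = y)"
    by (rule definable_induct[of "\<lambda>x. \<exists>y. numM x y \<and> (\<forall>z. numM x z \<longrightarrow> z = y)"])
      (intro dfn_intros dfn_numM, auto)
  then obtain z where z: "numM x z" "\<And>y. numM x y \<Longrightarrow> y = z" by blast
  then have "mnum x = z" unfolding mnum_def by (rule the_equality)
  with z show ?thesis by blast
qed

lemma mnum_simps [simp]: "mnum \<zero> = mZero" "mnum (S x) = mSucc (mnum x)"
  using numM_simps[of "mnum \<zero>"] numM_simps(2)[of x "mnum (S x)"] by (auto simp: numM_eq)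

lemma dfun_mnum: "dfun f \<Longrightarrow> dfun (\<lambda>e. mnum (f e))"
  by (rule dfun_app1) (unfold dfun_def numM_eq[symmetric], intro dfn_numM dfn_intros)

lemma closedM_mnum: "closedM (mnum x)"
  unfolding closedM_def
  by (rule definable_induct[of "\<lambda>x. termM (mnum x) \<and> (\<nexists>v. freeM v (mnum x))"])
    (intro dfn_intros dfn_termM dfn_freeM dfun_mnum, simp_all)

lemma termM_mnum [simp]: "termM (mnum x)" and freeM_mnum [simp]: "\<not> freeM v (mnum x)"
  using closedM_mnum[of x] by (auto simp: closedM_def)

lemma valM_simps [simp]:
  "valM mZero x \<longleftrightarrow> x = \<zero>" "valM (mSucc t) x \<longleftrightarrow> (\<exists>y. valM t y \<and> x = S y)"
  "valM (mAdd t u) x \<longleftrightarrow> (\<exists>y z. valM t y \<and> valM u z \<and> x = y \<oplus> z)"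
  "valM (mMul t u) x \<longleftrightarrow> (\<exists>y z. valM t y \<and> valM u z \<and> x = y \<otimes> z)"
  by (subst valM_iff, force)+

lemma valM_mnum: "valM (mnum x) y \<longleftrightarrow> y = x"
proof -
  have "\<forall>y. valM (mnum x) y \<longleftrightarrow> y = x"
    by (rule definable_induct[of "\<lambda>x. \<forall>y. valM (mnum x) y \<longleftrightarrow> y = x"])
      (intro dfn_intros dfn_valM dfun_mnum, simp_all)
  then show ?thesis by blast
qed


section \<open>Substitution of numerals\<close>

text \<open>The two facts about substitution that are proved simultaneously: \<open>y\<close> is the only result, and
  exactly the variable \<open>v\<close> disappears.\<close>

definition substs_to :: "'a \<Rightarrow> 'a \<Rightarrow> 'a \<Rightarrow> 'a \<Rightarrow> bool" where
  "substs_to v t x y \<longleftrightarrow>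
    (\<forall>z. substM v t x z \<longleftrightarrow> z = y) \<and> (\<forall>u. freeM u y \<longleftrightarrow> freeM u x \<and> u \<noteq> v)"

lemma dfn_substs_to:
  "dfun f \<Longrightarrow> dfun g \<Longrightarrow> dfun h \<Longrightarrow> dfun k \<Longrightarrow> dfn (\<lambda>e. substs_to (f e) (g e) (h e) (k e))"
  by (rule dfn_app4) (unfold substs_to_def, intro dfn_intros dfn_freeM dfn_substM)

text \<open>Closedness of \<open>t\<close> enters at the variable \<open>v\<close> only. Without it, free variables of \<open>t\<close> would show up in
  the result.\<close>

lemma substs_to_intros:
  "closedM t \<Longrightarrow> substs_to v t (mVar i) (if mVar i = v then t else mVar i)"
  "substs_to v t mZero mZero"
  "substs_to v t r r' \<Longrightarrow> substs_to v t (mSucc r) (mSucc r')"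
  "substs_to v t r r' \<Longrightarrow> substs_to v t s s' \<Longrightarrow> substs_to v t (mAdd r s) (mAdd r' s')"
  "substs_to v t r r' \<Longrightarrow> substs_to v t s s' \<Longrightarrow> substs_to v t (mMul r s) (mMul r' s')"
  "substs_to v t r r' \<Longrightarrow> substs_to v t s s' \<Longrightarrow> substs_to v t (mEq r s) (mEq r' s')"
  "substs_to v t r r' \<Longrightarrow> substs_to v t (mNeg r) (mNeg r')"
  "substs_to v t r r' \<Longrightarrow> substs_to v t s s' \<Longrightarrow> substs_to v t (mOr r s) (mOr r' s')"
  "substs_to v t r r' \<Longrightarrow> substs_to v t (mEx u r) (mEx u (if u = v then r else r'))"
  unfolding substs_to_def closedM_def by auto

lemma substs_to_term_ex:
  assumes "termM x" "closedM t"
  shows "\<exists>y. substs_to v t x y \<and> termM y"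
proof -
  have t: "termM (if b then t else mVar i)" for b i using assms(2) by (simp add: closedM_def)
  show ?thesis
  proof (rule termM_induct[OF assms(1), of "\<lambda>x. \<exists>y. substs_to v t x y \<and> termM y"])
    show "dfn (\<lambda>e. \<exists>y. substs_to v t (e 0) y \<and> termM y)"
      by (intro dfn_intros dfn_termM dfn_substs_to)
  qed (metis substs_to_intros termM_simps t assms(2))+
qed

lemma substs_to_form_ex:
  assumes "formM x" "closedM t"
  shows "\<exists>y. substs_to v t x y \<and> formM y"
proof -
  have f: "formM (mEx (mVar i) (if b then p else q))" if "formM p" "formM q" for i b p q
    using that by simp
  show ?thesis
  proof (rule formM_induct[OF assms(1), of "\<lambda>x. \<exists>y. substs_to v t x y \<and> formM y"])
    show "dfn (\<lambda>e. \<exists>y. substs_to v t (e 0) y \<and> formM y)"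
      by (intro dfn_intros dfn_formM dfn_substs_to)
  next
    fix r s assume "termM r" "termM s"
    then show "\<exists>y. substs_to v t (mEq r s) y \<and> formM y"
      using substs_to_term_ex[OF _ assms(2)] substs_to_intros(6) formM_simps(1) by metis
  qed (metis substs_to_intros(7-9) formM_simps f)+
qed

definition msub :: "'a \<Rightarrow> 'a \<Rightarrow> 'a \<Rightarrow> 'a" where
  "msub v a x = (THE y. substM v (mnum a) x y)"

lemma msub_eqI:
  assumes "\<And>z. substM v (mnum a) x z \<longleftrightarrow> z = y" shows "msub v a x = y"
  unfolding msub_def using assms by (intro the_equality) simp_all

lemma msub_term:
  assumes "termM x"
  shows substM_msub_term: "substM v (mnum a) x z \<longleftrightarrow> z = msub v a x"
    and termM_msub: "termM (msub v a x)"
    and freeM_msub_term: "freeM u (msub v a x) \<longleftrightarrow> freeM u x \<and> u \<noteq> v"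
proof -
  obtain y where "substs_to v (mnum a) x y" "termM y"
    using substs_to_term_ex[OF assms closedM_mnum] by blast
  then have y: "\<And>z. substM v (mnum a) x z \<longleftrightarrow> z = y" "termM y"
    "\<And>u. freeM u y \<longleftrightarrow> freeM u x \<and> u \<noteq> v" by (simp_all add: substs_to_def)
  have "msub v a x = y" using y(1) by (rule msub_eqI)
  with y show "substM v (mnum a) x z \<longleftrightarrow> z = msub v a x" "termM (msub v a x)"
    "freeM u (msub v a x) \<longleftrightarrow> freeM u x \<and> u \<noteq> v" by simp_all
qed

lemma msub_form:
  assumes "formM x"
  shows substM_msub_form: "substM v (mnum a) x z \<longleftrightarrow> z = msub v a x"
    and formM_msub: "formM (msub v a x)"
    and freeM_msub_form: "freeM u (msub v a x) \<longleftrightarrow> freeM u x \<and> u \<noteq> v"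
proof -
  obtain y where "substs_to v (mnum a) x y" "formM y"
    using substs_to_form_ex[OF assms closedM_mnum] by blast
  then have y: "\<And>z. substM v (mnum a) x z \<longleftrightarrow> z = y" "formM y"
    "\<And>u. freeM u y \<longleftrightarrow> freeM u x \<and> u \<noteq> v" by (simp_all add: substs_to_def)
  have "msub v a x = y" using y(1) by (rule msub_eqI)
  with y show "substM v (mnum a) x z \<longleftrightarrow> z = msub v a x" "formM (msub v a x)"
    "freeM u (msub v a x) \<longleftrightarrow> freeM u x \<and> u \<noteq> v" by simp_all
qed

lemma msub_simps [simp]:
  "msub v a (mVar i) = (if mVar i = v then mnum a else mVar i)"
  "msub v a mZero = mZero"
  "termM s \<Longrightarrow> msub v a (mSucc s) = mSucc (msub v a s)"
  "termM s \<Longrightarrow> termM t \<Longrightarrow> msub v a (mAdd s t) = mAdd (msub v a s) (msub v a t)"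
  "termM s \<Longrightarrow> termM t \<Longrightarrow> msub v a (mMul s t) = mMul (msub v a s) (msub v a t)"
  "termM s \<Longrightarrow> termM t \<Longrightarrow> msub v a (mEq s t) = mEq (msub v a s) (msub v a t)"
  "formM p \<Longrightarrow> msub v a (mNeg p) = mNeg (msub v a p)"
  "formM p \<Longrightarrow> formM q \<Longrightarrow> msub v a (mOr p q) = mOr (msub v a p) (msub v a q)"
  "formM p \<Longrightarrow> msub v a (mEx u p) = mEx u (if u = v then p else msub v a p)"
  by (rule msub_eqI, simp add: substM_msub_term substM_msub_form)+

lemma msub_mnum [simp]: "msub v b (mnum a) = mnum a"
proof -
  have "substM v (mnum b) (mnum a) (mnum a)"
    by (rule definable_induct[of "\<lambda>a. substM v (mnum b) (mnum a) (mnum a)"])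
      (intro dfn_intros dfn_substM dfun_mnum, simp_all)
  then show ?thesis by (simp add: substM_msub_term)
qed

abbreviation vr :: "nat \<Rightarrow> 'a" where "vr i \<equiv> mVar (std i)"

text \<open>Successive substitution of numerals for standard variables. The first pair for a variable takes
  effect, as in \<open>map_of\<close>.\<close>

primrec msubst :: "(nat \<times> 'a) list \<Rightarrow> 'a \<Rightarrow> 'a" where
  "msubst [] x = x"
| "msubst (b # l) x = msubst l (msub (vr (fst b)) (snd b) x)"

lemma msubst_append: "msubst (l @ l') x = msubst l' (msubst l x)"
  by (induction l arbitrary: x) simp_all

lemma msubst_mnum [simp]: "msubst l (mnum a) = mnum a" by (induction l) simp_all

lemma msubst_var: "msubst l (vr i) = (case map_of l i of None \<Rightarrow> vr i | Some a \<Rightarrow> mnum a)"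
  by (induction l) (auto)

lemma msubst_zero [simp]: "msubst l mZero = mZero" by (induction l) (simp_all)

lemma msubst_term [simp]:
  "termM s \<Longrightarrow> termM (msubst l s)"
  "termM s \<Longrightarrow> msubst l (mSucc s) = mSucc (msubst l s)"
  "termM s \<Longrightarrow> termM t \<Longrightarrow> msubst l (mAdd s t) = mAdd (msubst l s) (msubst l t)"
  "termM s \<Longrightarrow> termM t \<Longrightarrow> msubst l (mMul s t) = mMul (msubst l s) (msubst l t)"
  "termM s \<Longrightarrow> termM t \<Longrightarrow> msubst l (mEq s t) = mEq (msubst l s) (msubst l t)"
  by (induction l arbitrary: s t) (simp_all add: termM_msub)

lemma msubst_form [simp]:
  "formM p \<Longrightarrow> formM (msubst l p)"
  "formM p \<Longrightarrow> msubst l (mNeg p) = mNeg (msubst l p)"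
  "formM p \<Longrightarrow> formM q \<Longrightarrow> msubst l (mOr p q) = mOr (msubst l p) (msubst l q)"
  by (induction l arbitrary: p q) (simp_all add: formM_msub)

lemma msubst_ex [simp]:
  "formM p \<Longrightarrow> msubst l (mEx (vr i) p) = mEx (vr i) (msubst (filter (\<lambda>b. fst b \<noteq> i) l) p)"
  by (induction l arbitrary: p) (auto simp: formM_msub)

lemma freeM_msubst_term:
  "termM s \<Longrightarrow> freeM u (msubst l s) \<longleftrightarrow> freeM u s \<and> u \<notin> vr ` fst ` set l"
  by (induction l arbitrary: s) (auto simp: termM_msub freeM_msub_term)

lemma freeM_msubst_form:
  "formM p \<Longrightarrow> freeM u (msubst l p) \<longleftrightarrow> freeM u p \<and> u \<notin> vr ` fst ` set l"
  by (induction l arbitrary: p) (auto simp: formM_msub freeM_msub_form)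


section \<open>Codes of standard expressions\<close>

text \<open>Standard codes are the standard elements with the corresponding tags, so that the recursion
  equations of the model apply to them.\<close>

lemma std_tcode [simp]:
  "std (tcode (Var i)) = vr i" "std (tcode Zero) = mZero"
  "std (tcode (Succ t)) = mSucc (std (tcode t))"
  "std (tcode (Add s t)) = mAdd (std (tcode s)) (std (tcode t))"
  "std (tcode (Mul s t)) = mMul (std (tcode s)) (std (tcode t))"
  using pr_std[of 0] pr_std[of 1 0] by (simp_all add: pr_std)

lemma std_fcode [simp]:
  "std (fcode (Equ s t)) = mEq (std (tcode s)) (std (tcode t))"
  "std (fcode (Neg p)) = mNeg (std (fcode p))"
  "std (fcode (Or p q)) = mOr (std (fcode p)) (std (fcode q))"
  "std (fcode (Exi i p)) = mEx (vr i) (std (fcode p))"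
  using pr_std[of 0] by (simp_all add: pr_std)

declare tcode.simps [simp del] fcode.simps [simp del]

lemma termM_std [simp]: "termM (std (tcode t))"
  by (induction t) simp_all

lemma formM_std [simp]: "formM (std (fcode p))"
  by (induction p) simp_all

lemma freeM_std_term: "freeM u (std (tcode t)) \<longleftrightarrow> u \<in> vr ` fvt t"
  by (induction t) auto

lemma freeM_std_form: "freeM u (std (fcode p)) \<longleftrightarrow> u \<in> vr ` fv p"
  by (induction p) (auto simp: freeM_std_term)

lemma mnum_std: "mnum (std n) = std (tcode (num n))"
  by (induction n) simp_all

definition env :: "(nat \<times> 'a) list \<Rightarrow> nat \<Rightarrow> 'a" where
  "env l i = (case map_of l i of None \<Rightarrow> \<zero> | Some a \<Rightarrow> a)"

lemma closedM_msubst: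
  assumes "fvt t \<subseteq> fst ` set l"
  shows "closedM (msubst l (std (tcode t)))"
  unfolding closedM_def using assms by (auto simp: freeM_msubst_term freeM_std_term)

text \<open>The value is obtained by induction on the standard term. The numerals in it may be
  nonstandard.\<close>

lemma valM_msubst:
  "fvt t \<subseteq> fst ` set l \<Longrightarrow> valM (msubst l (std (tcode t))) x \<longleftrightarrow> x = teval M (env l) t"
proof (induction t arbitrary: x)
  case (Var i)
  then obtain a where "map_of l i = Some a"
    by (metis fvt.simps(1) insert_subset map_of_eq_None_iff not_None_eq)
  then show ?case by (simp add: msubst_var valM_mnum env_def)
qed auto

end

lemma tcode_inject: "tcode s = tcode t \<longleftrightarrow> s = t"
proof (induction s arbitrary: t)
  case (Var i) then show ?case by (cases t) simp_all
next
  case Zero then show ?case by (cases t) simp_all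
next
  case (Succ s) then show ?case by (cases t) simp_all
next
  case (Add s s') then show ?case by (cases t) simp_all
next
  case (Mul s s') then show ?case by (cases t) simp_all
qed

text \<open>This lets a condition of the type be recovered from its code, and it leaves only finitely many
  conditions with codes up to a given bound.\<close>

lemma fcode_inject: "fcode p = fcode q \<longleftrightarrow> p = q"
proof (induction p arbitrary: q)
  case (Equ s t) then show ?case by (cases q) (simp_all add: tcode_inject)
next
  case (Neg p) then show ?case by (cases q) simp_all
next
  case (Or p p') then show ?case by (cases q) simp_all
next
  case (Exi i p) then show ?case by (cases q) simp_all
qed

section \<open>Recursive functions\<close>

context pa_model
begin

text \<open>Definability of a function on lists of length \<open>n\<close>, stated for all definable arguments at once so
  that composition is immediate.\<close>

definition dfun_list :: "nat \<Rightarrow> ('a list \<Rightarrow> 'a) \<Rightarrow> bool" where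
  "dfun_list n F \<longleftrightarrow>
    (\<forall>gs. length gs = n \<and> (\<forall>g\<in>set gs. dfun g) \<longrightarrow> dfun (\<lambda>e. F (map (\<lambda>g. g e) gs)))"

lemma dfun_listD: "dfun_list n F \<Longrightarrow> length gs = n \<Longrightarrow> (\<And>g. g \<in> set gs \<Longrightarrow> dfun g) \<Longrightarrow>
    dfun (\<lambda>e. F (map (\<lambda>g. g e) gs))"
  unfolding dfun_list_def by blast

lemma dfun_listD_append:
  assumes "dfun_list n F" "length fs + length gs = n" "\<And>f. f \<in> set fs \<Longrightarrow> dfun f"
    "set gs \<subseteq> Collect dfun"
  shows "dfun (\<lambda>e. F (map (\<lambda>f. f e) (fs @ gs)))"
proof (rule dfun_listD[OF assms(1)])
  fix f assume "f \<in> set (fs @ gs)"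
  then show "dfun f" using assms(3,4) by (metis Un_iff mem_Collect_eq set_append subsetD)
qed (simp add: assms(2))

lemma dfun_listD_rename:
  assumes "dfun_list n F" "length fs + length gs = n" "\<And>f. f \<in> set fs \<Longrightarrow> dfun f"
    "\<And>g. g \<in> set gs \<Longrightarrow> dfun g"
  shows "dfun (\<lambda>e. F (map (\<lambda>f. f e) fs @ map (\<lambda>g. g (\<lambda>i. e (\<rho> i))) gs))"
proof -
  have "set (map (\<lambda>g e. g (\<lambda>i. e (\<rho> i))) gs) \<subseteq> Collect dfun"
    unfolding set_map by (rule image_subsetI, rule CollectI, rule dfun_rename, rule assms(4))
  then have "dfun (\<lambda>e. F (map (\<lambda>f. f e) (fs @ map (\<lambda>g e. g (\<lambda>i. e (\<rho> i))) gs)))"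
    using assms(2) by (intro dfun_listD_append[OF assms(1) _ assms(3)]) simp_all
  then show ?thesis by (simp add: comp_def)
qed

lemma dfun_listD_const:
  assumes "dfun_list n F" "length fs + length ys = n" "\<And>f. f \<in> set fs \<Longrightarrow> dfun f"
  shows "dfun (\<lambda>e. F (map (\<lambda>f. f e) fs @ ys))"
proof -
  have "set (map (\<lambda>y e. y) ys) \<subseteq> Collect dfun"
    unfolding set_map by (intro image_subsetI CollectI dfun_const)
  then have "dfun (\<lambda>e. F (map (\<lambda>f. f e) (fs @ map (\<lambda>y e. y) ys)))"
    using assms(2) by (intro dfun_listD_append[OF assms(1) _ assms(3)]) simp_all
  then show ?thesis by (simp add: comp_def)
qed

lemma dfun_list_comp:
  assumes F: "dfun_list (length hs) F" and H: "\<And>h. h \<in> set hs \<Longrightarrow> dfun_list n (H h)"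
  shows "dfun_list n (\<lambda>xs. F (map (\<lambda>h. H h xs) hs))"
  unfolding dfun_list_def
proof (intro allI impI)
  fix gs :: "((nat \<Rightarrow> 'a) \<Rightarrow> 'a) list"
  assume gs: "length gs = n \<and> (\<forall>g\<in>set gs. dfun g)"
  then have "set (map (\<lambda>h e. H h (map (\<lambda>g. g e) gs)) hs) \<subseteq> Collect dfun"
    unfolding set_map by (intro image_subsetI CollectI) (rule dfun_listD[OF H], auto)
  then have "dfun (\<lambda>e. F (map (\<lambda>g. g e) (map (\<lambda>h e. H h (map (\<lambda>g. g e) gs)) hs)))"
    by (intro dfun_listD[OF F]) auto
  then show "dfun (\<lambda>e. F (map (\<lambda>h. H h (map (\<lambda>g. g e) gs)) hs))" by (simp add: comp_def)
qed

lemma dfun_list_iter: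
  assumes B: "dfun_list n B" and G: "dfun_list (Suc (Suc n)) G"
  shows "dfun_list (Suc n) (\<lambda>xs. iter (B (tl xs)) (\<lambda>w r. G (w # r # tl xs)) (hd xs))"
  unfolding dfun_list_def
proof (intro allI impI)
  fix gs :: "((nat \<Rightarrow> 'a) \<Rightarrow> 'a) list"
  assume gs: "length gs = Suc n \<and> (\<forall>g\<in>set gs. dfun g)"
  then obtain k hs where hs: "gs = k # hs" "length hs = n" "dfun k" "\<And>h. h \<in> set hs \<Longrightarrow> dfun h"
    by (cases gs) auto
  have "dfun (\<lambda>e. G (map (\<lambda>f. f e) [\<lambda>e. e 0, \<lambda>e. e 1] @ map (\<lambda>h. h (\<lambda>i. e (Suc (Suc i)))) hs))"
    by (rule dfun_listD_rename[OF G]) (use hs(2,4) dfun_var in auto)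
  then have "dfun (\<lambda>e. G (e 0 # e 1 # map (\<lambda>h. h (\<lambda>i. e (Suc (Suc i)))) hs))" by simp
  then have "dfun (\<lambda>e. iter (B (map (\<lambda>h. h e) hs)) (\<lambda>w r. G (w # r # map (\<lambda>h. h e) hs)) (k e))"
    by (rule dfun_iter[of "\<lambda>e w r. G (w # r # map (\<lambda>h. h e) hs)"])
      (rule dfun_listD[OF B hs(2)], erule hs(4), rule hs(3))
  then show "dfun (\<lambda>e. iter (B (tl (map (\<lambda>g. g e) gs))) (\<lambda>w r. G (w # r # tl (map (\<lambda>g. g e) gs)))
      (hd (map (\<lambda>g. g e) gs)))"
    using hs(1) by simp
qed

text \<open>Unbounded search in \<open>M\<close>, with default value 0 so that it is total also when a minimization that
  succeeds on standard arguments fails on nonstandard ones.\<close>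

definition mu :: "('a \<Rightarrow> 'a) \<Rightarrow> 'a" where
  "mu F = (if \<exists>y. F y = \<zero> then THE y. F y = \<zero> \<and> (\<forall>z. z \<prec> y \<longrightarrow> F z \<noteq> \<zero>) else \<zero>)"

lemma mu_eqI: "F y = \<zero> \<Longrightarrow> (\<And>z. z \<prec> y \<Longrightarrow> F z \<noteq> \<zero>) \<Longrightarrow> mu F = y"
  unfolding mu_def by (auto intro!: the_equality) (metis linorder_cases)

lemma mu_iff:
  assumes "dfun (\<lambda>e. F (e 0))"
  shows "y = mu F \<longleftrightarrow> (F y = \<zero> \<and> (\<forall>z. z \<prec> y \<longrightarrow> F z \<noteq> \<zero>)) \<or> ((\<forall>z. F z \<noteq> \<zero>) \<and> y = \<zero>)"
proof (cases "\<exists>z. F z = \<zero>")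
  case True
  moreover have "dfn (\<lambda>e. F (e 0) = \<zero>)" by (intro dfn_intros assms)
  ultimately obtain x where "F x = \<zero>" "\<forall>z. z \<prec> x \<longrightarrow> F z \<noteq> \<zero>"
    using definable_least[of "\<lambda>x. F x = \<zero>"] by blast
  then show ?thesis using mu_eqI[of F x] mu_eqI[of F y] by metis
qed (auto simp: mu_def)

lemma dfun_list_mu:
  assumes F: "dfun_list (Suc n) F"
  shows "dfun_list n (\<lambda>xs. mu (\<lambda>y. F (y # xs)))"
  unfolding dfun_list_def
proof (intro allI impI)
  fix gs :: "((nat \<Rightarrow> 'a) \<Rightarrow> 'a) list"
  assume gs: "length gs = n \<and> (\<forall>g\<in>set gs. dfun g)"
  have F': "dfun (\<lambda>e. F (f e # map (\<lambda>g. g (\<lambda>i. e (\<rho> i))) gs))" if "dfun f" for f \<rho>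
    using dfun_listD_rename[OF F, of "[f]" gs \<rho>] gs that by simp
  have F'': "dfun (\<lambda>e. F (e 0 # map (\<lambda>g. g e') gs))" for e'
    using dfun_listD_const[OF F, of "[\<lambda>e. e 0]" "map (\<lambda>g. g e') gs"] gs dfun_var by simp
  show "dfun (\<lambda>e. mu (\<lambda>y. F (y # map (\<lambda>g. g e) gs)))"
    unfolding dfun_def mu_iff[OF F'']
    by (intro dfn_intros F'[OF dfun_var, of 0 Suc] F'[OF dfun_var, of 0 "\<lambda>i. Suc (Suc i)"])
qed

definition represents :: "nat \<Rightarrow> ('a list \<Rightarrow> 'a) \<Rightarrow> (nat list \<Rightarrow> nat) \<Rightarrow> bool" where
  "represents n F f \<longleftrightarrow> dfun_list n F \<and> (\<forall>xs. length xs = n \<longrightarrow> F (map std xs) = std (f xs))"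

text \<open>The recursion scheme of the function is copied inside \<open>M\<close>. On standard arguments the copy agrees
  because \<open>iter\<close> is computed stepwise, and because a standard zero found by \<open>mu\<close> has only standard elements
  below it.\<close>

lemma recfun_represented: "recfun n f \<Longrightarrow> \<exists>F. represents n F f"
proof (induction rule: recfun.induct)
  case (zero n)
  show ?case
    by (rule exI[of _ "\<lambda>_. \<zero>"]) (auto simp: represents_def dfun_list_def intro: dfun_const)
next
  case succ
  have "dfun_list 1 (\<lambda>xs. S (xs ! 0))" by (auto simp: dfun_list_def nth_map intro!: dfun_S)
  then show ?case by (intro exI[of _ "\<lambda>xs. S (xs ! 0)"]) (simp add: represents_def)
next
  case (proj i n)
  then have "dfun_list n (\<lambda>xs. xs ! i)" by (auto simp: dfun_list_def)
  with proj show ?case by (intro exI[of _ "\<lambda>xs. xs ! i"]) (simp add: represents_def)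
next
  case (comp gs f n)
  obtain F where F: "represents (length gs) F f" using comp.IH(1) by blast
  have "\<forall>g\<in>set gs. \<exists>G. represents n G g" using comp.IH(2) by blast
  then obtain G where G: "\<And>g. g \<in> set gs \<Longrightarrow> represents n (G g) g" by metis
  have "dfun_list n (\<lambda>xs. F (map (\<lambda>g. G g xs) gs))"
    using F G by (intro dfun_list_comp) (auto simp: represents_def)
  moreover have "F (map (\<lambda>g. G g (map std xs)) gs) = std (f (map (\<lambda>g. g xs) gs))"
    if "length xs = n" for xs
  proof -
    have "map (\<lambda>g. G g (map std xs)) gs = map std (map (\<lambda>g. g xs) gs)"
      using G that by (auto simp: represents_def)
    moreover have "F (map std (map (\<lambda>g. g xs) gs)) = std (f (map (\<lambda>g. g xs) gs))"
      using F by (simp add: represents_def del: map_map)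
    ultimately show ?thesis by (simp only:)
  qed
  ultimately show ?case
    by (intro exI[of _ "\<lambda>xs. F (map (\<lambda>g. G g xs) gs)"]) (simp add: represents_def)
next
  case (prim_rec n f g)
  then obtain F G where F: "represents n F f" and G: "represents (Suc (Suc n)) G g" by blast
  let ?I = "\<lambda>xs. iter (F (tl xs)) (\<lambda>w r. G (w # r # tl xs)) (hd xs)"
  have "?I (map std xs) = std (rec_nat (f (tl xs)) (\<lambda>y r. g (y # r # tl xs)) (hd xs))"
    if len: "length xs = Suc n" for xs
  proof -
    obtain k ys where xs: "xs = k # ys" "length ys = n" using len by (cases xs) auto
    have "dfun (\<lambda>e. G (map (\<lambda>f. f e) [\<lambda>e. e 0, \<lambda>e. e 1] @ map std ys))"
      by (rule dfun_listD_const[of "Suc (Suc n)"]) (use G xs dfun_var in \<open>auto simp: represents_def\<close>)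
    then have d: "dfun (\<lambda>e. G (e 0 # e 1 # map std ys))" by simp
    have "iter (F (map std ys)) (\<lambda>w r. G (w # r # map std ys)) (std k) =
        std (rec_nat (f ys) (\<lambda>y r. g (y # r # ys)) k)"
    proof (induction k)
      case 0
      show ?case using F xs by (simp add: iter_simps(1)[OF d] represents_def)
    next
      case (Suc k)
      have "G (map std (m # r # ys)) = std (g (m # r # ys))" for m r
        using G xs(2) unfolding represents_def by (metis length_Cons)
      then show ?case using Suc.IH by (simp add: iter_simps(2)[OF d])
    qed
    with xs show ?thesis by simp
  qed
  moreover have "dfun_list (Suc n) ?I" using F G by (intro dfun_list_iter) (auto simp: represents_def)
  ultimately show ?case by (intro exI[of _ ?I]) (simp add: represents_def)
next
  case (minimization n f)
  then obtain F where F: "represents (Suc n) F f" by blast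
  have "mu (\<lambda>y. F (y # map std xs)) = std (LEAST y. f (y # xs) = 0)" if "length xs = n" for xs
  proof (rule mu_eqI)
    have F_std: "F (std y # map std xs) = std (f (y # xs))" for y
      using F that unfolding represents_def by (metis length_Cons list.simps(9))
    have "f ((LEAST y. f (y # xs) = 0) # xs) = 0"
      using minimization(2)[OF that] by (rule LeastI_ex)
    then show "F (std (LEAST y. f (y # xs) = 0) # map std xs) = \<zero>" by (simp add: F_std)
    fix z assume "z \<prec> std (LEAST y. f (y # xs) = 0)"
    then obtain m where "m < (LEAST y. f (y # xs) = 0)" "z = std m" using lt_std by blast
    then show "F (z # map std xs) \<noteq> \<zero>" using not_less_Least by (auto simp: F_std)
  qed
  moreover have "dfun_list n (\<lambda>xs. mu (\<lambda>y. F (y # xs)))"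
    using F by (intro dfun_list_mu) (simp add: represents_def)
  ultimately show ?case
    by (intro exI[of _ "\<lambda>xs. mu (\<lambda>y. F (y # xs))"]) (simp add: represents_def)
qed

lemma recursive_set_definable:
  assumes "recursive_set A"
  obtains \<alpha> where "dfn (\<lambda>e. \<alpha> (e 0))" "\<And>n. \<alpha> (std n) \<longleftrightarrow> n \<in> A"
proof -
  obtain f where f: "recfun 1 f" "\<And>n. f [n] = (if n \<in> A then 1 else 0)"
    using assms unfolding recursive_set_def by blast
  obtain F where F: "dfun_list 1 F" "\<And>xs. length xs = 1 \<Longrightarrow> F (map std xs) = std (f xs)"
    using recfun_represented[OF f(1)] unfolding represents_def by blast
  have "dfun (\<lambda>e. F [e 0])" using dfun_listD[OF F(1), of "[\<lambda>e. e 0]"] dfun_var by simp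
  then have "dfn (\<lambda>e. F [e 0] = S \<zero>)" by (intro dfn_intros)
  moreover have "F [std n] = S \<zero> \<longleftrightarrow> n \<in> A" for n using F(2)[of "[n]"] f(2) by simp
  ultimately show ?thesis by (rule that)
qed

end

section \<open>The truth axioms in the model\<close>

lemma satT_emb [simp]: "satT M T e (emb p) \<longleftrightarrow> sat M e p"
  by (induction p arbitrary: e) simp_all

lemma schemeT_simps [simp]:
  "\<langle>A\<rangle> n = emb (A n)" "tTr t n = TrT t" "(\<^bold>\<not>\<^sub>T B) n = NegT (B n)"
  "(B \<^bold>\<or>\<^sub>T C) n = OrT (B n) (C n)" "tEx F n = ExiT n (F (Var n) (Suc n))"
  by (simp_all add: arith_def tTr_def tNot_def tOr_def tEx_def)

locale pt_model = pa_model M for M :: "'a arith_struct" +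
  fixes T :: "'a set"
  assumes models_PT: "modelsT M T (PT_minus \<union> {INT_tot})"
begin

lemma PT_sat: "p \<in> {PT1a, PT1b, PT2a, PT2b, PT3a, PT3b, PT4, INT_tot} \<Longrightarrow> satT M T e p"
  using models_PT unfolding modelsT_def PT_minus_def by blast

lemmas PT_simps = tTrOf_def NegOf_def code_defs

lemma T_eq:
  assumes "closedM s" "closedM t"
  shows "mEq s t \<in> T \<longleftrightarrow> (\<exists>x. valM s x \<and> valM t x)"
    and "mNeg (mEq s t) \<in> T \<longleftrightarrow> (\<nexists>x. valM s x \<and> valM t x)"
proof -
  have "\<forall>s. \<forall>t. closedM s \<and> closedM t \<longrightarrow> (mEq s t \<in> T \<longleftrightarrow> (\<exists>x. valM s x \<and> valM t x))"
    using PT_sat[of PT1a "\<lambda>_. \<zero>"] by (simp add: PT1a_def PT_simps) blast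
  then show "mEq s t \<in> T \<longleftrightarrow> (\<exists>x. valM s x \<and> valM t x)" using assms by blast
  have "\<forall>s. \<forall>t. closedM s \<and> closedM t \<longrightarrow> (mNeg (mEq s t) \<in> T \<longleftrightarrow> (\<nexists>x. valM s x \<and> valM t x))"
    using PT_sat[of PT1b "\<lambda>_. \<zero>"] by (simp add: PT1b_def PT_simps) blast
  then show "mNeg (mEq s t) \<in> T \<longleftrightarrow> (\<nexists>x. valM s x \<and> valM t x)" using assms by blast
qed

lemma T_or:
  assumes "sentM p" "sentM q"
  shows "mOr p q \<in> T \<longleftrightarrow> p \<in> T \<or> q \<in> T"
    and "mNeg (mOr p q) \<in> T \<longleftrightarrow> mNeg p \<in> T \<and> mNeg q \<in> T"
proof -
  have "\<forall>p. \<forall>q. sentM p \<and> sentM q \<longrightarrow> (mOr p q \<in> T \<longleftrightarrow> p \<in> T \<or> q \<in> T)"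
    using PT_sat[of PT2a "\<lambda>_. \<zero>"] by (simp add: PT2a_def PT_simps) blast
  then show "mOr p q \<in> T \<longleftrightarrow> p \<in> T \<or> q \<in> T" using assms by blast
  have "\<forall>p. \<forall>q. sentM p \<and> sentM q \<longrightarrow> (mNeg (mOr p q) \<in> T \<longleftrightarrow> mNeg p \<in> T \<and> mNeg q \<in> T)"
    using PT_sat[of PT2b "\<lambda>_. \<zero>"] by (simp add: PT2b_def PT_simps) blast
  then show "mNeg (mOr p q) \<in> T \<longleftrightarrow> mNeg p \<in> T \<and> mNeg q \<in> T" using assms by blast
qed

lemma T_neg: assumes "sentM p" shows "mNeg (mNeg p) \<in> T \<longleftrightarrow> p \<in> T"
proof -
  have "\<forall>p. sentM p \<longrightarrow> (mNeg (mNeg p) \<in> T \<longleftrightarrow> p \<in> T)"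
    using PT_sat[of PT4 "\<lambda>_. \<zero>"] by (simp add: PT4_def PT_simps) blast
  then show ?thesis using assms by blast
qed

lemma T_ex:
  assumes "form1M v p"
  shows "mEx v p \<in> T \<longleftrightarrow> (\<exists>x. msub v x p \<in> T)"
    and "mNeg (mEx v p) \<in> T \<longleftrightarrow> (\<forall>x. mNeg (msub v x p) \<in> T)"
proof -
  have p: "instM p v x z \<longleftrightarrow> z = msub v x p" for x z
    using assms by (simp add: instM_def form1M_def substM_msub_form numM_eq)
  have "\<forall>v. \<forall>p. form1M v p \<longrightarrow>
      (mEx v p \<in> T \<longleftrightarrow> (\<exists>x. \<exists>z. instM p v x z \<and> z \<in> T))"
    using PT_sat[of PT3a "\<lambda>_. \<zero>"] by (simp add: PT3a_def PT_simps) blast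
  then show "mEx v p \<in> T \<longleftrightarrow> (\<exists>x. msub v x p \<in> T)" using assms by (simp add: p)
  have "\<forall>v. \<forall>p. form1M v p \<longrightarrow>
      (mNeg (mEx v p) \<in> T \<longleftrightarrow> (\<forall>x. \<exists>z. instM p v x z \<and> mNeg z \<in> T))"
    using PT_sat[of PT3b "\<lambda>_. \<zero>"] by (simp add: PT3b_def PT_simps) blast
  then show "mNeg (mEx v p) \<in> T \<longleftrightarrow> (\<forall>x. mNeg (msub v x p) \<in> T)" using assms by (simp add: p)
qed

lemma T_induct:
  assumes "form1M v p" and "\<And>x. msub v x p \<in> T \<or> mNeg (msub v x p) \<in> T"
    and "\<And>x. msub v x p \<in> T \<Longrightarrow> msub v (S x) p \<in> T" and "msub v \<zero> p \<in> T"
  shows "msub v x p \<in> T"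
proof -
  have p: "instM p v x z \<longleftrightarrow> z = msub v x p" for x z
    using assms(1) by (simp add: instM_def form1M_def substM_msub_form numM_eq)
  have "form1M v p \<longrightarrow> (\<forall>x. msub v x p \<in> T \<or> mNeg (msub v x p) \<in> T) \<longrightarrow>
      (\<forall>x. msub v x p \<in> T \<longrightarrow> msub v (S x) p \<in> T) \<longrightarrow> msub v \<zero> p \<in> T \<longrightarrow> (\<forall>x. msub v x p \<in> T)"
    using PT_sat[of INT_tot "\<lambda>i. \<zero>"]
    apply (simp add: INT_tot_def tot_def PT_simps)
    apply (drule spec[of _ v])
    apply (drule spec[of _ p])
    apply (simp add: p)
    apply blast
    done
  then show ?thesis using assms by blast
qed

end

section \<open>Truth of standard formulae\<close>

context pa_model
begin

text \<open>Substituting first for the other variables and last for \<open>i\<close> is what the truth axioms do with a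
  quantifier over \<open>i\<close>.\<close>

lemma env_snoc_filter: "env (filter (\<lambda>b. fst b \<noteq> i) l @ [(i, a)]) = (env l)(i := a)"
proof
  fix j
  have "map_of (filter (\<lambda>b. fst b \<noteq> i) l) j = (if j = i then None else map_of l j)"
    by (induction l) auto
  then show "env (filter (\<lambda>b. fst b \<noteq> i) l @ [(i, a)]) j = ((env l)(i := a)) j"
    by (auto simp: env_def map_add_def split: option.split)
qed

lemma sentM_msubst_std: "fv p \<subseteq> fst ` set l \<Longrightarrow> sentM (msubst l (std (fcode p)))"
  unfolding sentM_def by (auto simp: freeM_msubst_form freeM_std_form)

text \<open>The free variables of \<open>x\<close> have indices below \<open>k\<close>. In contrast to an external list of variables this is
  definable in \<open>M\<close> and can be carried through inductions.\<close>

definition free_below :: "'a \<Rightarrow> 'a \<Rightarrow> bool" where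
  "free_below k x \<longleftrightarrow> (\<forall>u. freeM u x \<longrightarrow> (\<exists>i. i \<prec> k \<and> u = mVar i))"

lemma dfn_free_below: "dfun f \<Longrightarrow> dfun g \<Longrightarrow> dfn (\<lambda>e. free_below (f e) (g e))"
  by (rule dfn_app2) (unfold free_below_def, intro dfn_intros dfn_freeM)

lemma free_below_std: "free_below (std n) x \<Longrightarrow> freeM u x \<Longrightarrow> \<exists>i<n. u = vr i"
  unfolding free_below_def using lt_std by metis

lemma sentM_msubst_below:
  assumes "formM x" "free_below (std n) x" "{..<n} \<subseteq> fst ` set l"
  shows "sentM (msubst l x)"
proof -
  have "u \<in> vr ` fst ` set l" if "freeM u x" for u
  proof -
    obtain i where "i < n" "u = vr i" using free_below_std[OF assms(2) \<open>freeM u x\<close>] by blast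
    moreover have "i \<in> fst ` set l" using assms(3) \<open>i < n\<close> by blast
    ultimately show ?thesis by blast
  qed
  with assms(1) show ?thesis by (auto simp: sentM_def freeM_msubst_form)
qed

end

context pt_model
begin

text \<open>Truth agrees with satisfaction on standard formulae with arbitrary, possibly nonstandard, numerals.
  The statement about the negation is proved along with it, since the axioms are positive and \<open>T\<close>
  need not commute with negation in general.\<close>

lemma truth_of_standard:
  assumes "fv p \<subseteq> fst ` set l"
  shows "(msubst l (std (fcode p)) \<in> T \<longleftrightarrow> sat M (env l) p) \<and>
    (mNeg (msubst l (std (fcode p))) \<in> T \<longleftrightarrow> \<not> sat M (env l) p)"
  using assms
proof (induction p arbitrary: l)
  case (Equ s t)
  then show ?case by (auto simp: T_eq closedM_msubst valM_msubst)
next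
  case (Neg p)
  then show ?case by (simp add: T_neg sentM_msubst_std)
next
  case (Or p q)
  then show ?case by (simp add: T_or sentM_msubst_std)
next
  case (Exi i p)
  let ?l = "filter (\<lambda>b. fst b \<noteq> i) l"
  have f: "form1M (vr i) (msubst ?l (std (fcode p)))"
    using Exi.prems by (force simp: form1M_def freeM_msubst_form freeM_std_form)
  have msub: "msub (vr i) a (msubst ?l (std (fcode p))) = msubst (?l @ [(i, a)]) (std (fcode p))" for a
    by (simp add: msubst_append)
  have "fv p \<subseteq> fst ` set (?l @ [(i, a)])" for a using Exi.prems by force
  note IH = Exi.IH[OF this]
  show ?case
    using T_ex[OF f] IH by (simp add: msub env_snoc_filter del: fun_upd_apply)
qed

end


section \<open>A conjunction of nonstandard length\<close>

context pa_model
begin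

text \<open>The negation of \<open>\<Psi> n \<and> (y = n \<or> \<not> r)\<close>. Each layer is kept in negated form because only negation,
  disjunction and existential quantification are primitive.\<close>

definition link :: "('a \<Rightarrow> 'a) \<Rightarrow> 'a \<Rightarrow> 'a \<Rightarrow> 'a \<Rightarrow> 'a" where
  "link \<Psi> y n r = mOr (mNeg (\<Psi> n)) (mNeg (mOr (mEq y (mnum n)) (mNeg r)))"

text \<open>Recursion inside \<open>M\<close> runs upwards, whereas the conjunction is built from its end at \<open>c\<close> back to 0.
  So step \<open>k + 1\<close> of the recursion adds the layer \<open>n\<close> with \<open>n + k + 1 = c\<close>. The layers
  with standard index \<open>n\<close> never come to an end, since \<open>c\<close> is nonstandard.\<close>

lemma chain_exists:
  assumes \<Psi>: "dfun (\<lambda>e. \<Psi> (e 0))" "\<And>n. formM (\<Psi> n)" "\<And>n. free_below (std K) (\<Psi> n)"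
    and c: "\<And>n. c \<noteq> std n"
  obtains \<rho> where "\<And>n. formM (\<rho> n)" "\<And>n. free_below (std (Suc K)) (\<rho> n)"
    "\<And>n. \<rho> n = link \<Psi> (vr K) (std n) (\<rho> (Suc n))"
proof -
  \<comment> \<open>The layer added at step \<open>k + 1\<close>. Beyond the range the value is 0, and the
    layers with standard index lie within it.\<close>
  define position where "position k = (if \<exists>n. n \<oplus> S k = c then THE n. n \<oplus> S k = c else \<zero>)" for k
  have position_eq: "position k = n" if "n \<oplus> S k = c" for n k
    unfolding position_def using that by (auto intro!: the_equality)
  have position_iff: "y = position k \<longleftrightarrow> y \<oplus> S k = c \<or> ((\<forall>n. n \<oplus> S k \<noteq> c) \<and> y = \<zero>)" for y k
    using position_eq position_def by metis
  have dfun_position: "dfun (\<lambda>e. position (f e))" if "dfun f" for f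
    by (rule dfun_app1[OF _ that]) (unfold dfun_def position_iff, intro dfn_intros)
  define G where "G k r = link \<Psi> (vr K) (position k) r" for k r
  define h where "h = iter (std (fcode (Equ Zero Zero))) G"
  have G: "dfun (\<lambda>e. G (e 0) (e 1))"
    unfolding G_def link_def by (intro dfun_pr dfun_const dfun_var dfun_mnum dfun_position dfun_app1[OF \<Psi>(1)])
  have h: "h \<zero> = std (fcode (Equ Zero Zero))" "\<And>k. h (S k) = G k (h k)"
    unfolding h_def by (rule iter_simps[OF G])+
  have dfun_h: "dfun (\<lambda>e. h (e 0))"
    unfolding h_def using dfun_iter[of "\<lambda>_. G", OF G dfun_const dfun_var] .
  have inv: "formM (h k) \<and> free_below (std (Suc K)) (h k)" for k
  proof (rule definable_induct[of "\<lambda>k. formM (h k) \<and> free_below (std (Suc K)) (h k)"])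
    show "dfn (\<lambda>e. formM (h (e 0)) \<and> free_below (std (Suc K)) (h (e 0)))"
      by (intro dfn_intros dfn_formM dfn_free_below dfun_h)
    show "formM (h \<zero>) \<and> free_below (std (Suc K)) (h \<zero>)"
      by (simp add: h(1) free_below_def)
  next
    fix k assume IH: "formM (h k) \<and> free_below (std (Suc K)) (h k)"
    have "free_below (std (Suc K)) (\<Psi> n)" for n
      using \<Psi>(3)[of n] unfolding free_below_def by (metis lt_S less_imp_le std.simps(2))
    with IH show "formM (h (S k)) \<and> free_below (std (Suc K)) (h (S k))"
      using \<Psi>(2) by (auto simp: h(2) G_def link_def free_below_def)
  qed
  have "\<exists>k. std n \<oplus> k = c" for n
    using lt_std[of c n] c le_or_lt[of "std n" c] unfolding le_def by blast
  then obtain k where k: "\<And>n. std n \<oplus> k n = c" by metis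
  \<comment> \<open>Going to the next layer means going back by one step of the recursion.\<close>
  have kS: "k n = S (k (Suc n))" for n
  proof -
    have "std n \<oplus> k n = std n \<oplus> S (k (Suc n))" using k[of n] k[of "Suc n"] by simp
    then show ?thesis by (rule add_left_cancel[THEN iffD1])
  qed
  show ?thesis
  proof (rule that[of "\<lambda>n. h (k n)"])
    fix n
    show "formM (h (k n))" "free_below (std (Suc K)) (h (k n))" using inv by blast+
    have "position (k (Suc n)) = std n" using k[of n] by (intro position_eq) (simp flip: kS)
    then show "h (k n) = link \<Psi> (vr K) (std n) (h (k (Suc n)))"
      by (subst kS) (simp add: h(2) G_def)
  qed
qed

end

context pt_model
begin

text \<open>One layer of the unravelling. Both statements are needed because \<open>r\<close> has nonstandard length and need
  not be decided by \<open>T\<close>.\<close>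

lemma truth_of_link:
  assumes \<Psi>: "\<Psi> (std n) = std (fcode p)" "fv p \<subseteq> {..<K}"
    and r: "formM r" "free_below (std (Suc K)) r" and l: "{..K} \<subseteq> fst ` set l"
  shows "msubst l (link \<Psi> (vr K) (std n) r) \<in> T \<longleftrightarrow>
      \<not> sat M (env l) p \<or> (env l K \<noteq> std n \<and> msubst l r \<in> T)"
    and "mNeg (msubst l (link \<Psi> (vr K) (std n) r)) \<in> T \<longleftrightarrow>
      sat M (env l) p \<and> (env l K = std n \<or> mNeg (msubst l r) \<in> T)"
proof -
  let ?q = "Equ (Var K) (num n)"
  have num: "fvt (num n) = {}" by (induction n) simp_all
  have link: "link \<Psi> (vr K) (std n) r = mOr (mNeg (std (fcode p))) (mNeg (mOr (std (fcode ?q)) (mNeg r)))"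
    by (simp add: link_def \<Psi>(1) mnum_std)
  have pK: "fv p \<subseteq> {..K}" using \<Psi>(2) by fastforce
  have p: "fv p \<subseteq> fst ` set l" and q: "fv ?q \<subseteq> fst ` set l" 
    using subset_trans[OF pK l] subset_trans[OF _ l, of "{K}"] num by auto
  have "sentM (msubst l r)" by (rule sentM_msubst_below[OF r]) (use l in \<open>simp add: lessThan_Suc_atMost\<close>)
  note sent = this sentM_msubst_std[OF p] sentM_msubst_std[OF q]
  have sentN: "sentM (mNeg x)" if "sentM x" for x using that by (simp add: sentM_def)
  have sentO: "sentM (mOr x y)" if "sentM x" "sentM y" for x y using that by (simp add: sentM_def)
  have msubst: "msubst l (link \<Psi> (vr K) (std n) r) =
      mOr (mNeg (msubst l (std (fcode p)))) (mNeg (mOr (msubst l (std (fcode ?q))) (mNeg (msubst l r))))"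
    unfolding link using r(1) by (simp del: std_fcode)
  note simps = T_or T_neg sent sentN sentO truth_of_standard[OF p] truth_of_standard[OF q]
  show "msubst l (link \<Psi> (vr K) (std n) r) \<in> T \<longleftrightarrow>
      \<not> sat M (env l) p \<or> (env l K \<noteq> std n \<and> msubst l r \<in> T)"
    "mNeg (msubst l (link \<Psi> (vr K) (std n) r)) \<in> T \<longleftrightarrow>
      sat M (env l) p \<and> (env l K = std n \<or> mNeg (msubst l r) \<in> T)"
    unfolding msubst by (simp_all add: simps del: std_fcode)
qed

end

section \<open>Realising recursive types\<close>

context pt_model
begin

text \<open>If the type were omitted, \<open>\<Theta>\<close> would be a total formula true of exactly the standard numbers, which
  internal induction excludes.\<close>

lemma nonstandard_realises:
  assumes c: "\<And>n. c \<noteq> std n" and type: "recursive_type M e x p"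
  shows "realised M e x p"
proof (rule ccontr)
  assume omitted: "\<not> realised M e x p"
  have "finite (insert x (\<Union>\<phi>\<in>p. fv \<phi>))" using type by (simp add: recursive_type_def)
  then obtain K where K: "\<And>i. i \<in> insert x (\<Union>\<phi>\<in>p. fv \<phi>) \<Longrightarrow> i < K"
    unfolding finite_nat_set_iff_bounded by blast
  have xK: "x < K" and fvK: "\<And>\<phi>. \<phi> \<in> p \<Longrightarrow> fv \<phi> \<subseteq> {..<K}" using K by auto
  \<comment> \<open>Recursiveness enters here: \<open>M\<close> decides membership of standard codes in the
    type.\<close>
  obtain \<alpha> where \<alpha>: "dfn (\<lambda>e. \<alpha> (e 0))" "\<And>n. \<alpha> (std n) \<longleftrightarrow> n \<in> fcode ` p"
    using recursive_set_definable type unfolding recursive_type_def by blast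
  define \<chi> where "\<chi> n = (if n \<in> fcode ` p then inv_into p fcode n else Equ Zero Zero)" for n
  have \<chi>_fcode: "\<chi> (fcode \<phi>) = \<phi>" if "\<phi> \<in> p" for \<phi>
    using that fcode_inject by (simp add: \<chi>_def inv_into_f_f inj_on_def)
  have \<chi>_cases: "\<chi> n = Equ Zero Zero \<or> (\<chi> n \<in> p \<and> fcode (\<chi> n) = n)" for n
    by (auto simp: \<chi>_def inv_into_into f_inv_into_f)
  have fv\<chi>: "fv (\<chi> n) \<subseteq> {..<K}" for n using \<chi>_cases[of n] fvK by auto
  define proper where "proper n \<longleftrightarrow> \<alpha> n \<and> formM n \<and> free_below (std K) n" for n
  \<comment> \<open>At nonstandard \<open>n\<close> the answer of \<open>\<alpha>\<close> is meaningless, so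
    the syntactic conditions are imposed separately; a harmless truth serves as the default.\<close>
  define \<Psi> where "\<Psi> n = (if proper n then n else std (fcode (Equ Zero Zero)))" for n
  have dfn_proper: "dfn (\<lambda>e. proper (e 0))"
    unfolding proper_def by (intro dfn_intros \<alpha>(1) dfn_formM dfn_free_below)
  have "y = \<Psi> n \<longleftrightarrow> (proper n \<and> y = n) \<or> (\<not> proper n \<and> y = std (fcode (Equ Zero Zero)))" for y n
    by (auto simp: \<Psi>_def)
  then have dfun_\<Psi>: "dfun (\<lambda>e. \<Psi> (e 0))"
    unfolding dfun_def by (simp only:) (intro dfn_intros dfn_app1[OF dfn_proper])
  have form_\<Psi>: "formM (\<Psi> n)" "free_below (std K) (\<Psi> n)" for n
    by (auto simp: \<Psi>_def proper_def free_below_def)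
  have \<Psi>_std: "\<Psi> (std n) = std (fcode (\<chi> n))" for n
  proof (cases "n \<in> fcode ` p")
    case True
    then obtain \<phi> where \<phi>: "\<phi> \<in> p" "n = fcode \<phi>" by blast
    then have "i < K" if "i \<in> fv \<phi>" for i using fvK that by blast
    moreover have "i < K \<Longrightarrow> std i \<prec> std K" for i
      by (induction K) (auto simp: le_less less_Suc_eq)
    ultimately have "proper n'" if "n' = std (fcode \<phi>)" for n'
      using \<alpha>(2)[of n] True \<phi>(2) that by (auto simp: proper_def free_below_def freeM_std_form simp del: std_fcode)
    then show ?thesis by (simp add: \<phi> \<chi>_fcode \<Psi>_def)
  next
    case False
    then show ?thesis using \<alpha>(2) by (simp add: \<Psi>_def proper_def \<chi>_def)
  qed
  obtain \<rho> where \<rho>: "\<And>n. formM (\<rho> n)" "\<And>n. free_below (std (Suc K)) (\<rho> n)"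
      "\<And>n. \<rho> n = link \<Psi> (vr K) (std n) (\<rho> (Suc n))"
    using chain_exists[OF dfun_\<Psi> form_\<Psi> c] by metis
  \<comment> \<open>The variables below \<open>K\<close> receive their parameters, and the fresh variable
    \<open>K\<close> is the \<open>y\<close> of the nested conjunction. In \<open>L d b\<close> the value
    \<open>b\<close> replaces the parameter at \<open>x\<close>.\<close>
  define l where "l d = map (\<lambda>i. (i, e i)) [0..<K] @ [(K, d)]" for d
  define L where "L d b = filter (\<lambda>q. fst q \<noteq> x) (l d) @ [(x, b)]" for d b
  have dom: "{..K} \<subseteq> fst ` set (L d b)" for d b
    using xK by (force simp: L_def l_def)
  have env_l: "env (l d) i = (if i < K then e i else if i = K then d else \<zero>)" for d i
  proof -
    have "map_of (map (\<lambda>i. (i, e i)) xs) i = (if i \<in> set xs then Some (e i) else None)" for xs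
      by (induction xs) auto
    then show ?thesis by (auto simp: env_def l_def map_add_def)
  qed
  have env_K: "env (L d b) K = d" for d b
    using xK by (simp add: L_def env_snoc_filter env_l)
  have sat_\<chi>: "sat M (env (L d b)) (\<chi> n) \<longleftrightarrow> sat M (e(x := b)) (\<chi> n)" for d b n
    using fv\<chi>[of n] by (intro sat_cong) (auto simp: L_def env_snoc_filter env_l)
  have link: "msubst (L d b) (\<rho> n) \<in> T \<longleftrightarrow>
        \<not> sat M (e(x := b)) (\<chi> n) \<or> (d \<noteq> std n \<and> msubst (L d b) (\<rho> (Suc n)) \<in> T)"
      "mNeg (msubst (L d b) (\<rho> n)) \<in> T \<longleftrightarrow>
        sat M (e(x := b)) (\<chi> n) \<and> (d = std n \<or> mNeg (msubst (L d b) (\<rho> (Suc n))) \<in> T)" for d b n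
    using truth_of_link[of \<Psi> n "\<chi> n" K "\<rho> (Suc n)" "L d b", OF \<Psi>_std fv\<chi> \<rho>(1) \<rho>(2) dom]
    unfolding \<rho>(3)[of n] env_K sat_\<chi> by blast+
  \<comment> \<open>The list contains \<open>x\<close> too, which does no harm because \<open>x\<close> is
    bound.\<close>
  define \<Theta> where "\<Theta> = msubst (map (\<lambda>i. (i, e i)) [0..<K]) (mEx (vr x) (mNeg (\<rho> 0)))"
  have f\<Theta>: "form1M (vr K) \<Theta>"
  proof -
    have "u = vr K" if "freeM u (\<rho> 0)" "u \<notin> vr ` {0..<K}" for u
      using free_below_std[OF \<rho>(2) that(1)] that(2) less_Suc_eq by auto
    then show ?thesis
      using \<rho>(1) xK by (auto simp: \<Theta>_def form1M_def freeM_msubst_form image_image simp del: msubst_ex)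
  qed
  have msub\<Theta>: "msub (vr K) d \<Theta> = mEx (vr x) (msubst (filter (\<lambda>q. fst q \<noteq> x) (l d)) (mNeg (\<rho> 0)))" for d
  proof -
    have "msub (vr K) d \<Theta> = msubst (l d) (mEx (vr x) (mNeg (\<rho> 0)))" by (simp add: \<Theta>_def l_def msubst_append)
    then show ?thesis using \<rho>(1) by simp
  qed
  have f1: "form1M (vr x) (msubst (filter (\<lambda>q. fst q \<noteq> x) (l d)) (mNeg (\<rho> 0)))" for d
  proof -
    have "u = vr x" if u: "freeM u (\<rho> 0)" "u \<notin> vr ` fst ` set (filter (\<lambda>q. fst q \<noteq> x) (l d))" for u
    proof -
      obtain i where "i < Suc K" "u = vr i" using free_below_std[OF \<rho>(2) u(1)] by blast
      moreover have "i \<in> fst ` set (L d d)" using dom[of d d] \<open>i < Suc K\<close> by auto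
      then have "i = x \<or> i \<in> fst ` set (filter (\<lambda>q. fst q \<noteq> x) (l d))" by (auto simp: L_def)
      ultimately show ?thesis using u(2) by blast
    qed
    then show ?thesis using \<rho>(1) by (auto simp: form1M_def freeM_msubst_form)
  qed
  have sbL: "msub (vr x) b (msubst (filter (\<lambda>q. fst q \<noteq> x) (l d)) (mNeg (\<rho> 0))) = mNeg (msubst (L d b) (\<rho> 0))"
    for d b
  proof -
    have "msub (vr x) b (msubst (filter (\<lambda>q. fst q \<noteq> x) (l d)) (mNeg (\<rho> 0))) = msubst (L d b) (mNeg (\<rho> 0))"
      by (simp only: L_def msubst_append msubst.simps fst_conv snd_conv)
    then show ?thesis by (simp only: msubst_form(2)[OF \<rho>(1)])
  qed
  have sentL: "sentM (msubst (L d b) (\<rho> 0))" for d b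
    by (rule sentM_msubst_below[OF \<rho>(1,2)]) (simp only: lessThan_Suc_atMost dom)
  have T\<Theta>: "msub (vr K) d \<Theta> \<in> T \<longleftrightarrow> (\<exists>b. mNeg (msubst (L d b) (\<rho> 0)) \<in> T)" for d
    unfolding msub\<Theta> T_ex(1)[OF f1] sbL ..
  have Tn\<Theta>: "mNeg (msub (vr K) d \<Theta>) \<in> T \<longleftrightarrow> (\<forall>b. msubst (L d b) (\<rho> 0) \<in> T)" for d
    unfolding msub\<Theta> T_ex(2)[OF f1] sbL T_neg[OF sentL] ..
  \<comment> \<open>Finite satisfiability: finitely many codes are at most \<open>m\<close>.\<close>
  have std: "msub (vr K) (std m) \<Theta> \<in> T" for m
  proof -
    let ?q = "{\<phi> \<in> p. fcode \<phi> \<le> m}"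
    have "finite (fcode -` {..m})"
      by (rule finite_vimageI) (auto simp: inj_on_def fcode_inject)
    then have "finite ?q" by (rule rev_finite_subset) auto
    obtain b where b: "\<And>\<phi>. \<phi> \<in> p \<Longrightarrow> fcode \<phi> \<le> m \<Longrightarrow> sat M (e(x := b)) \<phi>"
    proof -
      from type \<open>finite ?q\<close> have "realised M e x ?q" by (simp add: recursive_type_def)
      then show ?thesis using that unfolding realised_def by blast
    qed
    have good: "sat M (e(x := b)) (\<chi> n)" if "n \<le> m" for n
    proof (rule disjE[OF \<chi>_cases[of n]])
      assume "\<chi> n \<in> p \<and> fcode (\<chi> n) = n"
      then show ?thesis using b[of "\<chi> n"] that by simp
    qed simp
    have "mNeg (msubst (L (std m) b) (\<rho> n)) \<in> T" if "n \<le> m" for n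
      using that
    proof (induction n rule: inc_induct)
      case base
      show ?case using link(2)[of "std m" b m] good by simp
    next
      case (step n)
      then show ?case using link(2)[of "std m" b n] good[of n] by simp
    qed
    then show ?thesis unfolding T\<Theta> by blast
  qed
  \<comment> \<open>Omission: a violated condition with standard code decides the nested conjunction
    negatively.\<close>
  have nonstd: "mNeg (msub (vr K) d \<Theta>) \<in> T" if d: "\<And>n. d \<noteq> std n" for d
    unfolding Tn\<Theta>
  proof
    fix b
    obtain \<phi> where \<phi>: "\<phi> \<in> p" "\<not> sat M (e(x := b)) \<phi>"
      using omitted unfolding realised_def by blast
    have "msubst (L d b) (\<rho> n) \<in> T" if "n \<le> fcode \<phi>" for n
      using that
    proof (induction n rule: inc_induct)
      case base
      show ?case using link(1)[of d b "fcode \<phi>"] \<phi> by (simp add: \<chi>_fcode)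
    next
      case (step n)
      then show ?case using link(1)[of d b n] d by simp
    qed
    then show "msubst (L d b) (\<rho> 0) \<in> T" by blast
  qed
  \<comment> \<open>Unravelling all standard layers of a true instance would realise the type.\<close>
  have only_std: "\<exists>n. d = std n" if true: "msub (vr K) d \<Theta> \<in> T" for d
  proof (rule ccontr)
    assume d: "\<nexists>n. d = std n"
    obtain b where b: "mNeg (msubst (L d b) (\<rho> 0)) \<in> T" using true unfolding T\<Theta> by blast
    have "mNeg (msubst (L d b) (\<rho> n)) \<in> T" for n
    proof (induction n)
      case (Suc n)
      then show ?case using link(2)[of d b n] d by simp
    qed (rule b)
    then have "sat M (e(x := b)) (\<chi> n)" for n using link(2)[of d b n] by simp
    then have "\<forall>\<phi>\<in>p. sat M (e(x := b)) \<phi>" using \<chi>_fcode by metis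
    with omitted show False unfolding realised_def by blast
  qed
  have "msub (vr K) c \<Theta> \<in> T"
  proof (rule T_induct[OF f\<Theta>])
    show "msub (vr K) d \<Theta> \<in> T \<or> mNeg (msub (vr K) d \<Theta>) \<in> T" for d using std nonstd by metis
    show "msub (vr K) d \<Theta> \<in> T \<Longrightarrow> msub (vr K) (S d) \<Theta> \<in> T" for d
      using only_std std by (metis std.simps(2))
    show "msub (vr K) \<zero> \<Theta> \<in> T" using std[of 0] by simp
  qed
  with only_std c show False by blast
qed

end

text \<open>If all elements are standard, \<open>x < a\<close> leaves finitely many candidates. If each of them violated some
  condition of the type, finitely many conditions would be jointly unsatisfiable.\<close>

lemma (in pa_model) standard_realises:
  fixes \<phi> :: "nat \<Rightarrow> fm"
  assumes standard: "\<And>b. \<exists>n. b = std n" and "x \<noteq> w"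
    and p: "p = {And (less_var x w) (\<phi> i) | i. True}"
    and type: "\<And>q. finite q \<Longrightarrow> q \<subseteq> p \<Longrightarrow> realised M e x q"
  shows "realised M e x p"
proof (rule ccontr)
  assume "\<not> realised M e x p"
  then have "\<forall>n. \<exists>\<psi>\<in>p. \<not> sat M (e(x := std n)) \<psi>" unfolding realised_def by blast
  then obtain f where f: "\<And>n. f n \<in> p" "\<And>n. \<not> sat M (e(x := std n)) (f n)" by metis
  obtain m where m: "e w = std m" using standard by blast
  \<comment> \<open>Some condition of the type has to be included in order to have the bound.\<close>
  let ?q = "insert (And (less_var x w) (\<phi> 0)) (f ` {..<m})"
  have "realised M e x ?q" using f(1) p by (intro type) auto
  then obtain b where b: "sat M (e(x := b)) (And (less_var x w) (\<phi> 0))"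
      "\<And>n. n < m \<Longrightarrow> sat M (e(x := b)) (f n)"
    unfolding realised_def by (auto simp del: fun_upd_apply)
  have "b \<prec> e w" using b(1) \<open>x \<noteq> w\<close> by (simp add: less_var_def)
  then obtain n where "n < m" "b = std n" using lt_std m by metis
  with b(2) f(2) show False by blast
qed

theorem theorem11:
  fixes M :: "'a arith_struct"
  assumes "models M PA"
    and "\<exists>T. modelsT M T (PT_minus \<union> {INT_tot})"
  shows "short_recursively_saturated M"
proof -
  obtain T where T: "modelsT M T (PT_minus \<union> {INT_tot})" using assms(2) by blast
  interpret pt_model M T by unfold_locales (rule assms(1), rule T)
  show ?thesis
    unfolding short_recursively_saturated_def
  proof (intro allI impI, elim conjE)
    fix e x w p and \<phi> :: "nat \<Rightarrow> fm"
    assume "x \<noteq> w" and p: "p = {And (less_var x w) (\<phi> i) | i. True}"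
      and type: "recursive_type M e x p"
    show "realised M e x p"
    proof (cases "\<exists>c. \<forall>n. c \<noteq> std n")
      case True
      then obtain c where "\<And>n. c \<noteq> std n" by blast
      then show ?thesis using type by (rule nonstandard_realises)
    next
      case False
      then have "\<And>b. \<exists>n. b = std n" by blast
      then show ?thesis
        by (rule standard_realises[OF _ \<open>x \<noteq> w\<close> p]) (use type in \<open>simp add: recursive_type_def\<close>)
    qed
  qed
qed

end
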